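(* Let $n\ge 1$ and let $K$ be either the Poisson kernel or the heat kernel on $\mathbb{R}^n$. For any non-negative measurable function $f$ on $\mathbb{R}$ and any numbers $\mu,\tilde\mu$ with $0<\tilde\mu<\mu$, we have $$\mathbf{B}_K(x;\tilde\mu,f,n)\le \mathbf{B}_*(x;\mu,f)\qquad\text{for all } x\in\Omega_{\tilde\mu}.$$
   Context: For $y\in\mathbb{R}^n$, $t>0$: $P_t(y)=\frac{\Gamma(\frac{n+1}2)}{\pi^{(n+1)/2}}\frac{t}{(t^2+|y|^2)^{(n+1)/2}}$ (Poisson kernel), $H_t(y)=(4\pi t)^{-n/2}e^{-|y|^2/(4t)}$ (heat kernel); $K_t$ denotes either one. For a sufficiently integrable $g$ on $\mathbb{R}^n$ and $z=(y,t)\in\mathbb{R}^{n+1}_+=\mathbb{R}^n\times(0,\infty)$, write $g(z):=(K_t*g)(y)$ (the $K$-extension/$K$-average); in particular $\varphi^2(z)$ means $(K_t*\varphi^2)(y)$ and $(f\circ\varphi)(z)=(K_t*(f\circ\varphi))(y)$. For a finite interval $I$ and $\eta$ on $I$, $\langle\eta\rangle_I=\frac1{|I|}\int_I\eta$ and $\|\eta\|_{*,I}=\sup_{J\subset I\text{ interval}}(\langle\eta^2\rangle_J-\langle\eta\rangle_J^2)^{1/2}$. For $\varphi\in L^1_{loc}(\mathbb{R}^n)$, $\|\varphi\|_K=\sup_{z\in\mathbb{R}^{n+1}_+}(\varphi^2(z)-\varphi(z)^2)^{1/2}$. For $\mu>0$, $\Omega_\mu=\{x=(x_1,x_2)\in\mathbb{R}^2: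 x_1^2\le x_2\le x_1^2+\mu^2\}$. Bellman functions: $\mathbf{B}_*(x;\mu,f)=\sup\{\langle f\circ\eta\rangle_I: \|\eta\|_{*,I}\le\mu,\ \langle\eta\rangle_I=x_1,\ \langle\eta^2\rangle_I=x_2\}$ (independent of the finite interval $I$), and $\mathbf{B}_K(x;\mu,f,n)=\sup\{(f\circ\varphi)(z): \|\varphi\|_K\le\mu,\ \varphi(z)=x_1,\ \varphi^2(z)=x_2\}$ (independent of $z\in\mathbb{R}^{n+1}_+$), both defined for $x\in\Omega_\mu$. *)

theory Defs
  imports "HOL-Analysis.Analysis"
begin

definition poisson_kernel :: "real \<Rightarrow> 'a::euclidean_space \<Rightarrow> real" where
  "poisson_kernel t y =
     Gamma ((real DIM('a) + 1) / 2) / pi powr ((real DIM('a) + 1) / 2)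
     * t / (t\<^sup>2 + (norm y)\<^sup>2) powr ((real DIM('a) + 1) / 2)"

definition heat_kernel :: "real \<Rightarrow> 'a::euclidean_space \<Rightarrow> real" where
  "heat_kernel t y = (4 * pi * t) powr (- real DIM('a) / 2) * exp (- (norm y)\<^sup>2 / (4 * t))"

definition Kext :: "(real \<Rightarrow> 'a::euclidean_space \<Rightarrow> real) \<Rightarrow> ('a \<Rightarrow> real) \<Rightarrow> 'a \<Rightarrow> real \<Rightarrow> real" where
  "Kext K g y t = (\<integral>w. K t (y - w) * g w \<partial>lborel)"

definition Kext_nn :: "(real \<Rightarrow> 'a::euclidean_space \<Rightarrow> real) \<Rightarrow> ('a \<Rightarrow> real) \<Rightarrow> 'a \<Rightarrow> real \<Rightarrow> ennreal" where
  "Kext_nn K g y t = (\<integral>\<^sup>+ w. ennreal (K t (y - w) * g w) \<partial>lborel)"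

definition K_admissible :: "(real \<Rightarrow> 'a::euclidean_space \<Rightarrow> real) \<Rightarrow> ('a \<Rightarrow> real) \<Rightarrow> bool" where
  "K_admissible K \<phi> \<longleftrightarrow>
     \<phi> \<in> borel_measurable lborel \<and>
     (\<forall>S. compact S \<longrightarrow> set_integrable lborel S \<phi>) \<and>
     (\<forall>y t. t > 0 \<longrightarrow> integrable lborel (\<lambda>w. K t (y - w) * \<phi> w)
                     \<and> integrable lborel (\<lambda>w. K t (y - w) * (\<phi> w)\<^sup>2))"

definition K_norm :: "(real \<Rightarrow> 'a::euclidean_space \<Rightarrow> real) \<Rightarrow> ('a \<Rightarrow> real) \<Rightarrow> ereal" where
  "K_norm K \<phi> = (SUP z \<in> {(y, t). t > (0::real)}.
      ereal (sqrt (Kext K (\<lambda>w. (\<phi> w)\<^sup>2) (fst z) (snd z) - (Kext K \<phi> (fst z) (snd z))\<^sup>2)))"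

definition avg :: "real \<Rightarrow> real \<Rightarrow> (real \<Rightarrow> real) \<Rightarrow> real" where
  "avg c d \<eta> = (LINT s:{c..d}|lborel. \<eta> s) / (d - c)"

definition bmo_norm :: "real \<Rightarrow> real \<Rightarrow> (real \<Rightarrow> real) \<Rightarrow> ereal" where
  "bmo_norm a b \<eta> = (SUP J \<in> {(c, d). a \<le> c \<and> c < d \<and> d \<le> b}.
      ereal (sqrt (avg (fst J) (snd J) (\<lambda>s. (\<eta> s)\<^sup>2) - (avg (fst J) (snd J) \<eta>)\<^sup>2)))"

definition Omega :: "real \<Rightarrow> (real \<times> real) set" where
  "Omega \<mu> = {x. (fst x)\<^sup>2 \<le> snd x \<and> snd x \<le> (fst x)\<^sup>2 + \<mu>\<^sup>2}"

text \<open>B_* : supremum over all finite intervals I=[a,b] (the value is independent of I).\<close>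
definition Bstar :: "real \<Rightarrow> (real \<Rightarrow> real) \<Rightarrow> real \<times> real \<Rightarrow> ennreal" where
  "Bstar \<mu> f x = Sup {(\<integral>\<^sup>+ s\<in>{a..b}. ennreal (f (\<eta> s)) \<partial>lborel) / ennreal (b - a) | a b \<eta>.
       a < b \<and> set_integrable lborel {a..b} \<eta> \<and> set_integrable lborel {a..b} (\<lambda>s. (\<eta> s)\<^sup>2) \<and>
       bmo_norm a b \<eta> \<le> ereal \<mu> \<and> avg a b \<eta> = fst x \<and> avg a b (\<lambda>s. (\<eta> s)\<^sup>2) = snd x}"

text \<open>B_K : supremum over admissible phi and over all points z=(y,t) (value independent of z).\<close>
definition BK :: "(real \<Rightarrow> 'a::euclidean_space \<Rightarrow> real) \<Rightarrow> real \<Rightarrow> (real \<Rightarrow> real) \<Rightarrow> real \<times> real \<Rightarrow> ennreal" where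
  "BK K \<mu> f x = Sup {Kext_nn K (\<lambda>w. f (\<phi> w)) y t | \<phi> y t.
       t > 0 \<and> K_admissible K \<phi> \<and> K_norm K \<phi> \<le> ereal \<mu> \<and>
       Kext K \<phi> y t = fst x \<and> Kext K (\<lambda>w. (\<phi> w)\<^sup>2) y t = snd x}"

end

theory Submission
  imports Defs "HOL-Probability.Probability" "HOL-Real_Asymp.Real_Asymp"
begin

text \<open>
  Given \<open>\<phi>\<close> with \<open>K\<close>-norm at most \<open>\<mu>' < \<mu>\<close> and a point \<open>z\<close>, the competitor for \<open>Bstar\<close> is the increasing
  rearrangement \<open>\<eta>\<close> of \<open>\<phi>\<close> on \<open>[0, 1]\<close> with respect to the probability measure \<open>K\<^sub>z\<close>. Only its BMO norm
  has to be estimated. For an interval \<open>[c, d]\<close> put \<open>a = \<eta> c\<close> and \<open>b = \<eta> d\<close>. If \<open>b - a \<le> 2 * \<mu>\<close>, the variance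
  on \<open>[c, d]\<close> is trivially at most \<open>\<mu>\<^sup>2\<close>. Otherwise clip \<open>\<phi>\<close> to \<open>[a, b]\<close>, which does not increase the
  \<open>K\<close>-norm, and look for \<open>m\<close> between \<open>a + \<mu>\<close> and \<open>b - \<mu>\<close> with \<open>E (clip \<phi> - m)\<^sup>2 \<le> \<mu>\<^sup>2\<close>. The mean of the
  clipped function works unless it is within \<open>\<mu>\<close> of \<open>a\<close> or \<open>b\<close>; then \<open>m = a + \<mu>\<close> or \<open>m = b - \<mu>\<close> works by the
  following fact, applied to the distance from \<open>a\<close> or \<open>b\<close>: if \<open>\<psi> \<ge> 0\<close> has \<open>K\<close>-norm at most \<open>\<mu>'\<close> and
  \<open>\<psi>(z) < \<mu>\<close>, then \<open>\<psi>\<^sup>2(z) \<le> 2 * \<mu> * \<psi>(z)\<close>.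

  This fact is a maximum principle for the extension of \<open>\<psi>\<^sup>2 - 2 * \<mu> * \<psi>\<close> on the region where the extension
  of \<open>\<psi>\<close> is below \<open>\<mu>\<close>: it is nonpositive at time \<open>0\<close>, and where \<open>\<psi>(z) = \<mu>\<close> it is at most
  \<open>\<mu>'\<^sup>2 - \<mu>\<^sup>2 < 0\<close>.
\<close>

section \<open>Difference quotients of parameter integrals\<close>

text \<open>The line \<open>x2 = 2 * \<mu> * x1\<close> is the tangent from the origin to the upper
  parabola \<open>x2 = x1^2 + \<mu>^2\<close>, touching it at \<open>x1 = \<mu>\<close>. So the fact
  says that the pair (mean, second moment) of a nonnegative function with mean below \<mu> stays on
  or below this tangent. Being below the tangent is the same as
  \<open>E (\<psi> - \<mu>)^2 \<le> \<mu>^2\<close>, and moving the origin to a clipping level turns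
  this into the estimate for \<open>m\<close>.

  Three obstacles shape the proof. The half-space is not compact, hence a barrier. The function is
  only measurable, so its extension need not be continuous down to time 0; the maximum principle is
  run on mollifications \<open>ext \<psi> _ s\<close>, which keep the variance bound, and
  \<open>s\<close> tends to 0. The rearrangement may be unbounded at 0 and 1 and offers no clipping
  levels there, so intervals touching the ends are limits of interior ones.

  The differential equation enters only as the absence of local maxima of
  \<open>Kext K g - \<delta> * h\<close>. This is read off from difference quotients at a supposed
  maximum; their limits come from differentiating the kernel under the integral.\<close>

lemma second_difference_taylor:
  fixes f f1 f2 :: "real \<Rightarrow> real"
  assumes f1: "\<And>x. \<bar>x\<bar> \<le> r \<Longrightarrow> (f has_real_derivative f1 x) (at x)"
    and f2: "\<And>x. \<bar>x\<bar> \<le> r \<Longrightarrow> (f1 has_real_derivative f2 x) (at x)" and r: "0 < r"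
  obtains \<xi> \<zeta> where "\<bar>\<xi>\<bar> \<le> r" "\<bar>\<zeta>\<bar> \<le> r" "(f r + f (- r) - 2 * f 0) / r\<^sup>2 = (f2 \<xi> + f2 \<zeta>) / 2"
proof -
  define D where "D m = (if m = 0 then f else if m = 1 then f1 else f2)" for m :: nat
  have deriv: "\<forall>m t. m < 2 \<and> - r \<le> t \<and> t \<le> r \<longrightarrow> (D m has_real_derivative D (Suc m) t) (at t)"
    using f1 f2 by (auto simp: D_def less_2_cases_iff abs_le_iff)
  obtain \<xi> where \<xi>: "0 < \<xi>" "\<xi> < r" "f r = (\<Sum>m<2. (D m 0 / fact m) * (r - 0) ^ m) + (D 2 \<xi> / fact 2) * (r - 0)\<^sup>2"
    using Taylor_up[of 2 D f "- r" r 0] deriv r by (auto simp: D_def)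
  obtain \<zeta> where \<zeta>: "- r < \<zeta>" "\<zeta> < 0" "f (- r) = (\<Sum>m<2. (D m 0 / fact m) * (- r - 0) ^ m) + (D 2 \<zeta> / fact 2) * (- r - 0)\<^sup>2"
    using Taylor_down[of 2 D f "- r" r 0] deriv r by (auto simp: D_def)
  have "f r + f (- r) - 2 * f 0 = (f2 \<xi> + f2 \<zeta>) / 2 * r\<^sup>2"
    using \<xi>(3) \<zeta>(3) by (simp add: D_def numeral_2_eq_2 algebra_simps)
  with r \<xi> \<zeta> show ?thesis by (intro that[of \<xi> \<zeta>]) (auto simp: field_simps)
qed

lemma second_difference_tendsto:
  fixes f f1 f2 :: "real \<Rightarrow> real"
  assumes f1: "\<And>x. \<bar>x\<bar> \<le> r0 \<Longrightarrow> (f has_real_derivative f1 x) (at x)"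
    and f2: "\<And>x. \<bar>x\<bar> \<le> r0 \<Longrightarrow> (f1 has_real_derivative f2 x) (at x)"
    and cont: "isCont f2 0" and r: "\<And>n. 0 < r n" "\<And>n. r n \<le> r0" "r \<longlonglongrightarrow> 0"
  shows "(\<lambda>n. (f (r n) + f (- r n) - 2 * f 0) / (r n)\<^sup>2) \<longlonglongrightarrow> f2 0"
proof -
  have "\<exists>\<xi> \<zeta>. \<bar>\<xi>\<bar> \<le> r n \<and> \<bar>\<zeta>\<bar> \<le> r n \<and> (f (r n) + f (- r n) - 2 * f 0) / (r n)\<^sup>2 = (f2 \<xi> + f2 \<zeta>) / 2" for n
    by (rule second_difference_taylor[of "r n" f f1 f2]) (use f1 f2 r(1)[of n] r(2)[of n] in auto)
  then obtain \<xi> \<zeta> where *: "\<And>n. \<bar>\<xi> n\<bar> \<le> r n" "\<And>n. \<bar>\<zeta> n\<bar> \<le> r n"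
    "\<And>n. (f (r n) + f (- r n) - 2 * f 0) / (r n)\<^sup>2 = (f2 (\<xi> n) + f2 (\<zeta> n)) / 2"
    by metis
  have "\<xi> \<longlonglongrightarrow> 0" "\<zeta> \<longlonglongrightarrow> 0"
    using * by (auto intro!: Lim_null_comparison[OF _ r(3)] always_eventually)
  then have "(\<lambda>n. (f2 (\<xi> n) + f2 (\<zeta> n)) / 2) \<longlonglongrightarrow> (f2 0 + f2 0) / 2"
    by (intro tendsto_intros isCont_tendsto_compose[OF cont]) auto
  then show ?thesis by (simp add: *)
qed

text \<open>Dominated convergence with the quotient in mean value form: \<open>G\<close> bounds
  \<open>k2\<close> over the whole window \<open>\<bar>x\<bar> \<le> r0\<close>, so it dominates
  wherever the two intermediate points fall. The second conclusion lets the limits for the separate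
  directions be added under one integral.\<close>

lemma second_difference_integral:
  fixes k k1 k2 :: "real \<Rightarrow> 'a::euclidean_space \<Rightarrow> real"
  assumes k1: "\<And>x w. \<bar>x\<bar> \<le> r0 \<Longrightarrow> ((\<lambda>x. k x w) has_real_derivative k1 x w) (at x)"
    and k2: "\<And>x w. \<bar>x\<bar> \<le> r0 \<Longrightarrow> ((\<lambda>x. k1 x w) has_real_derivative k2 x w) (at x)"
    and cont: "\<And>w. isCont (\<lambda>x. k2 x w) 0" and r: "\<And>n. 0 < r n" "\<And>n. r n \<le> r0" "r \<longlonglongrightarrow> 0"
    and k2m: "k2 0 \<in> borel_measurable lborel" and g: "g \<in> borel_measurable lborel" "\<And>w. \<bar>g w\<bar> \<le> B"
    and int: "\<And>x. \<bar>x\<bar> \<le> r0 \<Longrightarrow> integrable lborel (\<lambda>w. k x w * g w)"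
    and G: "integrable lborel G" "\<And>x w. \<bar>x\<bar> \<le> r0 \<Longrightarrow> \<bar>k2 x w\<bar> \<le> G w"
  shows "(\<lambda>n. ((\<integral>w. k (r n) w * g w \<partial>lborel) + (\<integral>w. k (- r n) w * g w \<partial>lborel) - 2 * (\<integral>w. k 0 w * g w \<partial>lborel)) / (r n)\<^sup>2)
    \<longlonglongrightarrow> (\<integral>w. k2 0 w * g w \<partial>lborel)"
    and "integrable lborel (\<lambda>w. k2 0 w * g w)"
proof -
  have r0: "0 \<le> r0" using r(1,2)[of 0] by linarith
  let ?D = "\<lambda>n w. (k (r n) w + k (- r n) w - 2 * k 0 w) / (r n)\<^sup>2 * g w"
  have i: "integrable lborel (\<lambda>w. k (r n) w * g w)" "integrable lborel (\<lambda>w. k (- r n) w * g w)" "integrable lborel (\<lambda>w. k 0 w * g w)" for n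
    using r(1)[of n] r(2)[of n] by (auto intro!: int)
  have D_eq: "?D n = (\<lambda>w. (k (r n) w * g w + k (- r n) w * g w - 2 * (k 0 w * g w)) / (r n)\<^sup>2)" for n
    by (auto simp: algebra_simps diff_divide_distrib add_divide_distrib)
  have iD: "integrable lborel (?D n)" for n
    unfolding D_eq using i by simp
  have "B \<ge> 0" using g(2)[of undefined] by simp
  have lim: "(\<lambda>n. ?D n w) \<longlonglongrightarrow> k2 0 w * g w" for w
    by (intro tendsto_intros second_difference_tendsto[of r0 "\<lambda>x. k x w" "\<lambda>x. k1 x w" "\<lambda>x. k2 x w"] k1 k2 cont r)
  have dom: "norm (?D n w) \<le> G w * B" for n w
  proof -
    obtain \<xi> \<zeta> where *: "\<bar>\<xi>\<bar> \<le> r n" "\<bar>\<zeta>\<bar> \<le> r n"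
      "(k (r n) w + k (- r n) w - 2 * k 0 w) / (r n)\<^sup>2 = (k2 \<xi> w + k2 \<zeta> w) / 2"
      by (rule second_difference_taylor[of "r n" "\<lambda>x. k x w" "\<lambda>x. k1 x w" "\<lambda>x. k2 x w"])
         (use r(1)[of n] r(2)[of n] in \<open>auto intro!: k1 k2\<close>)
    have "\<bar>(k2 \<xi> w + k2 \<zeta> w) / 2\<bar> \<le> G w"
      using G(2)[of \<xi> w] G(2)[of \<zeta> w] * r(2)[of n] by (simp add: abs_le_iff)
    then show ?thesis
      unfolding * using g(2)[of w] \<open>B \<ge> 0\<close> by (simp only: real_norm_def abs_mult) (intro mult_mono, auto)
  qed
  have m: "(\<lambda>w. k2 0 w * g w) \<in> borel_measurable lborel" using k2m g by measurable
  have iG: "integrable lborel (\<lambda>w. G w * B)" using G by simp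
  have "(\<lambda>n. integral\<^sup>L lborel (?D n)) \<longlonglongrightarrow> (\<integral>w. k2 0 w * g w \<partial>lborel)"
  proof (rule integral_dominated_convergence[OF m _ iG])
    show "?D n \<in> borel_measurable lborel" for n using iD by (rule borel_measurable_integrable)
  qed (intro AE_I2 lim, intro AE_I2 dom)
  moreover have "integral\<^sup>L lborel (?D n) = ((\<integral>w. k (r n) w * g w \<partial>lborel) + (\<integral>w. k (- r n) w * g w \<partial>lborel) - 2 * (\<integral>w. k 0 w * g w \<partial>lborel)) / (r n)\<^sup>2" for n
    unfolding D_eq using i by simp
  ultimately show "(\<lambda>n. ((\<integral>w. k (r n) w * g w \<partial>lborel) + (\<integral>w. k (- r n) w * g w \<partial>lborel) - 2 * (\<integral>w. k 0 w * g w \<partial>lborel)) / (r n)\<^sup>2)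
    \<longlonglongrightarrow> (\<integral>w. k2 0 w * g w \<partial>lborel)" by (simp only:)
  have "\<bar>k2 0 w * g w\<bar> \<le> \<bar>G w * B\<bar>" for w
  proof -
    have "\<bar>k2 0 w\<bar> \<le> G w" using G(2)[of 0 w] r0 by simp
    then have "\<bar>k2 0 w * g w\<bar> \<le> G w * B"
      using g(2)[of w] \<open>B \<ge> 0\<close> by (simp only: abs_mult) (intro mult_mono, auto)
    then show ?thesis by linarith
  qed
  then show "integrable lborel (\<lambda>w. k2 0 w * g w)"
    by (intro Bochner_Integration.integrable_bound[OF iG m]) auto
qed

text \<open>The heat equation is of first order in time, and its maximum principle compares with
  earlier times. Hence the window is one-sided and one mean value point replaces the two of the
  second difference.\<close>

lemma backward_difference_integral:
  fixes k k1 :: "real \<Rightarrow> 'a::euclidean_space \<Rightarrow> real"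
  assumes k1: "\<And>x w. - r0 \<le> x \<Longrightarrow> x \<le> 0 \<Longrightarrow> ((\<lambda>x. k x w) has_real_derivative k1 x w) (at x)"
    and r: "\<And>n. 0 < r n" "\<And>n. r n \<le> r0" "r \<longlonglongrightarrow> 0"
    and k1m: "k1 0 \<in> borel_measurable lborel" and g: "g \<in> borel_measurable lborel" "\<And>w. \<bar>g w\<bar> \<le> B"
    and int: "\<And>x. - r0 \<le> x \<Longrightarrow> x \<le> 0 \<Longrightarrow> integrable lborel (\<lambda>w. k x w * g w)"
    and G: "integrable lborel G" "\<And>x w. - r0 \<le> x \<Longrightarrow> x \<le> 0 \<Longrightarrow> \<bar>k1 x w\<bar> \<le> G w"
  shows "(\<lambda>n. ((\<integral>w. k (- r n) w * g w \<partial>lborel) - (\<integral>w. k 0 w * g w \<partial>lborel)) / r n)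
    \<longlonglongrightarrow> - (\<integral>w. k1 0 w * g w \<partial>lborel)"
    and "integrable lborel (\<lambda>w. k1 0 w * g w)"
proof -
  have r0: "0 \<le> r0" using r(1,2)[of 0] by linarith
  let ?D = "\<lambda>n w. (k (- r n) w - k 0 w) / r n * g w"
  have i: "integrable lborel (\<lambda>w. k (- r n) w * g w)" "integrable lborel (\<lambda>w. k 0 w * g w)" for n
    using r(1)[of n] r(2)[of n] by (auto intro!: int)
  have D_eq: "?D n = (\<lambda>w. (k (- r n) w * g w - k 0 w * g w) / r n)" for n
    by (auto simp: algebra_simps diff_divide_distrib)
  have iD: "integrable lborel (?D n)" for n
    unfolding D_eq using i by simp
  have "B \<ge> 0" using g(2)[of undefined] by simp
  have lim: "(\<lambda>n. ?D n w) \<longlonglongrightarrow> - k1 0 w * g w" for w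
  proof -
    have "((\<lambda>h. (k h w - k 0 w) / h) \<longlongrightarrow> k1 0 w) (at 0)"
      using k1[of 0 w] r0 by (simp add: DERIV_def)
    moreover have "filterlim (\<lambda>n. - r n) (at 0) sequentially"
      using r(1) tendsto_minus[OF r(3)] by (auto simp: filterlim_at less_imp_neq[symmetric])
    ultimately have "(\<lambda>n. (k (- r n) w - k 0 w) / (- r n)) \<longlonglongrightarrow> k1 0 w"
      by (rule filterlim_compose)
    then have "(\<lambda>n. - ((k (- r n) w - k 0 w) / (- r n)) * g w) \<longlonglongrightarrow> - k1 0 w * g w"
      by (intro tendsto_intros)
    then show ?thesis by simp
  qed
  have dom: "norm (?D n w) \<le> G w * B" for n w
  proof -
    obtain \<xi> where *: "- r n < \<xi>" "\<xi> < 0" "k 0 w - k (- r n) w = (0 - (- r n)) * k1 \<xi> w"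
      using MVT2[of "- r n" 0 "\<lambda>x. k x w" "\<lambda>x. k1 x w"] k1 r(1)[of n] r(2)[of n] by auto
    then have "(k (- r n) w - k 0 w) / r n = - k1 \<xi> w" using r(1)[of n] by (simp add: field_simps)
    moreover have "\<bar>- k1 \<xi> w\<bar> \<le> G w"
      using G(2)[of \<xi> w] * r(2)[of n] by simp
    ultimately show ?thesis
      using g(2)[of w] \<open>B \<ge> 0\<close> by (simp only: real_norm_def abs_mult) (intro mult_mono, auto)
  qed
  have m: "(\<lambda>w. - k1 0 w * g w) \<in> borel_measurable lborel" using k1m g by measurable
  have iG: "integrable lborel (\<lambda>w. G w * B)" using G by simp
  have "(\<lambda>n. integral\<^sup>L lborel (?D n)) \<longlonglongrightarrow> (\<integral>w. - k1 0 w * g w \<partial>lborel)"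
  proof (rule integral_dominated_convergence[OF m _ iG])
    show "?D n \<in> borel_measurable lborel" for n using iD by (rule borel_measurable_integrable)
  qed (intro AE_I2 lim, intro AE_I2 dom)
  moreover have "(\<integral>w. - k1 0 w * g w \<partial>lborel) = - (\<integral>w. k1 0 w * g w \<partial>lborel)" by simp
  moreover have "integral\<^sup>L lborel (?D n) = ((\<integral>w. k (- r n) w * g w \<partial>lborel) - (\<integral>w. k 0 w * g w \<partial>lborel)) / r n" for n
    unfolding D_eq using i by simp
  ultimately show "(\<lambda>n. ((\<integral>w. k (- r n) w * g w \<partial>lborel) - (\<integral>w. k 0 w * g w \<partial>lborel)) / r n)
    \<longlonglongrightarrow> - (\<integral>w. k1 0 w * g w \<partial>lborel)" by (simp only:)
  have "\<bar>- k1 0 w * g w\<bar> \<le> \<bar>G w * B\<bar>" for w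
  proof -
    have "\<bar>- k1 0 w\<bar> \<le> G w" using G(2)[of 0 w] r0 by simp
    then have "\<bar>- k1 0 w * g w\<bar> \<le> G w * B"
      using g(2)[of w] \<open>B \<ge> 0\<close> by (simp only: abs_mult) (intro mult_mono, auto)
    then show ?thesis by linarith
  qed
  then have "integrable lborel (\<lambda>w. - k1 0 w * g w)"
    by (intro Bochner_Integration.integrable_bound[OF iG m]) auto
  then show "integrable lborel (\<lambda>w. k1 0 w * g w)" by simp
qed

section \<open>Total mass of the kernels\<close>

lemma gaussian_mass:
  assumes u: "0 < u"
  shows "(\<integral>\<^sup>+ w. ennreal (exp (- u * (norm (w::'a::euclidean_space))\<^sup>2)) \<partial>lborel) = ennreal ((pi / u) powr (real DIM('a) / 2))"
proof -
  have one: "(\<integral>\<^sup>+ x. ennreal (exp (- u * x\<^sup>2)) \<partial>lborel) = ennreal (sqrt (pi / u))"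
  proof -
    define s where "s = 1 / sqrt (2 * u)"
    have s: "0 < s" "s\<^sup>2 = 1 / (2 * u)" using u by (auto simp: s_def power_divide)
    have "exp (- u * x\<^sup>2) = sqrt (pi / u) * normal_density 0 s x" for x
      using u by (simp add: normal_density_def s real_sqrt_divide field_simps)
    then have "(\<integral>\<^sup>+ x. ennreal (exp (- u * x\<^sup>2)) \<partial>lborel) = ennreal (sqrt (pi / u)) * (\<integral>\<^sup>+ x. ennreal (normal_density 0 s x) \<partial>lborel)"
      using u by (simp add: ennreal_mult' nn_integral_cmult)
    also have "(\<integral>\<^sup>+ x. ennreal (normal_density 0 s x) \<partial>lborel) = 1"
      using s by (subst nn_integral_eq_integral) auto
    finally show ?thesis by simp
  qed
  have "exp (- u * (norm w)\<^sup>2) = (\<Prod>b\<in>Basis. exp (- u * (w \<bullet> b)\<^sup>2))" for w :: 'a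
  proof -
    have "(norm w)\<^sup>2 = (\<Sum>b\<in>Basis. (w \<bullet> b)\<^sup>2)"
      unfolding power2_norm_eq_inner by (subst euclidean_inner) (simp add: power2_eq_square)
    then show ?thesis by (simp add: exp_sum[symmetric] sum_distrib_left)
  qed
  then have "(\<integral>\<^sup>+ w. ennreal (exp (- u * (norm (w::'a))\<^sup>2)) \<partial>lborel) =
      (\<integral>\<^sup>+ w. (\<Prod>b\<in>Basis. ennreal (exp (- u * ((w::'a) \<bullet> b)\<^sup>2))) \<partial>lborel)"
    by (simp add: prod_ennreal)
  also have "\<dots> = (\<Prod>b\<in>(Basis::'a set). (\<integral>\<^sup>+ x. ennreal (exp (- u * x\<^sup>2)) \<partial>lborel))"
    by (rule nn_integral_lborel_prod) auto
  also have "\<dots> = ennreal (sqrt (pi / u)) ^ DIM('a)" by (simp only: one prod_constant)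
  also have "\<dots> = ennreal (sqrt (pi / u) ^ DIM('a))" using u by (simp add: ennreal_power)
  also have "sqrt (pi / u) ^ DIM('a) = (pi / u) powr (real DIM('a) / 2)"
    using u by (simp add: powr_half_sqrt[symmetric] powr_powr powr_realpow[symmetric])
  finally show ?thesis .
qed

text \<open>The Gamma integral after rescaling \<open>u\<close> by \<open>a\<close>. Read backwards,
  it writes the negative power \<open>a powr (- s)\<close> as a mixture of exponentials in
  \<open>a\<close>, the form in which a power of \<open>t^2 + |w|^2\<close> can meet the Gaussian
  integral.\<close>

lemma Gamma_nn_integral_scaled:
  assumes s: "0 < s" and a: "0 < a"
  shows "(\<integral>\<^sup>+ u. ennreal (indicator {0..} u * u powr (s - 1) * exp (- a * u)) \<partial>lborel) = ennreal (Gamma s * a powr (- s))"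
    (is "?J = _")
proof -
  have "ennreal (Gamma s) = (\<integral>\<^sup>+ u. ennreal (indicator {0..} u * u powr (s - 1) / exp u) \<partial>lborel)"
    using s by (rule Gamma_conv_nn_integral_real)
  also have "\<dots> = ennreal a * (\<integral>\<^sup>+ u. ennreal (indicator {0..} (0 + a * u) * (0 + a * u) powr (s - 1) / exp (0 + a * u)) \<partial>lborel)"
    using a by (subst nn_integral_real_affine[where c=a and t=0]) auto
  also have "(\<lambda>u. indicator {0..} (0 + a * u) * (0 + a * u) powr (s - 1) / exp (0 + a * u)) =
      (\<lambda>u. a powr (s - 1) * (indicator {0..} u * u powr (s - 1) * exp (- a * u)))"
    using a by (auto simp: fun_eq_iff indicator_def powr_mult exp_minus field_simps zero_le_mult_iff)
  also have "ennreal a * (\<integral>\<^sup>+ u. ennreal (a powr (s - 1) * (indicator {0..} u * u powr (s - 1) * exp (- a * u))) \<partial>lborel) =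
      ennreal a * (ennreal (a powr (s - 1)) * ?J)"
    by (simp only: ennreal_mult'[OF powr_ge_zero]) (subst nn_integral_cmult, measurable)
  also have "\<dots> = ennreal (a powr s) * ?J"
    using a powr_mult_base[of a "s - 1"] by (simp only: mult.assoc[symmetric] ennreal_mult'[OF less_imp_le, symmetric]) simp
  finally have "ennreal (a powr (- s)) * ennreal (Gamma s) = (ennreal (a powr (- s)) * ennreal (a powr s)) * ?J"
    by (simp only: mult.assoc)
  also have "ennreal (a powr (- s)) * ennreal (a powr s) = 1"
    using a by (simp add: ennreal_mult'[symmetric] powr_add[symmetric])
  finally show ?thesis
    by (simp add: ennreal_mult'' Gamma_real_pos s less_imp_le mult.commute)
qed

text \<open>Subordination: the power of \<open>t^2 + |w|^2\<close> is a Gamma mixture of Gaussians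
  in \<open>w\<close>. Tonelli in \<open>ennreal\<close> puts the \<open>w\<close> integral inside,
  where \<open>gaussian_mass\<close> evaluates it; what is left is a Gamma integral with parameter
  1/2, and \<open>Gamma (1/2) = sqrt pi\<close>.\<close>

lemma poisson_mass:
  assumes t: "0 < t"
  shows "(\<integral>\<^sup>+ w. ennreal (poisson_kernel t (w::'a::euclidean_space)) \<partial>lborel) = 1"
proof -
  define s where "s = (real DIM('a) + 1) / 2"
  have s: "0 < s" by (simp add: s_def)
  let ?I = "\<integral>\<^sup>+ w. ennreal ((t\<^sup>2 + (norm (w::'a))\<^sup>2) powr (- s)) \<partial>lborel"
  have "ennreal (Gamma s) * ?I = (\<integral>\<^sup>+ w. ennreal (Gamma s * (t\<^sup>2 + (norm (w::'a))\<^sup>2) powr (- s)) \<partial>lborel)"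
    using s by (simp add: ennreal_mult' Gamma_real_pos nn_integral_cmult less_imp_le)
  also have "\<dots> = (\<integral>\<^sup>+ w. (\<integral>\<^sup>+ u. ennreal (indicator {0..} u * u powr (s - 1) * exp (- (t\<^sup>2 + (norm (w::'a))\<^sup>2) * u)) \<partial>lborel) \<partial>lborel)"
    using t s by (subst Gamma_nn_integral_scaled) (auto simp: add_pos_nonneg)
  also have "\<dots> = (\<integral>\<^sup>+ u. (\<integral>\<^sup>+ w. ennreal (indicator {0..} u * u powr (s - 1) * exp (- (t\<^sup>2 + (norm (w::'a))\<^sup>2) * u)) \<partial>lborel) \<partial>lborel)"
    by (rule lborel_pair.Fubini') measurable
  also have "\<dots> = (\<integral>\<^sup>+ u. ennreal (pi powr (real DIM('a) / 2)) * ennreal (indicator {0..} u * u powr (1/2 - 1) * exp (- t\<^sup>2 * u)) \<partial>lborel)"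
  proof (rule nn_integral_cong_AE)
    show "AE u in lborel. (\<integral>\<^sup>+ w. ennreal (indicator {0..} u * u powr (s - 1) * exp (- (t\<^sup>2 + (norm (w::'a))\<^sup>2) * u)) \<partial>lborel) =
      ennreal (pi powr (real DIM('a) / 2)) * ennreal (indicator {0..} u * u powr (1/2 - 1) * exp (- t\<^sup>2 * u))"
      using AE_lborel_singleton[of 0]
    proof eventually_elim
      case (elim u)
      show ?case
      proof (cases "0 < u")
        case True
        have "(\<integral>\<^sup>+ w. ennreal (indicator {0..} u * u powr (s - 1) * exp (- (t\<^sup>2 + (norm (w::'a))\<^sup>2) * u)) \<partial>lborel) =
          (\<integral>\<^sup>+ w. ennreal (u powr (s - 1) * exp (- t\<^sup>2 * u)) * ennreal (exp (- u * (norm (w::'a))\<^sup>2)) \<partial>lborel)"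
          using True by (intro nn_integral_cong) (simp add: ennreal_mult'[symmetric] exp_add[symmetric] algebra_simps)
        also have "\<dots> = ennreal (u powr (s - 1) * exp (- t\<^sup>2 * u)) * ennreal ((pi / u) powr (real DIM('a) / 2))"
          by (subst nn_integral_cmult, measurable, subst gaussian_mass[OF True], rule refl)
        also have "\<dots> = ennreal (u powr (s - 1) * exp (- t\<^sup>2 * u) * (pi / u) powr (real DIM('a) / 2))"
          by (simp add: ennreal_mult')
        \<comment> \<open>Since \<open>s - 1 - DIM('a) / 2 = - 1 / 2\<close>, the dimension drops
          out of the power of \<open>u\<close>.\<close>
        also have "u powr (s - 1) * exp (- t\<^sup>2 * u) * (pi / u) powr (real DIM('a) / 2) =
            pi powr (real DIM('a) / 2) * (u powr (1/2 - 1) * exp (- t\<^sup>2 * u))"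
        proof -
          have "u powr (s - 1) = u powr (1/2 - 1) * u powr (real DIM('a) / 2)"
            by (subst powr_add[symmetric]) (simp add: s_def field_simps)
          moreover have "(pi / u) powr (real DIM('a) / 2) = pi powr (real DIM('a) / 2) / u powr (real DIM('a) / 2)"
            by (rule powr_divide)
          moreover have "u powr (real DIM('a) / 2) \<noteq> 0" using True by simp
          ultimately show ?thesis by simp
        qed
        finally show ?thesis using True by (simp add: ennreal_mult')
      next
        case False
        with elim show ?thesis by (simp add: indicator_def)
      qed
    qed
  qed
  also have "\<dots> = ennreal (pi powr (real DIM('a) / 2)) * ennreal (Gamma (1/2) * (t\<^sup>2) powr (- (1/2)))"
    using t by (subst nn_integral_cmult) (auto simp: Gamma_nn_integral_scaled[of "1/2" "t\<^sup>2", simplified])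
  also have "(t\<^sup>2) powr (- (1/2)) = 1 / t"
    using t by (simp add: powr_minus powr_half_sqrt inverse_eq_divide)
  also have "ennreal (pi powr (real DIM('a) / 2)) * ennreal (Gamma (1/2) * (1 / t)) = ennreal (pi powr s / t)"
    by (simp add: ennreal_mult'[symmetric] Gamma_one_half_real s_def add_divide_distrib powr_add powr_half_sqrt)
  finally have *: "ennreal (Gamma s) * ?I = ennreal (pi powr s / t)" .
  have "poisson_kernel t w = t / pi powr s * Gamma s * (t\<^sup>2 + (norm w)\<^sup>2) powr (- s)" for w :: 'a
    unfolding poisson_kernel_def s_def[symmetric] powr_minus_divide by simp
  moreover have "0 \<le> t / pi powr s * Gamma s" using t s by (simp add: Gamma_real_pos less_imp_le)
  ultimately have pk: "ennreal (poisson_kernel t w) = ennreal (t / pi powr s * Gamma s) * ennreal ((t\<^sup>2 + (norm w)\<^sup>2) powr (- s))" for w :: 'a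
    by (simp only: ennreal_mult')
  have "(\<integral>\<^sup>+ w. ennreal (poisson_kernel t (w::'a)) \<partial>lborel) = ennreal (t / pi powr s * Gamma s) * ?I"
    unfolding pk by (subst nn_integral_cmult) auto
  also have "\<dots> = ennreal (t / pi powr s) * (ennreal (Gamma s) * ?I)"
    using t by (simp only: ennreal_mult'[OF divide_nonneg_nonneg[OF less_imp_le[OF t] powr_ge_zero]] mult.assoc)
  also have "\<dots> = 1"
    unfolding * using t by (simp add: ennreal_mult'[symmetric])
  finally show ?thesis .
qed

lemma heat_mass:
  assumes t: "0 < t"
  shows "(\<integral>\<^sup>+ w. ennreal (heat_kernel t (w::'a::euclidean_space)) \<partial>lborel) = 1"
proof -
  have "heat_kernel t w = (4 * pi * t) powr (- real DIM('a) / 2) * exp (- (1 / (4 * t)) * (norm w)\<^sup>2)" for w :: 'a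
    by (simp add: heat_kernel_def)
  then have "(\<integral>\<^sup>+ w. ennreal (heat_kernel t (w::'a)) \<partial>lborel) =
     ennreal ((4 * pi * t) powr (- real DIM('a) / 2)) * ennreal ((pi / (1 / (4 * t))) powr (real DIM('a) / 2))"
    using t by (simp only: ennreal_mult' powr_ge_zero, subst nn_integral_cmult) (simp_all only: gaussian_mass zero_less_divide_1_iff, simp_all)
  also have "\<dots> = 1"
    using t by (simp add: ennreal_mult'[symmetric] powr_minus mult_ac)
  finally show ?thesis .
qed

section \<open>Extensions of bounded functions\<close>

lemma abs_power2_le: "\<bar>x\<bar> \<le> B \<Longrightarrow> \<bar>x\<^sup>2\<bar> \<le> B\<^sup>2" for x B :: real
  using abs_le_square_iff[of x B] by auto

text \<open>Density of the continuous functions in the form that continuity of translations needs: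
  almost everywhere convergence with the bound \<open>B\<close> kept, so that dominated convergence
  applies.\<close>

lemma bounded_measurable_approx:
  fixes g :: "'a::euclidean_space \<Rightarrow> real"
  assumes [measurable]: "g \<in> borel_measurable borel" and B: "\<And>w. \<bar>g w\<bar> \<le> B"
  obtains k where "\<And>n. continuous_on UNIV (k n)" "\<And>n w. \<bar>k n w\<bar> \<le> B"
    "AE w in lborel. (\<lambda>n. k n w) \<longlonglongrightarrow> g w"
proof -
  have "g measurable_on UNIV"
    by (rule lebesgue_measurable_imp_measurable_on) (auto intro!: measurable_completion)
  then obtain Z k where Z: "negligible Z" and k: "\<And>n. continuous_on UNIV (k n)"
    and lim: "\<And>w. w \<notin> Z \<Longrightarrow> (\<lambda>n. k n w) \<longlonglongrightarrow> g w"
    by (auto simp: measurable_on_def)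
  \<comment> \<open>Clamping to \<open>[- B, B]\<close> restores the bound and keeps the limit,
    because \<open>g\<close> itself takes values there.\<close>
  let ?k = "\<lambda>n w. max (- B) (min B (k n w))"
  have "AE w in lebesgue. w \<notin> Z"
    using Z by (auto simp: negligible_iff_null_sets intro: AE_not_in)
  then have ae: "AE w in lborel. w \<notin> Z"
    by (simp add: AE_completion_iff)
  have "(\<lambda>n. ?k n w) \<longlonglongrightarrow> g w" if "w \<notin> Z" for w
  proof -
    have "(\<lambda>n. ?k n w) \<longlonglongrightarrow> max (- B) (min B (g w))"
      by (intro tendsto_intros lim that)
    also have "max (- B) (min B (g w)) = g w"
      using B[of w] by auto
    finally show ?thesis .
  qed
  with ae have "AE w in lborel. (\<lambda>n. ?k n w) \<longlonglongrightarrow> g w" by auto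
  moreover have "\<bar>?k n w\<bar> \<le> B" for n w
    using B[of undefined] by auto
  moreover have "continuous_on UNIV (?k n)" for n
    by (intro continuous_intros k)
  ultimately show ?thesis
    by (intro that[of ?k])
qed

text \<open>
  Here \<open>\<sigma> t\<close> is the spatial scale of the kernel at time \<open>t\<close>, and \<open>h\<close> is a strict supersolution that tends
  to infinity: subtracting \<open>\<delta> * h\<close> makes the maximum principle available on the unbounded half-space.
\<close>

locale averaging_kernel =
  fixes K :: "real \<Rightarrow> 'a::euclidean_space \<Rightarrow> real"
    and \<sigma> :: "real \<Rightarrow> real"
    and h :: "'a \<times> real \<Rightarrow> real"
  assumes K_nonneg: "\<And>t y. 0 < t \<Longrightarrow> 0 \<le> K t y"
    and K_cont: "\<And>t. 0 < t \<Longrightarrow> continuous_on UNIV (K t)"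
    and K_mass: "\<And>t. 0 < t \<Longrightarrow> (\<integral>\<^sup>+ w. ennreal (K t w) \<partial>lborel) = 1"
    and K_scale: "\<And>t v. 0 < t \<Longrightarrow> \<sigma> t ^ DIM('a) * K t (\<sigma> t *\<^sub>R v) = K 1 v"
    and \<sigma>_cont: "continuous_on {0..} \<sigma>"
    and \<sigma>_0: "\<sigma> 0 = 0"
    and \<sigma>_pos: "\<And>t. 0 < t \<Longrightarrow> 0 < \<sigma> t"
    and h_nonneg: "\<And>z. 0 \<le> snd z \<Longrightarrow> 0 \<le> h z"
    and h_cont: "continuous_on (UNIV \<times> {0..}) h"
    and h_coercive: "\<And>C. bounded {z. 0 \<le> snd z \<and> h z \<le> C}"
    and no_local_max: "\<And>g B y t \<delta> e. g \<in> borel_measurable borel \<Longrightarrow> (\<And>w. \<bar>g w\<bar> \<le> B) \<Longrightarrow>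
          0 < t \<Longrightarrow> 0 < \<delta> \<Longrightarrow> 0 < e \<Longrightarrow>
          \<exists>z\<in>ball (y, t) e. Kext K g y t - \<delta> * h (y, t) < Kext K g (fst z) (snd z) - \<delta> * h z"
begin

section \<open>The extension as an expectation over a fixed probability measure\<close>

definition N :: "'a measure" where
  "N = density lborel (\<lambda>v. ennreal (K 1 v))"

text \<open>\<open>K_scale\<close> moves the time from the kernel into the argument: this is the
  expectation of \<open>g (y - \<sigma> t * V)\<close> for \<open>V\<close> of law \<open>N\<close>.
  It has the right value \<open>g y\<close> at \<open>t = 0\<close>, where the kernel is not
  controlled, and it turns questions about one point of the half-space into questions about one
  random variable on \<open>N\<close>.\<close>

definition ext :: "('a \<Rightarrow> real) \<Rightarrow> 'a \<Rightarrow> real \<Rightarrow> real" where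
  "ext g y t = (\<integral>v. g (y - \<sigma> t *\<^sub>R v) \<partial>N)"

lemma sets_N [measurable_cong, simp]: "sets N = sets borel"
  and space_N [simp]: "space N = UNIV"
  by (simp_all add: N_def)

lemma K_measurable [measurable]: "0 < t \<Longrightarrow> K t \<in> borel_measurable borel"
  using K_cont by (rule borel_measurable_continuous_onI)

sublocale N: prob_space N
  by (rule prob_spaceI) (simp add: N_def emeasure_density K_mass)

lemma measure_N_UNIV [simp]: "measure N UNIV = 1"
  using N.prob_space by simp

sublocale NN: pair_prob_space N N
  by unfold_locales

text \<open>Affine change of variables; the Jacobian \<open>\<sigma> t ^ DIM('a)\<close> is exactly
  what \<open>K_scale\<close> cancels.\<close>

lemma distr_N:
  assumes "0 < t"
  shows "distr N borel (\<lambda>v. y - \<sigma> t *\<^sub>R v) = density lborel (\<lambda>w. ennreal (K t (y - w)))"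
proof -
  have [simp]: "\<sigma> t > 0" "\<sigma> t \<noteq> 0" using \<sigma>_pos[OF assms] by auto
  have [measurable]: "K t \<in> borel_measurable borel" "K 1 \<in> borel_measurable borel"
    using assms by simp_all
  have "density lborel (\<lambda>w. ennreal (K t (y - w))) =
    density (density (distr lborel borel (\<lambda>x. y + (- \<sigma> t) *\<^sub>R x)) (\<lambda>_. \<bar>- \<sigma> t\<bar>^DIM('a)))
      (\<lambda>w. ennreal (K t (y - w)))"
    by (subst lborel_affine[of "- \<sigma> t" y]) simp_all
  also have "\<dots> = density (distr lborel borel (\<lambda>x. y + (- \<sigma> t) *\<^sub>R x))
      (\<lambda>w. ennreal (\<sigma> t ^ DIM('a) * K t (y - w)))"
    by (subst density_density_eq) (auto simp: ennreal_mult'[OF zero_le_power[OF less_imp_le[OF \<open>\<sigma> t > 0\<close>]]] abs_of_pos intro!: density_cong AE_I2)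
  also have "\<dots> = distr (density lborel (\<lambda>v. ennreal (\<sigma> t ^ DIM('a) * K t (y - (y + (- \<sigma> t) *\<^sub>R v)))))
      borel (\<lambda>x. y + (- \<sigma> t) *\<^sub>R x)"
    by (subst density_distr) auto
  also have "\<dots> = distr N borel (\<lambda>v. y - \<sigma> t *\<^sub>R v)"
    using K_scale[OF assms] by (simp add: N_def)
  finally show ?thesis ..
qed

lemma Kext_eq_ext:
  assumes [measurable]: "g \<in> borel_measurable borel" and t: "0 < t"
  shows "Kext K g y t = ext g y t"
proof -
  have [measurable]: "K t \<in> borel_measurable borel" using t by simp
  have "Kext K g y t = (\<integral>w. g w \<partial>density lborel (\<lambda>w. ennreal (K t (y - w))))"
    unfolding Kext_def by (subst integral_density) (auto simp: K_nonneg t)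
  also have "\<dots> = ext g y t"
    unfolding distr_N[OF t, symmetric] ext_def by (subst integral_distr) auto
  finally show ?thesis .
qed

lemma integrable_kernel_iff:
  assumes [measurable]: "g \<in> borel_measurable borel" and t: "0 < t"
  shows "integrable lborel (\<lambda>w. K t (y - w) * g w) \<longleftrightarrow> integrable N (\<lambda>v. g (y - \<sigma> t *\<^sub>R v :: 'a) :: real)"
proof -
  have [measurable]: "K t \<in> borel_measurable borel" using t by simp
  have "integrable lborel (\<lambda>w. K t (y - w) * g w) \<longleftrightarrow>
      integrable (density lborel (\<lambda>w. ennreal (K t (y - w)))) g"
    by (subst integrable_density) (auto simp: K_nonneg t)
  also have "\<dots> \<longleftrightarrow> integrable N (\<lambda>v. g (y - \<sigma> t *\<^sub>R v))"
    unfolding distr_N[OF t, symmetric] by (subst integrable_distr_eq) auto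
  finally show ?thesis .
qed

lemma Kext_nn_eq:
  assumes [measurable]: "g \<in> borel_measurable borel" and t: "0 < t"
  shows "Kext_nn K g y t = (\<integral>\<^sup>+ v. ennreal (g (y - \<sigma> t *\<^sub>R v)) \<partial>N)"
proof -
  have [measurable]: "K t \<in> borel_measurable borel" using t by simp
  have "Kext_nn K g y t = (\<integral>\<^sup>+w. ennreal (g w) \<partial>density lborel (\<lambda>w. ennreal (K t (y - w))))"
    unfolding Kext_nn_def
    by (subst nn_integral_density) (auto simp: ennreal_mult' K_nonneg t intro!: nn_integral_cong)
  also have "\<dots> = (\<integral>\<^sup>+ v. ennreal (g (y - \<sigma> t *\<^sub>R v)) \<partial>N)"
    unfolding distr_N[OF t, symmetric] by (subst nn_integral_distr) auto
  finally show ?thesis .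
qed

lemma integrable_N_bounded:
  fixes g :: "'a \<Rightarrow> real"
  assumes "g \<in> borel_measurable borel" "\<And>w. \<bar>g w\<bar> \<le> B"
  shows "integrable N g"
  using assms by (intro N.integrable_const_bound[of _ B]) auto

lemma ext_zero [simp]: "ext g y 0 = g y"
  by (simp add: ext_def \<sigma>_0)

text \<open>Continuity on the closed half-space, as the maximum principle requires. At
  \<open>t = 0\<close> the extension is \<open>g\<close>, so the continuity of \<open>g\<close> is
  inherited there and not created.\<close>

lemma continuous_ext:
  assumes g: "continuous_on UNIV g" and B: "\<And>w. \<bar>g w\<bar> \<le> B"
  shows "continuous_on (UNIV \<times> {0..}) (\<lambda>z. ext g (fst z) (snd z))"
proof (rule continuous_on_sequentiallyI)
  fix x :: "nat \<Rightarrow> 'a \<times> real" and a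
  assume x: "\<forall>n. x n \<in> UNIV \<times> {0..}" and a: "a \<in> UNIV \<times> {0..}" and lim: "x \<longlonglongrightarrow> a"
  have [measurable]: "g \<in> borel_measurable borel"
    using g by (rule borel_measurable_continuous_onI)
  have 1: "(\<lambda>n. \<sigma> (snd (x n))) \<longlonglongrightarrow> \<sigma> (snd a)"
    using x a by (intro continuous_on_tendsto_compose[OF \<sigma>_cont]) (auto intro!: tendsto_intros lim simp: mem_Times_iff)
  have 2: "(\<lambda>n. g (fst (x n) - \<sigma> (snd (x n)) *\<^sub>R v)) \<longlonglongrightarrow> g (fst a - \<sigma> (snd a) *\<^sub>R v)" for v
    by (intro continuous_on_tendsto_compose[OF g]) (auto intro!: tendsto_intros lim 1)
  show "(\<lambda>n. ext g (fst (x n)) (snd (x n))) \<longlonglongrightarrow> ext g (fst a) (snd a)"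
    unfolding ext_def
    by (rule integral_dominated_convergence[where w="\<lambda>_. B"]) (use 2 B in auto)
qed

lemma kernel_integrable:
  assumes t: "0 < t" shows "integrable lborel (\<lambda>w. K t (y - w))"
  using integrable_kernel_iff[of "\<lambda>_. 1" t y] t by simp

lemma kernel_integral:
  assumes t: "0 < t" shows "(\<integral>w. K t (y - w) \<partial>lborel) = 1"
  using Kext_eq_ext[of "\<lambda>_. 1" t y] t by (simp add: Kext_def ext_def)

text \<open>Scheffe: the translates are densities of equal mass and converge pointwise, hence in
  L1.\<close>

lemma kernel_translation_L1:
  assumes t: "0 < t" and lim: "y \<longlonglongrightarrow> y0"
  shows "(\<lambda>n. \<integral>w. \<bar>K t (y n - w) - K t (y0 - w)\<bar> \<partial>lborel) \<longlonglongrightarrow> 0"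
proof -
  have [measurable]: "K t \<in> borel_measurable borel" using t by simp
  have eq: "(\<integral>\<^sup>+ w. norm (K t (z - w)) \<partial>lborel) = 1" for z
    using kernel_integral[OF t, of z] kernel_integrable[OF t, of z]
    by (subst nn_integral_eq_integral) (auto simp: K_nonneg t)
  have "(\<lambda>n. \<integral>\<^sup>+ w. norm (K t (y n - w) - K t (y0 - w)) \<partial>lborel) \<longlonglongrightarrow> 0"
  proof (rule Scheffe_lemma2)
    show "integrable lborel (\<lambda>w. K t (y0 - w))" using t by (rule kernel_integrable)
    show "AE w in lborel. (\<lambda>n. K t (y n - w)) \<longlonglongrightarrow> K t (y0 - w)"
      by (intro AE_I2 continuous_on_tendsto_compose[OF K_cont[OF t]]) (auto intro!: tendsto_intros lim)
  qed (simp_all only: eq order_refl, simp_all)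
  moreover have "(\<integral>\<^sup>+ w. norm (K t (y n - w) - K t (y0 - w)) \<partial>lborel) =
      ennreal (\<integral>w. \<bar>K t (y n - w) - K t (y0 - w)\<bar> \<partial>lborel)" for n
    using kernel_integrable[OF t]
    by (subst nn_integral_eq_integral) (auto intro!: Bochner_Integration.integrable_diff integrable_abs)
  ultimately have *: "(\<lambda>n. ennreal (\<integral>w. \<bar>K t (y n - w) - K t (y0 - w)\<bar> \<partial>lborel)) \<longlonglongrightarrow> ennreal 0"
    by simp
  show ?thesis
    by (rule tendsto_ennrealD[OF *]) auto
qed

text \<open>Here the regularity comes from the kernel: two values differ by at most \<open>B\<close>
  times the L1 distance of the translated kernels. So the extension of a bounded measurable function
  at a positive time can serve as continuous data for the maximum principle.\<close>

lemma continuous_ext_bounded: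
  assumes g[measurable]: "g \<in> borel_measurable borel" and B: "\<And>w. \<bar>g w\<bar> \<le> B" and t: "0 < t"
  shows "continuous_on UNIV (\<lambda>y. ext g y t)"
proof (rule continuous_on_sequentiallyI)
  fix y :: "nat \<Rightarrow> 'a" and y0
  assume lim: "y \<longlonglongrightarrow> y0"
  have [measurable]: "K t \<in> borel_measurable borel" using t by simp
  have int: "integrable lborel (\<lambda>w. K t (z - w) * g w)" for z
    unfolding integrable_kernel_iff[OF g t] by (rule integrable_N_bounded[where B=B]) (auto simp: B)
  have "norm (ext g (y n) t - ext g y0 t) \<le> B * (\<integral>w. \<bar>K t (y n - w) - K t (y0 - w)\<bar> \<partial>lborel)" for n
  proof -
    have "ext g (y n) t - ext g y0 t = (\<integral>w. (K t (y n - w) - K t (y0 - w)) * g w \<partial>lborel)"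
      using int by (simp add: Kext_eq_ext[OF g t, symmetric] Kext_def left_diff_distrib)
    also have "norm \<dots> \<le> (\<integral>w. norm ((K t (y n - w) - K t (y0 - w)) * g w) \<partial>lborel)"
      by (rule integral_norm_bound)
    also have "\<dots> \<le> (\<integral>w. B * \<bar>K t (y n - w) - K t (y0 - w)\<bar> \<partial>lborel)"
    proof (rule integral_mono)
      show "integrable lborel (\<lambda>w. norm ((K t (y n - w) - K t (y0 - w)) * g w))"
        using int by (intro integrable_norm) (simp add: left_diff_distrib)
      show "integrable lborel (\<lambda>w. B * \<bar>K t (y n - w) - K t (y0 - w)\<bar>)"
        using kernel_integrable[OF t] by (intro integrable_mult_right integrable_abs Bochner_Integration.integrable_diff)
    qed (auto simp: abs_mult mult.commute intro!: mult_right_mono B)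
    finally show ?thesis by simp
  qed
  then have "(\<lambda>n. ext g (y n) t - ext g y0 t) \<longlonglongrightarrow> 0"
    by (rule Lim_null_comparison[OF always_eventually[OF allI]])
       (rule tendsto_mult_right_zero[OF kernel_translation_L1[OF t lim]])
  then show "(\<lambda>n. ext g (y n) t) \<longlonglongrightarrow> ext g y0 t"
    by (rule LIM_zero_cancel)
qed

lemma ext_bounded:
  assumes "g \<in> borel_measurable borel" and B: "\<And>w. \<bar>g w\<bar> \<le> B"
  shows "\<bar>ext g y t\<bar> \<le> B"
proof -
  have "norm (ext g y t) \<le> (\<integral>v. norm (g (y - \<sigma> t *\<^sub>R v)) \<partial>N)"
    unfolding ext_def by (rule integral_norm_bound)
  also have "\<dots> \<le> (\<integral>v. B \<partial>N)"
    using assms by (intro integral_mono) (auto intro!: integrable_N_bounded[where B=B])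
  finally show ?thesis by simp
qed

lemma ext_linear:
  assumes "integrable N (\<lambda>v. g (y - \<sigma> t *\<^sub>R v))" "integrable N (\<lambda>v. k (y - \<sigma> t *\<^sub>R v))"
  shows "ext (\<lambda>w. g w + c * k w) y t = ext g y t + c * ext k y t"
  using assms by (simp add: ext_def)

lemma variance_eq:
  fixes X :: "'a \<Rightarrow> real"
  assumes "integrable N X" "integrable N (\<lambda>v. (X v)\<^sup>2)"
  shows "(\<integral>v. (X v)\<^sup>2 \<partial>N) - (\<integral>v. X v \<partial>N)\<^sup>2 = (\<integral>v. (X v - (\<integral>v. X v \<partial>N))\<^sup>2 \<partial>N)"
  using N.variance_eq[of X] assms by simp

lemma square_integral_le:
  fixes X :: "'a \<Rightarrow> real"
  assumes "integrable N X" "integrable N (\<lambda>v. (X v)\<^sup>2)"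
  shows "(\<integral>v. X v \<partial>N)\<^sup>2 \<le> (\<integral>v. (X v :: real)\<^sup>2 \<partial>N)"
proof -
  have "0 \<le> (\<integral>v. (X v - (\<integral>v. X v \<partial>N))\<^sup>2 \<partial>N)" by simp
  then show ?thesis using variance_eq[OF assms] by linarith
qed

lemma integrable_NN_bounded:
  assumes "f \<in> borel_measurable (N \<Otimes>\<^sub>M N)" "\<And>x. \<bar>f x :: real\<bar> \<le> B"
  shows "integrable (N \<Otimes>\<^sub>M N) f"
  using assms by (intro NN.integrable_const_bound[of _ B]) auto

lemma ext_measurable [measurable]:
  assumes [measurable]: "g \<in> borel_measurable borel"
  shows "(\<lambda>y. ext g y t) \<in> borel_measurable borel"
  unfolding ext_def by measurable

lemma integrable_N_square:
  assumes "g \<in> borel_measurable borel" "\<And>w. \<bar>g w :: real\<bar> \<le> B"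
  shows "integrable N (\<lambda>v. (g v)\<^sup>2)"
  using assms by (intro integrable_N_bounded[where B="B\<^sup>2"] abs_power2_le) auto

text \<open>Variance is convex, so averaging the translates of a function does not increase it.\<close>

lemma variance_mollified:
  assumes [measurable]: "\<psi> \<in> borel_measurable borel" and B: "\<And>w. \<bar>\<psi> w\<bar> \<le> B"
    and var: "\<And>y. ext (\<lambda>w. (\<psi> w)\<^sup>2) y t - (ext \<psi> y t)\<^sup>2 \<le> \<nu>"
  shows "ext (\<lambda>w. (ext \<psi> w s)\<^sup>2) y t - (ext (\<lambda>w. ext \<psi> w s) y t)\<^sup>2 \<le> \<nu>"
proof -
  \<comment> \<open>\<open>v\<close> is the mollifying variable and \<open>v'\<close> the extension
    variable; \<open>c v\<close> is the mean over \<open>v'\<close> of the translate of \<psi> by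
    \<open>v\<close>.\<close>
  define X where "X v v' = \<psi> (y - \<sigma> s *\<^sub>R v - \<sigma> t *\<^sub>R v')" for v v'
  define c where "c v = (\<integral>v'. X v v' \<partial>N)" for v
  have XB: "\<bar>X v v'\<bar> \<le> B" for v v' by (simp add: X_def B)
  have [measurable]: "case_prod X \<in> borel_measurable (N \<Otimes>\<^sub>M N)"
    unfolding X_def by measurable
  have [measurable]: "c \<in> borel_measurable borel"
    unfolding c_def X_def by measurable
  have [measurable]: "X v \<in> borel_measurable borel" "(\<lambda>v. X v v') \<in> borel_measurable borel" for v v'
    unfolding X_def by measurable
  have c_ext: "c v = ext \<psi> (y - \<sigma> s *\<^sub>R v) t" for v
    by (simp add: c_def X_def ext_def)
  have cB: "\<bar>c v\<bar> \<le> B" for v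
    unfolding c_ext by (rule ext_bounded) (auto simp: B)
  have d4: "\<bar>(X v v' - c v)\<^sup>2\<bar> \<le> (2*B)\<^sup>2" for v v'
    using XB[of v v'] cB[of v] by (intro abs_power2_le) linarith
  have psi: "ext \<psi> (y - \<sigma> t *\<^sub>R v') s = (\<integral>v. X v v' \<partial>N)" for v'
    by (simp add: X_def ext_def algebra_simps)
  have psiB: "\<bar>ext \<psi> w s\<bar> \<le> B" for w
    by (rule ext_bounded) (auto simp: B)
  have mean: "(\<integral>v'. (\<integral>v. X v v' \<partial>N) \<partial>N) = (\<integral>v. c v \<partial>N)"
    unfolding c_def by (rule NN.Fubini_integral) (rule integrable_NN_bounded[where B=B], auto simp: XB)
  have "ext (\<lambda>w. (ext \<psi> w s)\<^sup>2) y t - (ext (\<lambda>w. ext \<psi> w s) y t)\<^sup>2 =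
     (\<integral>v'. (\<integral>v. X v v' \<partial>N)\<^sup>2 \<partial>N) - (\<integral>v'. (\<integral>v. X v v' \<partial>N) \<partial>N)\<^sup>2"
    by (simp add: ext_def[of _ y t] psi)
  also have "\<dots> = (\<integral>v'. ((\<integral>v. X v v' \<partial>N) - (\<integral>v. c v \<partial>N))\<^sup>2 \<partial>N)"
    unfolding mean[symmetric]
    by (intro variance_eq integrable_N_bounded[where B=B] integrable_N_bounded[where B="B\<^sup>2"] abs_power2_le)
       (simp_all add: psi[symmetric] psiB)
  \<comment> \<open>Jensen in \<open>v\<close>, applied to \<open>X v v' - c v\<close>. After
    exchanging the integrals the inner one is the variance of \<psi> at the point
    \<open>y - \<sigma> s * v\<close>, to which \<open>var\<close> applies.\<close>
  also have "\<dots> \<le> (\<integral>v'. (\<integral>v. (X v v' - c v)\<^sup>2 \<partial>N) \<partial>N)"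
  proof (rule integral_mono)
    show "integrable N (\<lambda>v'. ((\<integral>v. X v v' \<partial>N) - (\<integral>v. c v \<partial>N))\<^sup>2)"
    proof (intro integrable_N_bounded[where B="(B + \<bar>\<integral>v. c v \<partial>N\<bar>)\<^sup>2"] abs_power2_le)
      show "\<bar>(\<integral>v. X v v' \<partial>N) - (\<integral>v. c v \<partial>N)\<bar> \<le> B + \<bar>\<integral>v. c v \<partial>N\<bar>" for v'
        using psiB[of "y - \<sigma> t *\<^sub>R v'"] unfolding psi by linarith
    qed measurable
    show "integrable N (\<lambda>v'. \<integral>v. (X v v' - c v)\<^sup>2 \<partial>N)"
      using NN.integrable_snd[OF integrable_NN_bounded[where B="(2*B)\<^sup>2" and f="\<lambda>(v, v'). (X v v' - c v)\<^sup>2"]] d4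
      by (auto simp: split_beta')
    fix v'
    have iX: "integrable N (\<lambda>v. X v v')" "integrable N c"
      by (auto intro!: integrable_N_bounded[where B=B] simp: XB cB)
    have "((\<integral>v. X v v' \<partial>N) - (\<integral>v. c v \<partial>N))\<^sup>2 = (\<integral>v. X v v' - c v \<partial>N)\<^sup>2"
      using iX by simp
    also have "\<dots> \<le> (\<integral>v. (X v v' - c v)\<^sup>2 \<partial>N)"
      by (rule square_integral_le[OF Bochner_Integration.integrable_diff[OF iX]
          integrable_N_bounded[where B="(2*B)\<^sup>2"]]) (simp_all only: d4, measurable)
    finally show "((\<integral>v. X v v' \<partial>N) - (\<integral>v. c v \<partial>N))\<^sup>2 \<le> (\<integral>v. (X v v' - c v)\<^sup>2 \<partial>N)" .
  qed
  also have "\<dots> = (\<integral>v. (\<integral>v'. (X v v' - c v)\<^sup>2 \<partial>N) \<partial>N)"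
    by (rule NN.Fubini_integral) (rule integrable_NN_bounded[where B="(2*B)\<^sup>2"], use d4 in auto)
  also have "\<dots> \<le> (\<integral>v. \<nu> \<partial>N)"
  proof (rule integral_mono)
    show "integrable N (\<lambda>v. \<integral>v'. (X v v' - c v)\<^sup>2 \<partial>N)"
      using NN.integrable_fst[OF integrable_NN_bounded[where B="(2*B)\<^sup>2" and f="\<lambda>(v, v'). (X v v' - c v)\<^sup>2"]] d4
      by (auto simp: split_beta')
    fix v
    have "(\<integral>v'. (X v v' - c v)\<^sup>2 \<partial>N) = (\<integral>v'. (X v v')\<^sup>2 \<partial>N) - (\<integral>v'. X v v' \<partial>N)\<^sup>2"
      unfolding c_def
      by (intro variance_eq[symmetric] integrable_N_bounded[where B=B] integrable_N_bounded[where B="B\<^sup>2"] abs_power2_le)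
         (auto simp: XB)
    also have "\<dots> \<le> \<nu>"
      using var[of "y - \<sigma> s *\<^sub>R v"] by (simp add: ext_def X_def)
    finally show "(\<integral>v'. (X v v' - c v)\<^sup>2 \<partial>N) \<le> \<nu>" .
  qed simp
  finally show ?thesis by simp
qed

section \<open>The maximum principle for continuous data\<close>

lemma second_moment_bound_continuous:
  assumes cont: "continuous_on UNIV \<psi>" and B: "\<And>w. \<bar>\<psi> w\<bar> \<le> B" and nonneg: "\<And>w. 0 \<le> \<psi> w"
    and var: "\<And>y t. 0 < t \<Longrightarrow> ext (\<lambda>w. (\<psi> w)\<^sup>2) y t - (ext \<psi> y t)\<^sup>2 \<le> \<nu>\<^sup>2"
    and \<mu>: "0 < \<nu>" "\<nu> < \<mu>" and t0: "0 < t0" and small: "ext \<psi> y0 t0 < \<mu>"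
  shows "ext (\<lambda>w. (\<psi> w)\<^sup>2) y0 t0 \<le> 2 * \<mu> * ext \<psi> y0 t0"
proof (rule ccontr)
  assume neg: "\<not> ?thesis"
  have [measurable]: "\<psi> \<in> borel_measurable borel"
    using cont by (rule borel_measurable_continuous_onI)
  define g where "g w = (\<psi> w)\<^sup>2 + (- 2 * \<mu>) * \<psi> w" for w
  have g_cont: "continuous_on UNIV g" unfolding g_def by (intro continuous_intros cont)
  have [measurable]: "g \<in> borel_measurable borel" unfolding g_def by measurable
  define C where "C = B\<^sup>2 + 2 * \<mu> * B"
  have gB: "\<bar>g w\<bar> \<le> C" for w
  proof -
    have "\<bar>g w\<bar> \<le> \<bar>(\<psi> w)\<^sup>2\<bar> + \<bar>2 * \<mu> * \<psi> w\<bar>" unfolding g_def by linarith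
    also have "\<dots> \<le> C"
      unfolding C_def abs_mult using \<mu> B[of w] by (intro add_mono abs_power2_le mult_mono) auto
    finally show ?thesis .
  qed
  have ext_g: "ext g y t = ext (\<lambda>w. (\<psi> w)\<^sup>2) y t - 2 * \<mu> * ext \<psi> y t" for y t
    unfolding g_def
    by (subst ext_linear) (simp_all add: integrable_N_bounded[OF _ B] integrable_N_square[OF _ B])
  define u where "u z = ext g (fst z) (snd z)" for z
  define q where "q z = ext \<psi> (fst z) (snd z)" for z
  define z0 where "z0 = (y0, t0)"
  have u0: "0 < u z0" using neg by (simp add: u_def z0_def ext_g)
  have h0: "0 \<le> h z0" using h_nonneg t0 by (simp add: z0_def)
  \<comment> \<open>Small enough that the barrier takes at most half of \<open>u z0\<close>, so that
    \<open>z0\<close> stays in the set \<open>A\<close>; adding 1 avoids division by zero.\<close>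
  define \<delta> where "\<delta> = u z0 / (2 * (h z0 + 1))"
  have \<delta>: "0 < \<delta>" using u0 h0 by (simp add: \<delta>_def)
  have "\<delta> * h z0 \<le> \<delta> * (h z0 + 1)" using \<delta> by (intro mult_left_mono) auto
  also have "\<dots> = u z0 / 2" using h0 by (simp add: \<delta>_def field_simps)
  finally have \<kappa>0: "u z0 / 2 \<le> u z0 - \<delta> * h z0" by simp
  let ?H = "UNIV \<times> {0..} :: ('a \<times> real) set"
  let ?w = "\<lambda>z. u z - \<delta> * h z"
  \<comment> \<open>The threshold has two effects: on \<open>A\<close> one has
    \<open>\<delta> * h z \<le> u z \<le> C\<close>, so coercivity of \<open>h\<close> bounds
    \<open>A\<close>; and \<open>u\<close> is positive on all of \<open>A\<close>, in particular at
    the maximizer.\<close>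
  define A where "A = {z \<in> ?H. q z \<le> \<mu> \<and> u z0 / 2 \<le> ?w z}"
  have closedH: "closed ?H" by (intro closed_Times) auto
  have cont_u: "continuous_on ?H u" unfolding u_def by (rule continuous_ext[OF g_cont gB])
  have cont_q: "continuous_on ?H q" unfolding q_def by (rule continuous_ext[OF cont B])
  have cont_w: "continuous_on ?H ?w" by (intro continuous_intros cont_u h_cont)
  have "A = (?H \<inter> q -` {..\<mu>}) \<inter> (?H \<inter> ?w -` {u z0 / 2..})" by (auto simp: A_def)
  then have "closed A"
    by (simp only:) (intro closed_Int continuous_closed_preimage cont_q cont_w closedH closed_atMost closed_atLeast)
  moreover have "bounded A"
  proof (rule bounded_subset[OF h_coercive[of "C / \<delta>"]], safe)
    fix y t assume "(y, t) \<in> A"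
    then have t: "0 \<le> t" and "0 \<le> u (y, t) - \<delta> * h (y, t)"
      using u0 by (auto simp: A_def)
    moreover have "u (y, t) \<le> C"
      using ext_bounded[of g C y t] gB by (auto simp: u_def)
    ultimately show "0 \<le> snd (y, t)" "h (y, t) \<le> C / \<delta>"
      using \<delta> by (auto simp: field_simps)
  qed
  ultimately have "compact A" by (simp add: compact_eq_bounded_closed)
  moreover have "z0 \<in> A" using small t0 \<kappa>0 by (auto simp: A_def q_def z0_def)
  moreover have "continuous_on A ?w" by (rule continuous_on_subset[OF cont_w]) (auto simp: A_def)
  ultimately obtain z1 where z1: "z1 \<in> A" and max: "\<And>z. z \<in> A \<Longrightarrow> ?w z \<le> ?w z1"
    using continuous_attains_sup[of A ?w] by blast
  obtain y1 t1 where z1_eq: "z1 = (y1, t1)" by (cases z1)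
  have t1: "0 \<le> t1" and q1: "q z1 \<le> \<mu>" and w1: "u z0 / 2 \<le> ?w z1"
    using z1 by (auto simp: A_def z1_eq)
  have u1: "0 < u z1"
    using w1 u0 h_nonneg[of z1] t1 \<delta> by (smt (verit) z1_eq snd_conv half_gt_zero mult_nonneg_nonneg)
  \<comment> \<open>At time 0 the extensions are the functions themselves, and
    \<open>g = \<psi> * (\<psi> - 2 * \<mu>)\<close> is nonpositive where \<psi> lies between 0 and
    \<mu>.\<close>
  have "t1 \<noteq> 0"
  proof
    assume "t1 = 0"
    then have "0 < g y1" "\<psi> y1 \<le> \<mu>" using u1 q1 by (simp_all add: u_def q_def z1_eq)
    moreover have "g y1 = \<psi> y1 * (\<psi> y1 - 2 * \<mu>)" by (simp add: g_def algebra_simps power2_eq_square)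
    ultimately show False using nonneg[of y1] \<mu> by (simp add: zero_less_mult_iff)
  qed
  with t1 have t1: "0 < t1" by simp
  have q1: "q z1 < \<mu>"
  proof (rule ccontr)
    assume "\<not> q z1 < \<mu>"
    with q1 have "ext \<psi> y1 t1 = \<mu>" by (simp add: q_def z1_eq)
    \<comment> \<open>On the face \<open>q = \<mu>\<close>, positivity of \<open>u\<close> means a
      second moment above \<open>2 * \<mu>^2\<close>, hence a variance above
      \<open>\<mu>^2\<close>.\<close>
    with var[OF t1, of y1] u1 have "\<mu>\<^sup>2 < \<nu>\<^sup>2" by (simp add: u_def z1_eq ext_g power2_eq_square)
    then show False using \<mu> power2_less_imp_less[of \<mu> \<nu>] by simp
  qed
  \<comment> \<open>Both remaining constraints, \<open>q < \<mu>\<close> and positive time, are open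
    at \<open>z1\<close>; so the better point that \<open>no_local_max\<close> finds nearby lies in
    \<open>A\<close> again.\<close>
  have "continuous (at z1 within ?H) q"
    using cont_q t1 by (simp add: continuous_on_eq_continuous_within z1_eq)
  moreover have "z1 \<in> interior ?H"
    using t1 by (simp add: interior_Times z1_eq)
  ultimately have "isCont q z1" by (simp only: at_within_interior)
  then have "(q \<longlongrightarrow> q z1) (nhds z1)"
    by (simp only: isCont_def tendsto_at_iff_tendsto_nhds)
  then have "\<forall>\<^sub>F z in nhds z1. q z < \<mu>"
    using q1 by (rule order_tendstoD(2))
  moreover have "\<forall>\<^sub>F z in nhds z1. z \<in> interior ?H"
    using \<open>z1 \<in> interior ?H\<close> by (intro eventually_nhds_in_open) auto
  ultimately have "\<forall>\<^sub>F z in nhds z1. q z < \<mu> \<and> z \<in> interior ?H" by (rule eventually_conj)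
  then obtain e where e: "0 < e" "\<And>z. dist z z1 < e \<Longrightarrow> q z < \<mu> \<and> z \<in> interior ?H"
    unfolding eventually_nhds_metric by blast
  obtain z where z: "z \<in> ball (y1, t1) e"
    and gt: "Kext K g y1 t1 - \<delta> * h (y1, t1) < Kext K g (fst z) (snd z) - \<delta> * h z"
    using no_local_max[of g C t1 \<delta> e y1] gB t1 \<delta> e(1) by auto
  have "q z < \<mu>" and int: "z \<in> interior ?H" using e(2)[of z] z by (auto simp: z1_eq dist_commute)
  have "0 < snd z" using int by (auto simp: interior_Times)
  then have gt: "?w z1 < ?w z"
    using gt t1 by (simp add: Kext_eq_ext u_def z1_eq)
  then have "z \<in> A" using \<open>q z < \<mu>\<close> \<open>0 < snd z\<close> w1 by (auto simp: A_def mem_Times_iff)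
  with max[OF this] gt show False by linarith
qed

section \<open>From continuous to bounded measurable data\<close>

text \<open>Done with the kernel against Lebesgue measure, where the exceptional null set is given;
  under \<open>N\<close> it would first have to be carried through the affine map.\<close>

lemma ext_dominated_convergence:
  assumes [measurable]: "\<And>n. f n \<in> borel_measurable borel" "g \<in> borel_measurable borel"
    and B: "\<And>n w. \<bar>f n w\<bar> \<le> B" and lim: "AE w in lborel. (\<lambda>n. f n w) \<longlonglongrightarrow> g w" and t: "0 < t"
  shows "(\<lambda>n. ext (f n) y t) \<longlonglongrightarrow> ext g y t"
proof -
  have [measurable]: "K t \<in> borel_measurable borel" using t by simp
  have "(\<lambda>n. \<integral>w. K t (y - w) * f n w \<partial>lborel) \<longlonglongrightarrow> (\<integral>w. K t (y - w) * g w \<partial>lborel)"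
  proof (rule integral_dominated_convergence[where w="\<lambda>w. K t (y - w) * B"])
    show "integrable lborel (\<lambda>w. K t (y - w) * B)"
      using kernel_integrable[OF t] by simp
    show "AE w in lborel. (\<lambda>n. K t (y - w) * f n w) \<longlonglongrightarrow> K t (y - w) * g w"
      using lim by eventually_elim (intro tendsto_intros)
    show "AE w in lborel. norm (K t (y - w) * f n w) \<le> K t (y - w) * B" for n
      using K_nonneg[OF t] B by (auto simp: abs_mult intro!: mult_left_mono)
  qed auto
  then show ?thesis
    by (simp add: Kext_eq_ext[symmetric] t Kext_def)
qed

text \<open>Three-term estimate through a continuous approximation \<open>k n\<close>. The error
  \<open>D n\<close> also appears at the shifted point \<open>y - d j\<close>; since
  \<open>D n\<close> is only measurable, continuity of its extension in \<open>y\<close> brings it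
  back to \<open>y\<close>. Hence \<open>n\<close> is fixed first and \<open>j\<close> sent to
  infinity afterwards.\<close>

lemma translation_continuity:
  fixes g :: "'a \<Rightarrow> real"
  assumes [measurable]: "g \<in> borel_measurable borel" and B: "\<And>w. \<bar>g w\<bar> \<le> B"
    and t: "0 < t" and d: "d \<longlonglongrightarrow> 0"
  shows "(\<lambda>j. ext (\<lambda>w. \<bar>g (w - d j) - g w\<bar>) y t) \<longlonglongrightarrow> 0"
proof -
  obtain k where k: "\<And>n. continuous_on UNIV (k n)" "\<And>n w. \<bar>k n w\<bar> \<le> B"
    "AE w in lborel. (\<lambda>n. k n w) \<longlonglongrightarrow> g w"
    by (rule bounded_measurable_approx[OF assms(1) B]) auto
  have [measurable]: "k n \<in> borel_measurable borel" for n
    using k(1) by (rule borel_measurable_continuous_onI)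
  define D where "D n w = \<bar>g w - k n w\<bar>" for n w
  have [measurable]: "D n \<in> borel_measurable borel" for n
    unfolding D_def by measurable
  have DB: "\<bar>D n w\<bar> \<le> 2 * B" for n w
    using B[of w] k(2)[of n w] unfolding D_def by linarith
  have "(\<lambda>n. ext (D n) y t) \<longlonglongrightarrow> ext (\<lambda>_. 0) y t"
  proof (rule ext_dominated_convergence[OF _ _ DB _ t])
    show "AE w in lborel. (\<lambda>n. D n w) \<longlonglongrightarrow> 0"
      using k(3)
    proof eventually_elim
      case (elim w)
      then have "(\<lambda>n. \<bar>g w - k n w\<bar>) \<longlonglongrightarrow> \<bar>g w - g w\<bar>" by (intro tendsto_intros)
      then show ?case by (simp add: D_def)
    qed
  qed auto
  then have D0: "(\<lambda>n. ext (D n) y t) \<longlonglongrightarrow> 0" by (simp add: ext_def)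
  have kd: "(\<lambda>j. ext (\<lambda>w. \<bar>k n (w - d j) - k n w\<bar>) y t) \<longlonglongrightarrow> 0" for n
  proof -
    have "(\<lambda>j. ext (\<lambda>w. \<bar>k n (w - d j) - k n w\<bar>) y t) \<longlonglongrightarrow> ext (\<lambda>_. 0) y t"
    proof (rule ext_dominated_convergence[where B="2*B", OF _ _ _ _ t])
      show "\<bar>\<bar>k n (w - d j) - k n w\<bar>\<bar> \<le> 2 * B" for j w
        using k(2)[of n w] k(2)[of n "w - d j"] by linarith
      have "(\<lambda>j. \<bar>k n (w - d j) - k n w\<bar>) \<longlonglongrightarrow> \<bar>k n w - k n w\<bar>" for w
        by (intro tendsto_intros continuous_on_tendsto_compose[OF k(1)]) (use tendsto_diff[OF tendsto_const d, of w] in auto)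
      then show "AE w in lborel. (\<lambda>j. \<bar>k n (w - d j) - k n w\<bar>) \<longlonglongrightarrow> 0" by simp
    qed auto
    then show ?thesis by (simp add: ext_def)
  qed
  have bound: "ext (\<lambda>w. \<bar>g (w - d j) - g w\<bar>) y t \<le>
      ext (D n) (y - d j) t + ext (\<lambda>w. \<bar>k n (w - d j) - k n w\<bar>) y t + ext (D n) y t" for n j
  proof -
    let ?T = "\<lambda>v. y - \<sigma> t *\<^sub>R v"
    have k2: "\<bar>k n u - k n w\<bar> \<le> 2 * B" "\<bar>g u - g w\<bar> \<le> 2 * B" for u w
      using k(2)[of n w] k(2)[of n u] B[of u] B[of w] by linarith+
    have i: "integrable N (\<lambda>v. D n (?T v - d j))" "integrable N (\<lambda>v. \<bar>k n (?T v - d j) - k n (?T v)\<bar>)"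
      "integrable N (\<lambda>v. D n (?T v))" "integrable N (\<lambda>v. \<bar>g (?T v - d j) - g (?T v)\<bar>)"
      by (rule integrable_N_bounded[where B="2*B"]; use DB k2 in simp)+
    have "ext (\<lambda>w. \<bar>g (w - d j) - g w\<bar>) y t \<le>
      (\<integral>v. D n (?T v - d j) + \<bar>k n (?T v - d j) - k n (?T v)\<bar> + D n (?T v) \<partial>N)"
      unfolding ext_def using i by (intro integral_mono) (auto simp: D_def)
    also have "\<dots> = (\<integral>v. D n (?T v - d j) \<partial>N) + (\<integral>v. \<bar>k n (?T v - d j) - k n (?T v)\<bar> \<partial>N) + (\<integral>v. D n (?T v) \<partial>N)"
      using i by simp
    finally show ?thesis by (simp add: ext_def algebra_simps)
  qed
  show ?thesis
  proof (rule LIMSEQ_I)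
    fix r :: real assume r: "0 < r"
    then have "\<forall>\<^sub>F n in sequentially. ext (D n) y t < r / 4"
      by (intro order_tendstoD(2)[OF D0]) simp
    then obtain n where n: "ext (D n) y t < r / 4"
      by (auto dest: eventually_happens)
    have "(\<lambda>j. ext (D n) (y - d j) t) \<longlonglongrightarrow> ext (D n) y t"
      using tendsto_diff[OF tendsto_const d, of y]
      by (intro continuous_on_tendsto_compose[OF continuous_ext_bounded[OF _ DB t]]) auto
    then have 1: "\<forall>\<^sub>F j in sequentially. ext (D n) (y - d j) t < r / 4"
      using n by (rule order_tendstoD(2))
    have 2: "\<forall>\<^sub>F j in sequentially. ext (\<lambda>w. \<bar>k n (w - d j) - k n w\<bar>) y t < r / 4"
      using r by (intro order_tendstoD(2)[OF kd]) simp
    have "\<forall>\<^sub>F j in sequentially. norm (ext (\<lambda>w. \<bar>g (w - d j) - g w\<bar>) y t - 0) < r"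
      using 1 2
    proof eventually_elim
      case (elim j)
      moreover have "0 \<le> ext (\<lambda>w. \<bar>g (w - d j) - g w\<bar>) y t"
        unfolding ext_def by simp
      ultimately show ?case using bound[of j n] n r by simp
    qed
    then show "\<exists>no. \<forall>j\<ge>no. norm (ext (\<lambda>w. \<bar>g (w - d j) - g w\<bar>) y t - 0) < r"
      by (simp add: eventually_sequentially)
  qed
qed

text \<open>The mollification error is at most the average over \<open>v\<close> of the translation
  errors by \<open>\<sigma> (s j) * v\<close>. Each of these tends to 0 by
  \<open>translation_continuity\<close>, and the constant \<open>2 * B\<close> dominates on the
  probability space \<open>N\<close>.\<close>

lemma mollification_L1:
  fixes g :: "'a \<Rightarrow> real"
  assumes [measurable]: "g \<in> borel_measurable borel" and B: "\<And>w. \<bar>g w\<bar> \<le> B"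
    and t: "0 < t" and s: "s \<longlonglongrightarrow> 0" "\<And>j. 0 \<le> s j"
  shows "(\<lambda>j. ext (\<lambda>w. \<bar>ext g w (s j) - g w\<bar>) y t) \<longlonglongrightarrow> 0"
proof -
  have \<sigma>s: "(\<lambda>j. \<sigma> (s j)) \<longlonglongrightarrow> 0"
    using continuous_on_tendsto_compose[OF \<sigma>_cont s(1)] s(2) by (simp add: \<sigma>_0)
  have g2: "\<bar>g u - g w\<bar> \<le> 2 * B" for u w
    using B[of u] B[of w] by linarith
  let ?E = "\<lambda>j v. ext (\<lambda>w. \<bar>g (w - \<sigma> (s j) *\<^sub>R v) - g w\<bar>) y t"
  have Em [measurable]: "?E j \<in> borel_measurable N" for j
    unfolding ext_def by measurable
  have "(\<lambda>j. \<integral>v. ?E j v \<partial>N) \<longlonglongrightarrow> (\<integral>v. 0 \<partial>N)"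
  proof (rule integral_dominated_convergence[where w="\<lambda>_. 2 * B"])
    show "AE v in N. (\<lambda>j. ?E j v) \<longlonglongrightarrow> 0"
    proof (rule AE_I2)
      fix v :: 'a
      have "(\<lambda>j. \<sigma> (s j) *\<^sub>R v) \<longlonglongrightarrow> 0"
        using tendsto_scaleR[OF \<sigma>s tendsto_const[of v]] by simp
      then show "(\<lambda>j. ?E j v) \<longlonglongrightarrow> 0"
        by (rule translation_continuity[OF assms(1) B t])
    qed
    show "AE v in N. norm (?E j v) \<le> 2 * B" for j
      unfolding real_norm_def by (intro AE_I2 ext_bounded) (auto simp: g2)
  qed auto
  then have lim: "(\<lambda>j. \<integral>v. ?E j v \<partial>N) \<longlonglongrightarrow> 0" by simp
  have le: "ext (\<lambda>w. \<bar>ext g w (s j) - g w\<bar>) y t \<le> (\<integral>v. ?E j v \<partial>N)" for j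
  proof -
    let ?T = "\<lambda>v. y - \<sigma> t *\<^sub>R v"
    have int: "integrable (N \<Otimes>\<^sub>M N) (\<lambda>(v, v'). \<bar>g (?T v' - \<sigma> (s j) *\<^sub>R v) - g (?T v')\<bar>)"
      by (rule integrable_NN_bounded[where B="2*B"]) (auto simp: g2)
    have "ext (\<lambda>w. \<bar>ext g w (s j) - g w\<bar>) y t \<le>
      (\<integral>v'. (\<integral>v. \<bar>g (?T v' - \<sigma> (s j) *\<^sub>R v) - g (?T v')\<bar> \<partial>N) \<partial>N)"
      unfolding ext_def[of _ y t]
    proof (rule integral_mono)
      show "integrable N (\<lambda>v'. \<bar>ext g (?T v') (s j) - g (?T v')\<bar>)"
      proof (rule integrable_N_bounded[where B="2*B"])
        show "\<bar>\<bar>ext g (?T v') (s j) - g (?T v')\<bar>\<bar> \<le> 2 * B" for v'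
          using ext_bounded[of g B "?T v'" "s j"] B B[of "?T v'"] by fastforce
      qed measurable
      show "integrable N (\<lambda>v'. \<integral>v. \<bar>g (?T v' - \<sigma> (s j) *\<^sub>R v) - g (?T v')\<bar> \<partial>N)"
        using NN.integrable_snd[OF int] by simp
      fix v'
      have "ext g (?T v') (s j) - g (?T v') = (\<integral>v. g (?T v' - \<sigma> (s j) *\<^sub>R v) - g (?T v') \<partial>N)"
        unfolding ext_def
        by (subst Bochner_Integration.integral_diff) (auto intro!: integrable_N_bounded[where B=B] simp: B)
      also have "\<bar>\<dots>\<bar> \<le> (\<integral>v. \<bar>g (?T v' - \<sigma> (s j) *\<^sub>R v) - g (?T v')\<bar> \<partial>N)"
        using integral_norm_bound[of N "\<lambda>v. g (?T v' - \<sigma> (s j) *\<^sub>R v) - g (?T v')"] by simp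
      finally show "\<bar>ext g (?T v') (s j) - g (?T v')\<bar> \<le> (\<integral>v. \<bar>g (?T v' - \<sigma> (s j) *\<^sub>R v) - g (?T v')\<bar> \<partial>N)" .
    qed
    also have "\<dots> = (\<integral>v. ?E j v \<partial>N)"
      unfolding ext_def by (rule NN.Fubini_integral[OF int])
    finally show ?thesis .
  qed
  show ?thesis
  proof (rule tendsto_sandwich[OF _ _ tendsto_const lim])
    show "\<forall>\<^sub>F j in sequentially. 0 \<le> ext (\<lambda>w. \<bar>ext g w (s j) - g w\<bar>) y t"
      by (simp add: ext_def[of _ y t])
  qed (simp add: le)
qed

text \<open>All hypotheses of the continuous case pass to the mollifications \<open>P j\<close>.
  Their L1 convergence also gives convergence of second moments, because
  \<open>\<bar>p^2 - q^2\<bar> \<le> 2 * B * \<bar>p - q\<bar>\<close> for values bounded by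
  \<open>B\<close>.\<close>

lemma second_moment_bound:
  assumes [measurable]: "\<psi> \<in> borel_measurable borel" and B: "\<And>w. \<bar>\<psi> w\<bar> \<le> B" and nonneg: "\<And>w. 0 \<le> \<psi> w"
    and var: "\<And>y t. 0 < t \<Longrightarrow> ext (\<lambda>w. (\<psi> w)\<^sup>2) y t - (ext \<psi> y t)\<^sup>2 \<le> \<nu>\<^sup>2"
    and \<mu>: "0 < \<nu>" "\<nu> < \<mu>" and t: "0 < t" and small: "ext \<psi> y t < \<mu>"
  shows "ext (\<lambda>w. (\<psi> w)\<^sup>2) y t \<le> 2 * \<mu> * ext \<psi> y t"
proof -
  define s where "s j = 1 / real (Suc j)" for j
  have s: "s \<longlonglongrightarrow> 0" "\<And>j. 0 < s j"
    using LIMSEQ_inverse_real_of_nat unfolding s_def by (simp_all only: inverse_eq_divide) simp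
  define P where "P j w = ext \<psi> w (s j)" for j w
  have [measurable]: "P j \<in> borel_measurable borel" for j unfolding P_def by measurable
  have PB: "\<bar>P j w\<bar> \<le> B" for j w unfolding P_def by (rule ext_bounded) (auto simp: B)
  have L: "(\<lambda>j. ext (\<lambda>w. \<bar>P j w - \<psi> w\<bar>) y t) \<longlonglongrightarrow> 0"
    unfolding P_def by (rule mollification_L1[OF _ B t s(1)]) (auto simp: s(2) less_imp_le)
  have i: "integrable N (\<lambda>v. P j (y - \<sigma> t *\<^sub>R v))" "integrable N (\<lambda>v. \<psi> (y - \<sigma> t *\<^sub>R v))"
    "integrable N (\<lambda>v. (P j (y - \<sigma> t *\<^sub>R v))\<^sup>2)" "integrable N (\<lambda>v. (\<psi> (y - \<sigma> t *\<^sub>R v))\<^sup>2)"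
    "integrable N (\<lambda>v. \<bar>P j (y - \<sigma> t *\<^sub>R v) - \<psi> (y - \<sigma> t *\<^sub>R v)\<bar>)" for j
    using integrable_N_bounded[of "\<lambda>v. P j (y - \<sigma> t *\<^sub>R v)" B] integrable_N_bounded[of "\<lambda>v. \<psi> (y - \<sigma> t *\<^sub>R v)" B]
      integrable_N_square[of "\<lambda>v. P j (y - \<sigma> t *\<^sub>R v)" B] integrable_N_square[of "\<lambda>v. \<psi> (y - \<sigma> t *\<^sub>R v)" B]
    by (simp_all add: B PB)
  have 1: "(\<lambda>j. ext (P j) y t) \<longlonglongrightarrow> ext \<psi> y t"
  proof (rule LIM_zero_cancel, rule Lim_null_comparison[OF always_eventually[OF allI] L])
    fix j
    show "norm (ext (P j) y t - ext \<psi> y t) \<le> ext (\<lambda>w. \<bar>P j w - \<psi> w\<bar>) y t"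
      using integral_norm_bound[of N "\<lambda>v. P j (y - \<sigma> t *\<^sub>R v) - \<psi> (y - \<sigma> t *\<^sub>R v)"] i
      by (simp add: ext_def)
  qed
  have 2: "(\<lambda>j. ext (\<lambda>w. (P j w)\<^sup>2) y t) \<longlonglongrightarrow> ext (\<lambda>w. (\<psi> w)\<^sup>2) y t"
  proof (rule LIM_zero_cancel, rule Lim_null_comparison[OF always_eventually[OF allI] tendsto_mult_right_zero[OF L, of "2 * B"]])
    fix j
    let ?P = "\<lambda>v. P j (y - \<sigma> t *\<^sub>R v)" and ?Q = "\<lambda>v. \<psi> (y - \<sigma> t *\<^sub>R v)"
    have "norm (ext (\<lambda>w. (P j w)\<^sup>2) y t - ext (\<lambda>w. (\<psi> w)\<^sup>2) y t) \<le> (\<integral>v. norm ((?P v)\<^sup>2 - (?Q v)\<^sup>2) \<partial>N)"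
      using integral_norm_bound[of N "\<lambda>v. (?P v)\<^sup>2 - (?Q v)\<^sup>2"] i by (simp add: ext_def)
    also have "\<dots> \<le> (\<integral>v. 2 * B * \<bar>?P v - ?Q v\<bar> \<partial>N)"
    proof (rule integral_mono)
      fix v :: 'a
      have "norm ((?P v)\<^sup>2 - (?Q v)\<^sup>2) = \<bar>?P v + ?Q v\<bar> * \<bar>?P v - ?Q v\<bar>"
        by (simp add: power2_eq_square square_diff_square_factored abs_mult)
      also have "\<dots> \<le> 2 * B * \<bar>?P v - ?Q v\<bar>"
        using PB[of j "y - \<sigma> t *\<^sub>R v"] B[of "y - \<sigma> t *\<^sub>R v"] by (intro mult_right_mono) auto
      finally show "norm ((?P v)\<^sup>2 - (?Q v)\<^sup>2) \<le> 2 * B * \<bar>?P v - ?Q v\<bar>" .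
    qed (use i in auto)
    finally show "norm (ext (\<lambda>w. (P j w)\<^sup>2) y t - ext (\<lambda>w. (\<psi> w)\<^sup>2) y t) \<le> 2 * B * ext (\<lambda>w. \<bar>P j w - \<psi> w\<bar>) y t"
      by (simp add: ext_def)
  qed
  \<comment> \<open>The strict inequality in \<open>small\<close> is inherited by all late
    mollifications.\<close>
  have "\<forall>\<^sub>F j in sequentially. ext (P j) y t < \<mu>"
    using order_tendstoD(2)[OF 1 small] .
  then have "\<forall>\<^sub>F j in sequentially. ext (\<lambda>w. (P j w)\<^sup>2) y t \<le> 2 * \<mu> * ext (P j) y t"
  proof eventually_elim
    case (elim j)
    show ?case
    proof (rule second_moment_bound_continuous[OF _ PB _ _ \<mu> t elim])
      show "continuous_on UNIV (P j)"
        unfolding P_def by (rule continuous_ext_bounded[OF _ B s(2)]) auto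
      show "0 \<le> P j w" for w unfolding P_def ext_def using nonneg by simp
      show "ext (\<lambda>w. (P j w)\<^sup>2) y' t' - (ext (P j) y' t')\<^sup>2 \<le> \<nu>\<^sup>2" if "0 < t'" for y' t'
        unfolding P_def by (rule variance_mollified[OF _ B var[OF that]]) auto
    qed
  qed
  then show ?thesis
    by (intro tendsto_le[OF _ tendsto_mult[OF tendsto_const 1] 2]) auto
qed

end

section \<open>Clipping and rearrangement\<close>

definition clip :: "real \<Rightarrow> real \<Rightarrow> real \<Rightarrow> real" where
  "clip a b x = max a (min b x)"

lemma clip_measurable [measurable]: "clip a b \<in> borel_measurable borel"
  unfolding clip_def by measurable

lemma clip_dist: "\<bar>clip a b x - clip a b z\<bar> \<le> \<bar>x - z\<bar>"
  unfolding clip_def by linarith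

lemma (in prob_space) quantile_function:
  fixes X :: "'a \<Rightarrow> real"
  assumes [measurable]: "X \<in> borel_measurable M"
  obtains \<eta> :: "real \<Rightarrow> real" where "\<eta> \<in> borel_measurable borel" "mono_on {0<..<1} \<eta>"
    "distr (restrict_space lborel {0<..<1}) borel \<eta> = distr M borel X"
proof -
  interpret L: cdf_distribution "distr M borel X"
    unfolding cdf_distribution_def by (rule real_distribution_distr) simp
  \<comment> \<open>\<open>L.I\<close> is the generalized inverse of the distribution function, as
    in Skorohod's representation. It is meaningful on the open unit interval only; the value 0
    elsewhere makes \<eta> Borel on the whole line.\<close>
  define \<eta> where "\<eta> s = (if s \<in> {0<..<1} then L.I s else 0)" for s :: real
  have "\<eta> \<in> borel_measurable borel"
    unfolding \<eta>_def using L.measurable_CI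
    by (subst measurable_If_restrict_space_iff) (auto simp: greaterThanLessThan_eq Collect_conj_eq[symmetric] Int_def)
  moreover have "mono_on {0<..<1} \<eta>"
    using L.mono_I by (auto simp: mono_on_def \<eta>_def)
  moreover have "distr (restrict_space lborel {0<..<1}) borel \<eta> = distr M borel X"
  proof -
    have "distr (restrict_space lborel {0<..<1}) borel \<eta> = distr (restrict_space lborel {0<..<1}) borel L.I"
      by (rule distr_cong) (auto simp: \<eta>_def space_restrict_space)
    also have "\<dots> = distr M borel X" by (rule L.distr_I_eq_M)
    finally show ?thesis .
  qed
  ultimately show ?thesis by (rule that)
qed

text \<open>The mean minimizes the mean square deviation, so any centre \<open>m\<close> certifies a
  variance bound. This frees \<open>m\<close> to be chosen from the whole distribution and not from
  the part on \<open>{c..d}\<close>.\<close>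

lemma avg_variance_le:
  assumes cd: "c < d" and int: "set_integrable lborel {c..d} \<eta>" "set_integrable lborel {c..d} (\<lambda>s. (\<eta> s)\<^sup>2)"
    and le: "(LINT s:{c..d}|lborel. (\<eta> s - m)\<^sup>2 - \<mu>\<^sup>2) \<le> 0"
  shows "avg c d (\<lambda>s. (\<eta> s)\<^sup>2) - (avg c d \<eta>)\<^sup>2 \<le> \<mu>\<^sup>2"
proof -
  let ?a = "LINT s:{c..d}|lborel. \<eta> s" and ?b = "LINT s:{c..d}|lborel. (\<eta> s)\<^sup>2" and ?p = "d - c"
  have const: "set_integrable lborel {c..d} (\<lambda>s. k)" "(LINT s:{c..d}|lborel. k) = k * ?p" for k :: real
    using cd by (simp_all add: set_integrable_def set_lebesgue_integral_def)
  have "(\<lambda>s. (\<eta> s - m)\<^sup>2 - \<mu>\<^sup>2) = (\<lambda>s. (\<eta> s)\<^sup>2 - 2 * m * \<eta> s + (m\<^sup>2 - \<mu>\<^sup>2))"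
    by (auto simp: power2_diff)
  then have "(LINT s:{c..d}|lborel. (\<eta> s - m)\<^sup>2 - \<mu>\<^sup>2) = ?b - 2 * m * ?a + (m\<^sup>2 - \<mu>\<^sup>2) * ?p"
    using int by (simp add: const set_integral_add set_integral_diff)
  with le have "(?b - 2 * m * ?a + (m\<^sup>2 - \<mu>\<^sup>2) * ?p) / ?p \<le> 0"
    using cd by (simp add: divide_nonpos_pos)
  then have "avg c d (\<lambda>s. (\<eta> s)\<^sup>2) - 2 * m * avg c d \<eta> + m\<^sup>2 - \<mu>\<^sup>2 \<le> 0"
    using cd by (simp add: avg_def add_divide_distrib diff_divide_distrib)
  moreover have "0 \<le> (avg c d \<eta> - m)\<^sup>2" by simp
  ultimately show ?thesis by (simp add: power2_diff algebra_simps)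
qed

text \<open>Carries the variance estimate from intervals strictly inside the unit interval to those
  that touch its ends.\<close>

lemma set_integral_shrink:
  assumes cd: "c < d" and int: "set_integrable lborel {c..d} (\<eta> :: real \<Rightarrow> real)"
  shows "(\<lambda>n. LINT s:{c + (d - c) / (real n + 3)..d - (d - c) / (real n + 3)}|lborel. \<eta> s) \<longlonglongrightarrow> (LINT s:{c..d}|lborel. \<eta> s)"
proof -
  \<comment> \<open>Two margins are cut off; with \<open>real n + 3\<close> they take at most two
    thirds of the length, so the interval is nondegenerate already at \<open>n = 0\<close>.\<close>
  let ?r = "\<lambda>n. (d - c) / (real n + 3)"
  have r: "?r \<longlonglongrightarrow> 0" by real_asymp
  have r0: "0 \<le> ?r n" for n using cd by simp
  have m: "(\<lambda>s. indicator {c..d} s *\<^sub>R \<eta> s) \<in> borel_measurable lborel"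
    using int by (auto simp: set_integrable_def)
  show ?thesis
    unfolding set_lebesgue_integral_def
  proof (rule integral_dominated_convergence[where w="\<lambda>s. norm (indicator {c..d} s *\<^sub>R \<eta> s)"])
    show "(\<lambda>s. indicator {c + ?r n..d - ?r n} s *\<^sub>R \<eta> s) \<in> borel_measurable lborel" for n
    proof -
      \<comment> \<open>Measurability is known only for \<eta> restricted to \<open>{c..d}\<close>,
        so the smaller indicator is multiplied onto that restriction.\<close>
      have "(\<lambda>s. indicator {c + ?r n..d - ?r n} s * (indicator {c..d} s *\<^sub>R \<eta> s)) \<in> borel_measurable lborel"
        using m by measurable
      also have "(\<lambda>s. indicator {c + ?r n..d - ?r n} s * (indicator {c..d} s *\<^sub>R \<eta> s)) = (\<lambda>s. indicator {c + ?r n..d - ?r n} s *\<^sub>R \<eta> s)"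
        using r0[of n] by (auto simp: indicator_def fun_eq_iff)
      finally show ?thesis .
    qed
    show "AE s in lborel. (\<lambda>n. indicator {c + ?r n..d - ?r n} s *\<^sub>R \<eta> s) \<longlonglongrightarrow> indicator {c..d} s *\<^sub>R \<eta> s"
      using AE_lborel_singleton[of c] AE_lborel_singleton[of d]
    proof eventually_elim
      case (elim s)
      show ?case
      proof (cases "c < s \<and> s < d")
        case True
        then have "\<forall>\<^sub>F n in sequentially. ?r n < s - c" "\<forall>\<^sub>F n in sequentially. ?r n < d - s"
          by (auto intro!: order_tendstoD(2)[OF r])
        then have "\<forall>\<^sub>F n in sequentially. indicator {c + ?r n..d - ?r n} s *\<^sub>R \<eta> s = indicator {c..d} s *\<^sub>R \<eta> s"
          by eventually_elim (use True in \<open>auto simp: indicator_def\<close>)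
        then show ?thesis by (rule tendsto_eventually)
      next
        case False
        with elim have "s \<notin> {c..d}" by auto
        moreover from this have "s \<notin> {c + ?r n..d - ?r n}" for n using r0[of n] by auto
        ultimately show ?thesis by simp
      qed
    qed
    show "AE s in lborel. norm (indicator {c + ?r n..d - ?r n} s *\<^sub>R \<eta> s) \<le> norm (indicator {c..d} s *\<^sub>R \<eta> s)" for n
      using r0[of n] by (auto simp: indicator_def)
  qed (use m int in \<open>auto simp: set_integrable_def\<close>)
qed

section \<open>Variance of the increasing rearrangement\<close>

context averaging_kernel
begin

text \<open>Clipping is a contraction, so deviations from the clipped mean \<open>c\<close> are no
  larger than the original deviations from \<open>m\<close>; and the variance of \<open>Y\<close> is
  at most its mean square deviation from \<open>c\<close>.\<close>

lemma variance_clip: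
  assumes X: "integrable N X" "integrable N (\<lambda>v. (X v :: real)\<^sup>2)" and ab: "a \<le> b"
  shows "(\<integral>v. (clip a b (X v))\<^sup>2 \<partial>N) - (\<integral>v. clip a b (X v) \<partial>N)\<^sup>2 \<le> (\<integral>v. (X v)\<^sup>2 \<partial>N) - (\<integral>v. X v \<partial>N)\<^sup>2"
proof -
  define m where "m = (\<integral>v. X v \<partial>N)"
  define c where "c = clip a b m"
  define Y where "Y v = clip a b (X v)" for v
  have [measurable]: "X \<in> borel_measurable N" using X(1) by auto
  have [measurable]: "Y \<in> borel_measurable N" unfolding Y_def by measurable
  have YB: "\<bar>Y v\<bar> \<le> max \<bar>a\<bar> \<bar>b\<bar>" for v using ab by (auto simp: Y_def clip_def)
  have Y: "integrable N Y" "integrable N (\<lambda>v. (Y v)\<^sup>2)"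
    using YB by (auto intro!: integrable_N_bounded[where B="max \<bar>a\<bar> \<bar>b\<bar>"] integrable_N_square[where B="max \<bar>a\<bar> \<bar>b\<bar>"])
  have "(\<integral>v. (Y v)\<^sup>2 \<partial>N) - (\<integral>v. Y v \<partial>N)\<^sup>2 \<le> (\<integral>v. (Y v)\<^sup>2 \<partial>N) - 2 * c * (\<integral>v. Y v \<partial>N) + c\<^sup>2"
    using zero_le_power2[of "(\<integral>v. Y v \<partial>N) - c"] by (simp add: power2_diff algebra_simps)
  also have "\<dots> = (\<integral>v. (Y v - c)\<^sup>2 \<partial>N)"
    using Y by (simp add: power2_diff algebra_simps)
  also have "\<dots> \<le> (\<integral>v. (X v - m)\<^sup>2 \<partial>N)"
  proof (rule integral_mono)
    show "integrable N (\<lambda>v. (Y v - c)\<^sup>2)" "integrable N (\<lambda>v. (X v - m)\<^sup>2)"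
      using X Y by (auto simp: power2_diff)
    show "(Y v - c)\<^sup>2 \<le> (X v - m)\<^sup>2" for v
      using clip_dist[of a b "X v" m] by (simp add: Y_def c_def abs_le_square_iff)
  qed
  also have "\<dots> = (\<integral>v. (X v)\<^sup>2 \<partial>N) - (\<integral>v. X v \<partial>N)\<^sup>2"
    using variance_eq[OF X] by (simp add: m_def)
  finally show ?thesis by (simp add: Y_def)
qed

text \<open>The choice of \<open>m\<close> makes \<open>(s - m)\<^sup>2 - \<mu>\<^sup>2\<close> nonnegative at both clipping levels, so that the
  mass which clipping moves there can be discarded in the estimate of the conditional variance.\<close>

lemma clip_center:
  assumes \<phi>[measurable]: "\<phi> \<in> borel_measurable borel" and ab: "a \<le> b"
    and int: "\<And>y t. 0 < t \<Longrightarrow> integrable N (\<lambda>v. \<phi> (y - \<sigma> t *\<^sub>R v))"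
      "\<And>y t. 0 < t \<Longrightarrow> integrable N (\<lambda>v. (\<phi> (y - \<sigma> t *\<^sub>R v))\<^sup>2)"
    and var: "\<And>y t. 0 < t \<Longrightarrow> ext (\<lambda>w. (\<phi> w)\<^sup>2) y t - (ext \<phi> y t)\<^sup>2 \<le> \<nu>\<^sup>2"
    and \<mu>: "0 < \<nu>" "\<nu> < \<mu>" and t: "0 < t" and far: "2 * \<mu> < b - a"
  obtains m where "a + \<mu> \<le> m" "m \<le> b - \<mu>" "(\<integral>v. (clip a b (\<phi> (y - \<sigma> t *\<^sub>R v)) - m)\<^sup>2 - \<mu>\<^sup>2 \<partial>N) \<le> 0"
proof -
  define \<psi> where "\<psi> w = clip a b (\<phi> w)" for w
  have [measurable]: "\<psi> \<in> borel_measurable borel" unfolding \<psi>_def by measurable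
  define C where "C = max \<bar>a\<bar> \<bar>b\<bar>"
  have \<psi>B: "\<bar>\<psi> w\<bar> \<le> C" for w using ab by (auto simp: \<psi>_def clip_def C_def)
  have \<psi>a: "a \<le> \<psi> w" "\<psi> w \<le> b" for w using ab by (auto simp: \<psi>_def clip_def)
  have i: "integrable N (\<lambda>v. \<psi> (y - \<sigma> t *\<^sub>R v))" "integrable N (\<lambda>v. (\<psi> (y - \<sigma> t *\<^sub>R v))\<^sup>2)" for y t
    using integrable_N_bounded[of "\<lambda>v. \<psi> (y - \<sigma> t *\<^sub>R v)" C] integrable_N_square[of "\<lambda>v. \<psi> (y - \<sigma> t *\<^sub>R v)" C]
    by (simp_all add: \<psi>B)
  have var\<psi>: "ext (\<lambda>w. (\<psi> w)\<^sup>2) y t - (ext \<psi> y t)\<^sup>2 \<le> \<nu>\<^sup>2" if "0 < t" for y t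
    using variance_clip[OF int[OF that, of y] ab] var[OF that, of y] by (simp add: ext_def \<psi>_def)
  have affine: "ext (\<lambda>w. c + e * \<psi> w) y t = c + e * ext \<psi> y t"
    "ext (\<lambda>w. (c + e * \<psi> w)\<^sup>2) y t = c\<^sup>2 + 2 * c * e * ext \<psi> y t + e\<^sup>2 * ext (\<lambda>w. (\<psi> w)\<^sup>2) y t" for c e y t
    using i by (simp_all add: ext_def power2_sum power_mult_distrib algebra_simps)
  \<comment> \<open>\<open>e\<close> will be 1 for the distance from \<open>a\<close> and -1 for the
    distance from \<open>b\<close>.\<close>
  have affine_var: "ext (\<lambda>w. (c + e * \<psi> w)\<^sup>2) y t - (ext (\<lambda>w. c + e * \<psi> w) y t)\<^sup>2 \<le> \<nu>\<^sup>2"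
    if "0 < t" "e\<^sup>2 = 1" for c e y t
    unfolding affine using var\<psi>[OF that(1), of y] that(2) by (simp add: power2_sum power_mult_distrib algebra_simps)
  define x1 where "x1 = ext \<psi> y t"
  define x2 where "x2 = ext (\<lambda>w. (\<psi> w)\<^sup>2) y t"
  have expand: "(\<integral>v. (clip a b (\<phi> (y - \<sigma> t *\<^sub>R v)) - m)\<^sup>2 - \<mu>\<^sup>2 \<partial>N) = x2 - 2 * m * x1 + m\<^sup>2 - \<mu>\<^sup>2" for m
    using i by (simp add: x1_def x2_def ext_def \<psi>_def[symmetric] power2_diff algebra_simps)
  consider "x1 < a + \<mu>" | "b - \<mu> < x1" | "a + \<mu> \<le> x1" "x1 \<le> b - \<mu>" by linarith
  then show ?thesis
  proof cases
    case 1
    \<comment> \<open>For the distance from \<open>a\<close>, the bound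
      \<open>second moment \<le> 2 * \<mu> * mean\<close> is the statement that the mean square
      deviation of the clipped function from \<open>a + \<mu>\<close> is at most
      \<open>\<mu>^2\<close>.\<close>
    have "ext (\<lambda>w. (- a + 1 * \<psi> w)\<^sup>2) y t \<le> 2 * \<mu> * ext (\<lambda>w. - a + 1 * \<psi> w) y t"
    proof (rule second_moment_bound[where B="2*C" and \<nu>=\<nu>, OF _ _ _ _ \<mu> t])
      show "\<bar>- a + 1 * \<psi> w\<bar> \<le> 2 * C" for w using \<psi>B[of w] by (auto simp: C_def)
      show "ext (\<lambda>w. - a + 1 * \<psi> w) y t < \<mu>" unfolding affine using 1 by (simp add: x1_def)
      show "ext (\<lambda>w. (- a + 1 * \<psi> w)\<^sup>2) y t - (ext (\<lambda>w. - a + 1 * \<psi> w) y t)\<^sup>2 \<le> \<nu>\<^sup>2" if "0 < t" for y t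
        by (rule affine_var[OF that]) simp
    qed (use \<psi>a in auto)
    then have "x2 - 2 * (a + \<mu>) * x1 + (a + \<mu>)\<^sup>2 - \<mu>\<^sup>2 \<le> 0"
      unfolding affine by (simp add: x1_def x2_def power2_eq_square algebra_simps)
    then show ?thesis using far \<mu> by (intro that[of "a + \<mu>"]) (auto simp: expand)
  next
    case 2
    have "ext (\<lambda>w. (b + (- 1) * \<psi> w)\<^sup>2) y t \<le> 2 * \<mu> * ext (\<lambda>w. b + (- 1) * \<psi> w) y t"
    proof (rule second_moment_bound[where B="2*C" and \<nu>=\<nu>, OF _ _ _ _ \<mu> t])
      show "\<bar>b + (- 1) * \<psi> w\<bar> \<le> 2 * C" for w using \<psi>B[of w] by (auto simp: C_def)
      show "ext (\<lambda>w. b + (- 1) * \<psi> w) y t < \<mu>" unfolding affine using 2 by (simp add: x1_def)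
      show "ext (\<lambda>w. (b + (- 1) * \<psi> w)\<^sup>2) y t - (ext (\<lambda>w. b + (- 1) * \<psi> w) y t)\<^sup>2 \<le> \<nu>\<^sup>2" if "0 < t" for y t
        by (rule affine_var[OF that]) simp
    qed (use \<psi>a in auto)
    then have "x2 - 2 * (b - \<mu>) * x1 + (b - \<mu>)\<^sup>2 - \<mu>\<^sup>2 \<le> 0"
      unfolding affine by (simp add: x1_def x2_def power2_eq_square algebra_simps)
    then show ?thesis using far \<mu> by (intro that[of "b - \<mu>"]) (auto simp: expand)
  next
    \<comment> \<open>With the mean as centre, the integral is the variance minus
      \<open>\<mu>^2\<close>.\<close>
    case 3
    have "\<nu>\<^sup>2 \<le> \<mu>\<^sup>2" using \<mu> by (intro power_mono) auto
    with var\<psi>[OF t, of y] have "x2 - x1\<^sup>2 \<le> \<mu>\<^sup>2" by (simp add: x1_def x2_def)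
    then have "x2 - 2 * x1 * x1 + x1\<^sup>2 - \<mu>\<^sup>2 \<le> 0" by (simp add: power2_eq_square)
    with 3 show ?thesis by (intro that[of x1]) (auto simp: expand)
  qed
qed

text \<open>Strictly inside the unit interval the values of \<eta> at the ends are usable clipping
  levels. The function \<open>G\<close> agrees with the wanted integrand on \<open>{c..d}\<close>,
  and integrating it over the whole unit interval gives, by equidistribution, an integral over
  \<open>N\<close>.\<close>

lemma quantile_variance_interior:
  assumes \<phi>[measurable]: "\<phi> \<in> borel_measurable borel"
    and int: "\<And>y t. 0 < t \<Longrightarrow> integrable N (\<lambda>v. \<phi> (y - \<sigma> t *\<^sub>R v))"
      "\<And>y t. 0 < t \<Longrightarrow> integrable N (\<lambda>v. (\<phi> (y - \<sigma> t *\<^sub>R v))\<^sup>2)"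
    and var: "\<And>y t. 0 < t \<Longrightarrow> ext (\<lambda>w. (\<phi> w)\<^sup>2) y t - (ext \<phi> y t)\<^sup>2 \<le> \<nu>\<^sup>2"
    and \<mu>: "0 < \<nu>" "\<nu> < \<mu>" and t: "0 < t"
    and \<eta>[measurable]: "\<eta> \<in> borel_measurable borel" and mono: "mono_on {0<..<1} \<eta>"
    and distr: "distr (restrict_space lborel {0<..<1}) borel \<eta> = distr N borel (\<lambda>v. \<phi> (y - \<sigma> t *\<^sub>R v))"
    and cd: "0 < c" "c < d" "d < 1"
    and \<eta>int: "set_integrable lborel {c..d} \<eta>" "set_integrable lborel {c..d} (\<lambda>s. (\<eta> s)\<^sup>2)"
  shows "avg c d (\<lambda>s. (\<eta> s)\<^sup>2) - (avg c d \<eta>)\<^sup>2 \<le> \<mu>\<^sup>2"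
proof -
  define a b where "a = \<eta> c" and "b = \<eta> d"
  have [measurable]: "\<eta> \<in> borel_measurable (restrict_space lborel {0<..<1})"
    by (rule measurable_restrict_space1) simp
  have ab: "a \<le> b" unfolding a_def b_def using cd by (intro mono_onD[OF mono]) auto
  have range: "a \<le> \<eta> s" "\<eta> s \<le> b" if "s \<in> {c..d}" for s
    unfolding a_def b_def using cd that by (auto intro!: mono_onD[OF mono])
  have iG: "set_integrable lborel {c..d} (\<lambda>s. (\<eta> s - m)\<^sup>2 - \<mu>\<^sup>2)" for m
  proof -
    have "set_integrable lborel {c..d} (\<lambda>s. (\<eta> s)\<^sup>2 - 2 * m * \<eta> s + (m\<^sup>2 - \<mu>\<^sup>2))"
    proof (intro set_integral_add set_integral_diff set_integrable_mult_right \<eta>int)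
      show "set_integrable lborel {c..d} (\<lambda>_. m\<^sup>2)" "set_integrable lborel {c..d} (\<lambda>_. \<mu>\<^sup>2)"
        using cd by (simp_all add: set_integrable_def)
    qed
    then show ?thesis by (simp add: power2_diff algebra_simps)
  qed
  have "\<exists>m. (LINT s:{c..d}|lborel. (\<eta> s - m)\<^sup>2 - \<mu>\<^sup>2) \<le> 0"
  proof (cases "b - a \<le> 2 * \<mu>")
    case True
    let ?m = "(a + b) / 2"
    have "(\<eta> s - ?m)\<^sup>2 - \<mu>\<^sup>2 \<le> 0" if "s \<in> {c..d}" for s
    proof -
      have "\<bar>\<eta> s - ?m\<bar> \<le> \<mu>" using range[OF that] True by (simp add: abs_le_iff field_simps)
      then show ?thesis using \<mu> by (simp add: abs_le_square_iff[symmetric])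
    qed
    then have "(LINT s:{c..d}|lborel. (\<eta> s - ?m)\<^sup>2 - \<mu>\<^sup>2) \<le> (LINT s:{c..d}|lborel. 0)"
      by (intro set_integral_mono iG) (auto simp: set_integrable_def)
    then show ?thesis by auto
  next
    case False
    then obtain m where m: "a + \<mu> \<le> m" "m \<le> b - \<mu>"
      and le: "(\<integral>v. (clip a b (\<phi> (y - \<sigma> t *\<^sub>R v)) - m)\<^sup>2 - \<mu>\<^sup>2 \<partial>N) \<le> 0"
      using clip_center[OF \<phi> ab int var \<mu> t, of y] by auto
    define G where "G x = (clip a b x - m)\<^sup>2 - \<mu>\<^sup>2" for x
    have [measurable]: "G \<in> borel_measurable borel" unfolding G_def by measurable
    have Gab: "0 \<le> (a - m)\<^sup>2 - \<mu>\<^sup>2" "0 \<le> (b - m)\<^sup>2 - \<mu>\<^sup>2"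
      using m \<mu> by (auto simp: abs_le_square_iff[symmetric])
    have clipB: "\<bar>clip a b x\<bar> \<le> max \<bar>a\<bar> \<bar>b\<bar>" for x using ab by (auto simp: clip_def)
    have "integrable N (\<lambda>v. G (\<phi> (y - \<sigma> t *\<^sub>R v)))"
      unfolding G_def power2_diff
      using integrable_N_bounded[of "\<lambda>v. clip a b (\<phi> (y - \<sigma> t *\<^sub>R v))", OF _ clipB]
        integrable_N_square[of "\<lambda>v. clip a b (\<phi> (y - \<sigma> t *\<^sub>R v))", OF _ clipB] by simp
    then have "integrable (distr (restrict_space lborel {0<..<1}) borel \<eta>) G"
      unfolding distr by (subst integrable_distr_eq) auto
    then have iG2: "integrable lborel (\<lambda>s. indicator {0<..<1} s *\<^sub>R G (\<eta> s))"
      by (subst (asm) integrable_distr_eq) (auto simp: integrable_restrict_space)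
    have "(LINT s:{c..d}|lborel. (\<eta> s - m)\<^sup>2 - \<mu>\<^sup>2) \<le> (\<integral>s. indicator {0<..<1} s *\<^sub>R G (\<eta> s) \<partial>lborel)"
      unfolding set_lebesgue_integral_def
    proof (rule integral_mono[OF _ iG2])
      show "integrable lborel (\<lambda>s. indicator {c..d} s *\<^sub>R ((\<eta> s - m)\<^sup>2 - \<mu>\<^sup>2))"
        using iG[of m] by (simp add: set_integrable_def)
      fix s :: real
      consider "s \<in> {c..d}" | "0 < s" "s < c" | "d < s" "s < 1" | "s \<notin> {0<..<1}" by force
      then show "indicator {c..d} s *\<^sub>R ((\<eta> s - m)\<^sup>2 - \<mu>\<^sup>2) \<le> indicator {0<..<1} s *\<^sub>R G (\<eta> s)"
      proof cases
        case 1
        then have "clip a b (\<eta> s) = \<eta> s" using range[of s] by (simp add: clip_def)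
        then show ?thesis using 1 cd by (simp add: G_def)
      next
        case 2
        then have "\<eta> s \<le> a" unfolding a_def using cd by (intro mono_onD[OF mono]) auto
        then have "clip a b (\<eta> s) = a" using ab by (simp add: clip_def)
        then show ?thesis using 2 cd Gab by (simp add: G_def)
      next
        case 3
        then have "b \<le> \<eta> s" unfolding b_def using cd by (intro mono_onD[OF mono]) auto
        then have "clip a b (\<eta> s) = b" using ab by (simp add: clip_def)
        then show ?thesis using 3 cd Gab by (simp add: G_def)
      next
        case 4
        then show ?thesis using cd by (auto simp: indicator_def)
      qed
    qed
    also have "\<dots> = (\<integral>x. G x \<partial>distr (restrict_space lborel {0<..<1}) borel \<eta>)"
      by (subst integral_distr) (auto simp: integral_restrict_space)
    also have "\<dots> = (\<integral>v. G (\<phi> (y - \<sigma> t *\<^sub>R v)) \<partial>N)"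
      unfolding distr by (subst integral_distr) auto
    also have "\<dots> \<le> 0" using le by (simp add: G_def)
    finally show ?thesis by blast
  qed
  then show ?thesis using avg_variance_le[OF cd(2) \<eta>int] by blast
qed

section \<open>The competitor on the unit interval\<close>

theorem BK_le_Bstar:
  assumes f[measurable]: "f \<in> borel_measurable borel" and \<mu>: "0 < \<nu>" "\<nu> < \<mu>"
  shows "BK K \<nu> f x \<le> Bstar \<mu> f x"
  unfolding BK_def
proof (safe intro!: Sup_least)
  fix \<phi> y t
  assume t: "(0::real) < t" and adm: "K_admissible K \<phi>" and norm: "K_norm K \<phi> \<le> ereal \<nu>"
    and x1: "Kext K \<phi> y t = fst x" and x2: "Kext K (\<lambda>w. (\<phi> w)\<^sup>2) y t = snd x"
  have \<phi>[measurable]: "\<phi> \<in> borel_measurable borel" using adm by (simp add: K_admissible_def)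
  have int: "integrable N (\<lambda>v. \<phi> (y - \<sigma> t *\<^sub>R v))" "integrable N (\<lambda>v. (\<phi> (y - \<sigma> t *\<^sub>R v))\<^sup>2)" if "0 < t" for y t
    using adm that integrable_kernel_iff[OF \<phi> that, of y] integrable_kernel_iff[of "\<lambda>w. (\<phi> w)\<^sup>2" t y]
    by (auto simp: K_admissible_def)
  have var: "ext (\<lambda>w. (\<phi> w)\<^sup>2) y t - (ext \<phi> y t)\<^sup>2 \<le> \<nu>\<^sup>2" if t: "0 < t" for y t
  proof -
    have "ereal (sqrt (ext (\<lambda>w. (\<phi> w)\<^sup>2) y t - (ext \<phi> y t)\<^sup>2)) \<le> K_norm K \<phi>"
      unfolding K_norm_def using t by (intro SUP_upper2[of "(y, t)"]) (auto simp: Kext_eq_ext)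
    with norm have "sqrt (ext (\<lambda>w. (\<phi> w)\<^sup>2) y t - (ext \<phi> y t)\<^sup>2) \<le> \<nu>" by (metis ereal_less_eq(3) order_trans)
    then show ?thesis by (rule sqrt_le_D)
  qed
  define X where "X v = \<phi> (y - \<sigma> t *\<^sub>R v)" for v
  have [measurable]: "X \<in> borel_measurable N" unfolding X_def by measurable
  obtain \<eta> :: "real \<Rightarrow> real" where \<eta>[measurable]: "\<eta> \<in> borel_measurable borel" and mono: "mono_on {0<..<1} \<eta>"
    and distr: "distr (restrict_space lborel {0<..<1}) borel \<eta> = distr N borel X"
    by (rule N.quantile_function[of X]) auto
  let ?U = "restrict_space lborel {0<..<1::real}"
  have [measurable]: "\<eta> \<in> borel_measurable ?U" by (rule measurable_restrict_space1) simp
  \<comment> \<open>The quantile function lives on the open interval while \<open>Bstar\<close>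
    averages over closed ones; the two endpoints are null.\<close>
  have ind: "AE s in lborel. indicator {0..1::real} s = (indicator {0<..<1} s :: real)"
    using AE_lborel_singleton[of 0] AE_lborel_singleton[of 1] by eventually_elim (auto simp: indicator_def)
  have transfer: "set_integrable lborel {0..1} (\<lambda>s. g (\<eta> s)) \<longleftrightarrow> integrable N (\<lambda>v. g (X v))"
    "(LINT s:{0..1}|lborel. g (\<eta> s)) = (\<integral>v. g (X v) \<partial>N)"
    if [measurable]: "g \<in> borel_measurable borel" for g :: "real \<Rightarrow> real"
  proof -
    have ae: "AE s in lborel. indicator {0..1} s *\<^sub>R g (\<eta> s) = indicator {0<..<1} s *\<^sub>R g (\<eta> s)"
      using ind by eventually_elim simp
    have "set_integrable lborel {0..1} (\<lambda>s. g (\<eta> s)) \<longleftrightarrow> integrable lborel (\<lambda>s. indicator {0<..<1} s *\<^sub>R g (\<eta> s))"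
      unfolding set_integrable_def by (rule integrable_cong_AE[OF _ _ ae]) auto
    also have "\<dots> \<longleftrightarrow> integrable (distr ?U borel \<eta>) g"
      by (subst integrable_distr_eq) (auto simp: integrable_restrict_space)
    also have "\<dots> \<longleftrightarrow> integrable N (\<lambda>v. g (X v))"
      unfolding distr by (subst integrable_distr_eq) auto
    finally show "set_integrable lborel {0..1} (\<lambda>s. g (\<eta> s)) \<longleftrightarrow> integrable N (\<lambda>v. g (X v))" .
    have "(LINT s:{0..1}|lborel. g (\<eta> s)) = (\<integral>s. indicator {0<..<1} s *\<^sub>R g (\<eta> s) \<partial>lborel)"
      unfolding set_lebesgue_integral_def by (rule integral_cong_AE[OF _ _ ae]) auto
    also have "\<dots> = integral\<^sup>L (distr ?U borel \<eta>) g"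
      by (subst integral_distr) (auto simp: integral_restrict_space)
    also have "\<dots> = (\<integral>v. g (X v) \<partial>N)"
      unfolding distr by (subst integral_distr) auto
    finally show "(LINT s:{0..1}|lborel. g (\<eta> s)) = (\<integral>v. g (X v) \<partial>N)" .
  qed
  have \<eta>1: "set_integrable lborel {0..1} \<eta>" and \<eta>2: "set_integrable lborel {0..1} (\<lambda>s. (\<eta> s)\<^sup>2)"
    using transfer(1)[of "\<lambda>x. x"] transfer(1)[of "\<lambda>x. x\<^sup>2"] int[OF t, of y] by (auto simp: X_def)
  have avg1: "avg 0 1 \<eta> = fst x" and avg2: "avg 0 1 (\<lambda>s. (\<eta> s)\<^sup>2) = snd x"
    using transfer(2)[of "\<lambda>x. x"] transfer(2)[of "\<lambda>x. x\<^sup>2"] x1 x2 t by (auto simp: avg_def Kext_eq_ext ext_def X_def)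
  have sub: "set_integrable lborel {c..d} \<eta>" "set_integrable lborel {c..d} (\<lambda>s. (\<eta> s)\<^sup>2)" if "0 \<le> c" "d \<le> 1" for c d
    using \<eta>1 \<eta>2 that by (auto intro: set_integrable_subset)
  have "bmo_norm 0 1 \<eta> \<le> ereal \<mu>"
    unfolding bmo_norm_def
  proof (safe intro!: SUP_least)
    fix c d :: real assume cd: "0 \<le> c" "c < d" "d \<le> 1"
    \<comment> \<open>Cutting off both ends puts the interval strictly inside the unit interval even
      when \<open>c = 0\<close> or \<open>d = 1\<close>.\<close>
    define c' d' where "c' n = c + (d - c) / (real n + 3)" and "d' n = d - (d - c) / (real n + 3)" for n
    have r: "0 < (d - c) / (real n + 3)" "2 * ((d - c) / (real n + 3)) < d - c" for n
    proof -
      show "0 < (d - c) / (real n + 3)" using cd by simp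
      have "(d - c) * 2 < (d - c) * (real n + 3)" using cd by (intro mult_strict_left_mono) auto
      then show "2 * ((d - c) / (real n + 3)) < d - c" by (simp add: field_simps)
    qed
    have c': "0 < c' n" "c' n < d' n" "d' n < 1" for n
      using cd r[of n] unfolding c'_def d'_def by linarith+
    have "avg (c' n) (d' n) (\<lambda>s. (\<eta> s)\<^sup>2) - (avg (c' n) (d' n) \<eta>)\<^sup>2 \<le> \<mu>\<^sup>2" for n
      using c'[of n] by (intro quantile_variance_interior[OF \<phi> int var \<mu> t \<eta> mono distr[unfolded X_def]] sub) auto
    moreover have "(\<lambda>n. avg (c' n) (d' n) (\<lambda>s. (\<eta> s)\<^sup>2) - (avg (c' n) (d' n) \<eta>)\<^sup>2) \<longlonglongrightarrow>
        avg c d (\<lambda>s. (\<eta> s)\<^sup>2) - (avg c d \<eta>)\<^sup>2"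
    proof -
      have "c' \<longlonglongrightarrow> c" "d' \<longlonglongrightarrow> d" unfolding c'_def d'_def by real_asymp+
      then show ?thesis
        unfolding avg_def using cd
        by (intro tendsto_intros set_integral_shrink[OF cd(2), folded c'_def d'_def] sub) auto
    qed
    ultimately have "avg c d (\<lambda>s. (\<eta> s)\<^sup>2) - (avg c d \<eta>)\<^sup>2 \<le> \<mu>\<^sup>2"
      by (intro LIMSEQ_le_const2) auto
    then have "sqrt (avg c d (\<lambda>s. (\<eta> s)\<^sup>2) - (avg c d \<eta>)\<^sup>2) \<le> \<mu>"
      using \<mu> real_le_lsqrt by (simp add: real_sqrt_le_iff sqrt_le_D real_sqrt_unique[symmetric])
    then show "ereal (sqrt (avg (fst (c, d)) (snd (c, d)) (\<lambda>s. (\<eta> s)\<^sup>2) - (avg (fst (c, d)) (snd (c, d)) \<eta>)\<^sup>2)) \<le> ereal \<mu>"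
      by simp
  qed
  moreover have "(\<integral>\<^sup>+ s\<in>{0..1}. ennreal (f (\<eta> s)) \<partial>lborel) = Kext_nn K (\<lambda>w. f (\<phi> w)) y t"
  proof -
    have "(\<integral>\<^sup>+ s\<in>{0..1}. ennreal (f (\<eta> s)) \<partial>lborel) = (\<integral>\<^sup>+ s\<in>{0<..<1}. ennreal (f (\<eta> s)) \<partial>lborel)"
    proof (rule nn_integral_cong_AE)
      show "AE s in lborel. ennreal (f (\<eta> s)) * indicator {0..1} s = ennreal (f (\<eta> s)) * indicator {0<..<1} s"
        using AE_lborel_singleton[of 0] AE_lborel_singleton[of 1] by eventually_elim (auto simp: indicator_def)
    qed
    also have "\<dots> = (\<integral>\<^sup>+ x. ennreal (f x) \<partial>distr ?U borel \<eta>)"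
      by (subst nn_integral_distr) (auto simp: nn_integral_restrict_space)
    also have "\<dots> = (\<integral>\<^sup>+ v. ennreal (f (X v)) \<partial>N)"
      unfolding distr by (subst nn_integral_distr) auto
    finally show ?thesis
      using t by (simp add: Kext_nn_eq X_def)
  qed
  ultimately show "Kext_nn K (\<lambda>w. f (\<phi> w)) y t \<le> Bstar \<mu> f x"
    unfolding Bstar_def using \<eta>1 \<eta>2 avg1 avg2
    by - (rule Sup_upper, rule CollectI, rule exI[of _ 0], rule exI[of _ 1], rule exI[of _ \<eta>], auto simp: divide_ennreal_def)
qed

end

section \<open>Translations and coordinate directions\<close>

lemma lborel_reflect: "distr lborel borel (\<lambda>w. y - w :: 'a::euclidean_space) = lborel"
proof -
  have "lborel = density (distr lborel borel (\<lambda>w. y + (- 1) *\<^sub>R w)) (\<lambda>_. ennreal (\<bar>- 1\<bar> ^ DIM('a)))"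
    by (rule lborel_affine) simp
  also have "\<dots> = distr lborel borel (\<lambda>w. y - w)" by (simp add: density_1)
  finally show ?thesis by (rule sym)
qed

lemma integrable_reflect:
  fixes f :: "'a::euclidean_space \<Rightarrow> real"
  assumes "integrable lborel f"
  shows "integrable lborel (\<lambda>w. f (y - w))"
proof -
  have [measurable]: "f \<in> borel_measurable borel" using assms by auto
  show ?thesis
    using assms integrable_distr_eq[of "\<lambda>w. y - w" lborel borel f] by (simp add: lborel_reflect)
qed

lemma integrable_reflect_mult:
  fixes f g :: "'a::euclidean_space \<Rightarrow> real"
  assumes f: "integrable lborel f" and g: "g \<in> borel_measurable borel" "\<And>w. \<bar>g w\<bar> \<le> B"
  shows "integrable lborel (\<lambda>w. f (y - w) * g w)"
proof (rule Bochner_Integration.integrable_bound)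
  show "integrable lborel (\<lambda>w. B * f (y - w))"
    using integrable_reflect[OF f] by simp
  have [measurable]: "f \<in> borel_measurable borel" using f by auto
  show "(\<lambda>w. f (y - w) * g w) \<in> borel_measurable lborel" using g(1) by measurable
  have "B \<ge> 0" using g(2)[of undefined] by simp
  then show "AE w in lborel. norm (f (y - w) * g w) \<le> norm (B * f (y - w))"
    by (intro AE_I2) (auto simp: abs_mult mult.commute intro!: mult_right_mono g)
qed

lemma integrable_of_mass:
  fixes f :: "'a::euclidean_space \<Rightarrow> real"
  assumes "f \<in> borel_measurable borel" "\<And>w. 0 \<le> f w" "(\<integral>\<^sup>+ w. ennreal (f w) \<partial>lborel) = ennreal c"
  shows "integrable lborel f"
  using assms by (intro integrableI_nonneg) auto

lemma norm_add_Basis_square: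
  fixes v b :: "'a::euclidean_space"
  assumes "b \<in> Basis"
  shows "(norm (v + x *\<^sub>R b))\<^sup>2 = (norm v)\<^sup>2 + 2 * (v \<bullet> b) * x + x\<^sup>2"
  using assms unfolding power2_norm_eq_inner
  by (simp add: inner_add_left inner_add_right inner_commute[of b v] power2_eq_square distrib_left)

lemma inner_Basis_square_le:
  fixes v b :: "'a::euclidean_space"
  assumes "b \<in> Basis"
  shows "(v \<bullet> b + x)\<^sup>2 \<le> (norm (v + x *\<^sub>R b))\<^sup>2"
proof -
  have "\<bar>(v + x *\<^sub>R b) \<bullet> b\<bar> \<le> norm (v + x *\<^sub>R b)" using assms by (rule Basis_le_norm)
  moreover have "(v + x *\<^sub>R b) \<bullet> b = v \<bullet> b + x" using assms by (simp add: inner_add)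
  ultimately show ?thesis by (simp add: abs_le_square_iff[symmetric])
qed

text \<open>Trades the moving point for the fixed one: kernels at \<open>v + x *\<^sub>R b\<close>
  are to be bounded by a function of \<open>v\<close> alone, uniformly for small
  \<open>x\<close>.\<close>

lemma norm_square_le_shift:
  fixes v b :: "'a::euclidean_space"
  assumes "b \<in> Basis"
  shows "(norm v)\<^sup>2 \<le> 2 * (norm (v + x *\<^sub>R b))\<^sup>2 + 2 * x\<^sup>2"
proof -
  have "(norm v)\<^sup>2 \<le> (norm (v + x *\<^sub>R b) + \<bar>x\<bar>)\<^sup>2"
    using norm_triangle_ineq4[of "v + x *\<^sub>R b" "x *\<^sub>R b"] assms by (intro power_mono) auto
  also have "\<dots> \<le> 2 * (norm (v + x *\<^sub>R b))\<^sup>2 + 2 * \<bar>x\<bar>\<^sup>2"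
    using zero_le_power2[of "norm (v + x *\<^sub>R b) - \<bar>x\<bar>"] by (simp add: power2_sum power2_diff)
  finally show ?thesis by simp
qed

lemma sum_inner_Basis_square: "(\<Sum>b\<in>Basis. ((v::'a::euclidean_space) \<bullet> b)\<^sup>2) = (norm v)\<^sup>2"
  unfolding power2_norm_eq_inner euclidean_inner[of v v] by (simp add: power2_eq_square)

section \<open>The heat kernel\<close>

lemma heat_deriv_space:
  fixes v b :: "'a::euclidean_space"
  assumes b: "b \<in> Basis" and t: "0 < t"
  shows "((\<lambda>x. heat_kernel t (v + x *\<^sub>R b)) has_real_derivative heat_kernel t (v + x *\<^sub>R b) * (- (v \<bullet> b + x) / (2 * t))) (at x)"
    and "((\<lambda>x. heat_kernel t (v + x *\<^sub>R b) * (- (v \<bullet> b + x) / (2 * t))) has_real_derivative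
      heat_kernel t (v + x *\<^sub>R b) * ((v \<bullet> b + x)\<^sup>2 / (4 * t\<^sup>2) - 1 / (2 * t))) (at x)"
proof -
  show 1: "((\<lambda>x. heat_kernel t (v + x *\<^sub>R b)) has_real_derivative heat_kernel t (v + x *\<^sub>R b) * (- (v \<bullet> b + x) / (2 * t))) (at x)" for x
  proof -
    have e: "((\<lambda>x. - ((norm v)\<^sup>2 + 2 * (v \<bullet> b) * x + x\<^sup>2) / (4 * t)) has_real_derivative - (v \<bullet> b + x) / (2 * t)) (at x)"
      using t by (auto intro!: derivative_eq_intros simp: field_simps)
    show ?thesis
      unfolding heat_kernel_def norm_add_Basis_square[OF b]
      by (rule DERIV_cong[OF DERIV_cmult[OF DERIV_fun_exp[OF e]]]) (simp only: mult.assoc)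
  qed
  have l: "((\<lambda>x. - (v \<bullet> b + x) / (2 * t)) has_real_derivative - 1 / (2 * t)) (at x)"
    using t by (auto intro!: derivative_eq_intros)
  show "((\<lambda>x. heat_kernel t (v + x *\<^sub>R b) * (- (v \<bullet> b + x) / (2 * t))) has_real_derivative
      heat_kernel t (v + x *\<^sub>R b) * ((v \<bullet> b + x)\<^sup>2 / (4 * t\<^sup>2) - 1 / (2 * t))) (at x)"
  proof (rule DERIV_cong[OF DERIV_mult[OF 1 l]])
    have "H * (- q / (2 * t)) * (- q / (2 * t)) + - 1 / (2 * t) * H = H * (q\<^sup>2 / (4 * t\<^sup>2) - 1 / (2 * t))" for H q :: real
      by (simp add: power2_eq_square right_diff_distrib)
    then show "heat_kernel t (v + x *\<^sub>R b) * (- (v \<bullet> b + x) / (2 * t)) * (- (v \<bullet> b + x) / (2 * t)) + - 1 / (2 * t) * heat_kernel t (v + x *\<^sub>R b) =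
      heat_kernel t (v + x *\<^sub>R b) * ((v \<bullet> b + x)\<^sup>2 / (4 * t\<^sup>2) - 1 / (2 * t))" .
  qed
qed

lemma heat_deriv_time:
  fixes v :: "'a::euclidean_space"
  assumes \<tau>: "0 < t + x"
  shows "((\<lambda>x. heat_kernel (t + x) v) has_real_derivative
      heat_kernel (t + x) v * ((norm v)\<^sup>2 / (4 * (t + x)\<^sup>2) - real DIM('a) / (2 * (t + x)))) (at x)"
proof -
  have p: "((\<lambda>x. (4 * pi * (t + x)) powr (- real DIM('a) / 2)) has_real_derivative
      (- real DIM('a) / 2) * (4 * pi * (t + x)) powr (- real DIM('a) / 2 - 1) * (4 * pi)) (at x)"
    using \<tau> by (rule_tac DERIV_cong[OF DERIV_fun_powr[where m="4 * pi"]]) (auto intro!: derivative_eq_intros)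
  have q: "(4 * pi * (t + x)) powr (- real DIM('a) / 2 - 1) = (4 * pi * (t + x)) powr (- real DIM('a) / 2) / (4 * pi * (t + x))"
    using \<tau> by (simp add: powr_diff)
  have e: "((\<lambda>x. exp (- (norm v)\<^sup>2 / (4 * (t + x)))) has_real_derivative
      exp (- (norm v)\<^sup>2 / (4 * (t + x))) * ((norm v)\<^sup>2 / (4 * (t + x)\<^sup>2))) (at x)"
    using \<tau> by (auto intro!: derivative_eq_intros simp: power2_eq_square divide_simps) (simp add: algebra_simps)
  show ?thesis
    unfolding heat_kernel_def
  proof (rule DERIV_cong[OF DERIV_mult[OF p e]])
    have "n / 2 * (P / (4 * pi * T)) * (4 * pi) * E + E * D * P = P * E * (D - - n / (2 * T))" if "T \<noteq> 0" for n P E D T :: real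
      using that by (simp add: field_simps)
    from this[of "t + x" "- real DIM('a)"] \<tau>
    show "- real DIM('a) / 2 * (4 * pi * (t + x)) powr (- real DIM('a) / 2 - 1) * (4 * pi) * exp (- (norm v)\<^sup>2 / (4 * (t + x))) +
      exp (- (norm v)\<^sup>2 / (4 * (t + x))) * ((norm v)\<^sup>2 / (4 * (t + x)\<^sup>2)) * (4 * pi * (t + x)) powr (- real DIM('a) / 2) =
      (4 * pi * (t + x)) powr (- real DIM('a) / 2) * exp (- (norm v)\<^sup>2 / (4 * (t + x))) *
      ((norm v)\<^sup>2 / (4 * (t + x)\<^sup>2) - real DIM('a) / (2 * (t + x)))"
      unfolding q by (metis minus_minus less_irrefl)
  qed
qed

text \<open>Half of the exponent absorbs the polynomial, through \<open>x \<le> exp x\<close> and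
  \<open>1 \<le> exp x\<close> at \<open>x = S / (8 * t)\<close>; the constant is
  \<open>2 / t + 1 / (2 * t)\<close>.\<close>

lemma gaussian_absorb:
  assumes S: "0 \<le> S" and t: "0 < (t::real)"
  shows "exp (- S / (4 * t)) * (S / (4 * t\<^sup>2) + 1 / (2 * t)) \<le> 5 / (2 * t) * exp (- S / (8 * t))"
proof -
  define E where "E = exp (S / (8 * t))"
  have E: "S / (8 * t) \<le> E" "1 \<le> E"
    using exp_ge_add_one_self[of "S / (8 * t)"] divide_nonneg_pos[OF S, of "8 * t"] t unfolding E_def by linarith+
  have "S / (4 * t\<^sup>2) + 1 / (2 * t) = (2 / t) * (S / (8 * t)) + (1 / (2 * t)) * 1"
    using t by (simp add: power2_eq_square)
  also have "\<dots> \<le> (2 / t) * E + (1 / (2 * t)) * E"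
    using E t by (intro add_mono mult_left_mono) auto
  also have "\<dots> = 5 / (2 * t) * E" using t by (simp add: field_simps)
  finally have "exp (- S / (4 * t)) * (S / (4 * t\<^sup>2) + 1 / (2 * t)) \<le> exp (- S / (4 * t)) * (5 / (2 * t) * E)"
    by (intro mult_left_mono) auto
  also have "\<dots> = 5 / (2 * t) * exp (- S / (8 * t))"
    using t by (simp add: E_def exp_add[symmetric] field_simps)
  finally show ?thesis .
qed

text \<open>By \<open>norm_square_le_shift\<close> with \<open>x^2 \<le> t\<close>, recentring the
  Gaussian at \<open>v\<close> costs half of the exponent and a factor \<open>exp (1 / 8)\<close>;
  the majorant no longer depends on \<open>x\<close>.\<close>

lemma heat_bound_space:
  fixes v b :: "'a::euclidean_space"
  assumes b: "b \<in> Basis" and t: "0 < t" and x: "x\<^sup>2 \<le> t"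
  shows "\<bar>heat_kernel t (v + x *\<^sub>R b) * ((v \<bullet> b + x)\<^sup>2 / (4 * t\<^sup>2) - 1 / (2 * t))\<bar>
    \<le> (4 * pi * t) powr (- real DIM('a) / 2) * (5 / (2 * t)) * exp (1 / 8) * exp (- (1 / (16 * t)) * (norm v)\<^sup>2)"
proof -
  define S where "S = (norm (v + x *\<^sub>R b))\<^sup>2"
  have "\<bar>(v \<bullet> b + x)\<^sup>2 / (4 * t\<^sup>2) - 1 / (2 * t)\<bar> \<le> \<bar>(v \<bullet> b + x)\<^sup>2 / (4 * t\<^sup>2)\<bar> + \<bar>1 / (2 * t)\<bar>"
    by (rule abs_triangle_ineq4)
  also have "\<dots> \<le> S / (4 * t\<^sup>2) + 1 / (2 * t)"
    using t inner_Basis_square_le[OF b, of v x] by (simp add: S_def divide_right_mono)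
  finally have 1: "\<bar>(v \<bullet> b + x)\<^sup>2 / (4 * t\<^sup>2) - 1 / (2 * t)\<bar> \<le> S / (4 * t\<^sup>2) + 1 / (2 * t)" .
  have "(norm v)\<^sup>2 \<le> 2 * S + 2 * t"
    using norm_square_le_shift[OF b, of v x] x by (simp add: S_def)
  then have "- S / (8 * t) \<le> 1 / 8 + - (1 / (16 * t)) * (norm v)\<^sup>2"
    using t by (simp add: field_simps)
  then have 2: "exp (- S / (8 * t)) \<le> exp (1 / 8) * exp (- (1 / (16 * t)) * (norm v)\<^sup>2)"
    by (simp only: exp_add[symmetric] exp_le_cancel_iff)
  have "\<bar>heat_kernel t (v + x *\<^sub>R b) * ((v \<bullet> b + x)\<^sup>2 / (4 * t\<^sup>2) - 1 / (2 * t))\<bar> =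
     (4 * pi * t) powr (- real DIM('a) / 2) * (exp (- S / (4 * t)) * \<bar>(v \<bullet> b + x)\<^sup>2 / (4 * t\<^sup>2) - 1 / (2 * t)\<bar>)"
    by (simp add: heat_kernel_def abs_mult S_def)
  also have "\<dots> \<le> (4 * pi * t) powr (- real DIM('a) / 2) * (exp (- S / (4 * t)) * (S / (4 * t\<^sup>2) + 1 / (2 * t)))"
    by (intro mult_left_mono 1) auto
  also have "\<dots> \<le> (4 * pi * t) powr (- real DIM('a) / 2) * (5 / (2 * t) * exp (- S / (8 * t)))"
    using t by (intro mult_left_mono gaussian_absorb) (auto simp: S_def)
  also have "\<dots> \<le> (4 * pi * t) powr (- real DIM('a) / 2) * (5 / (2 * t) * (exp (1 / 8) * exp (- (1 / (16 * t)) * (norm v)\<^sup>2)))"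
    using t by (intro mult_left_mono 2) auto
  finally show ?thesis by (simp only: mult.assoc)
qed

text \<open>Over times in \<open>[t / 2, t]\<close> the prefactor is largest at the left end and the
  exponential at the right end. The factor \<open>4 * DIM('a)\<close> brings the polynomial into the
  shape of \<open>gaussian_absorb\<close>, and the exponent is relaxed to the one of
  \<open>heat_bound_space\<close>, so that one integrability fact serves space and time.\<close>

lemma heat_bound_time:
  fixes v :: "'a::euclidean_space"
  assumes t: "0 < t" and \<tau>: "t / 2 \<le> \<tau>" "\<tau> \<le> t"
  shows "\<bar>heat_kernel \<tau> v * ((norm v)\<^sup>2 / (4 * \<tau>\<^sup>2) - real DIM('a) / (2 * \<tau>))\<bar>
    \<le> (4 * pi * (t / 2)) powr (- real DIM('a) / 2) * (4 * real DIM('a) * (5 / (2 * t))) * exp (- (1 / (16 * t)) * (norm v)\<^sup>2)"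
proof -
  define S where "S = (norm v)\<^sup>2"
  have S: "0 \<le> S" by (simp add: S_def)
  have n: "1 \<le> real DIM('a)" by (simp add: Suc_leI)
  have \<tau>0: "0 < \<tau>" using t \<tau> by simp
  have "t\<^sup>2 \<le> (2 * \<tau>)\<^sup>2" using t \<tau> by (intro power_mono) auto
  then have "S / (4 * \<tau>\<^sup>2) \<le> S / t\<^sup>2" using t S \<tau>0 by (intro divide_left_mono) (auto simp: power_mult_distrib)
  moreover have "real DIM('a) / (2 * \<tau>) \<le> real DIM('a) / t" using t \<tau> by (intro divide_left_mono) auto
  moreover have "\<bar>S / (4 * \<tau>\<^sup>2) - real DIM('a) / (2 * \<tau>)\<bar> \<le> \<bar>S / (4 * \<tau>\<^sup>2)\<bar> + \<bar>real DIM('a) / (2 * \<tau>)\<bar>"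
    by (rule abs_triangle_ineq4)
  ultimately have "\<bar>S / (4 * \<tau>\<^sup>2) - real DIM('a) / (2 * \<tau>)\<bar> \<le> S / t\<^sup>2 + real DIM('a) / t"
    using S \<tau>0 by simp
  also have "\<dots> \<le> 4 * real DIM('a) * (S / (4 * t\<^sup>2) + 1 / (2 * t))"
  proof -
    have "1 * (S / t\<^sup>2) \<le> real DIM('a) * (S / t\<^sup>2)" using n S by (intro mult_right_mono) auto
    moreover have "0 \<le> real DIM('a) / t" using t by simp
    moreover have "4 * real DIM('a) * (S / (4 * t\<^sup>2) + 1 / (2 * t)) = real DIM('a) * (S / t\<^sup>2) + 2 * (real DIM('a) / t)"
      by (simp add: algebra_simps)
    ultimately show ?thesis by linarith
  qed
  finally have 1: "\<bar>S / (4 * \<tau>\<^sup>2) - real DIM('a) / (2 * \<tau>)\<bar> \<le> 4 * real DIM('a) * (S / (4 * t\<^sup>2) + 1 / (2 * t))" .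
  have 2: "(4 * pi * \<tau>) powr (- real DIM('a) / 2) \<le> (4 * pi * (t / 2)) powr (- real DIM('a) / 2)"
    using t \<tau> by (intro powr_mono2') auto
  have 3: "exp (- S / (4 * \<tau>)) \<le> exp (- S / (4 * t))"
    using S \<tau> \<tau>0 by (auto simp: intro!: divide_left_mono)
  have 4: "exp (- S / (8 * t)) \<le> exp (- (1 / (16 * t)) * S)"
    using t S by (simp add: field_simps)
  have "\<bar>heat_kernel \<tau> v * ((norm v)\<^sup>2 / (4 * \<tau>\<^sup>2) - real DIM('a) / (2 * \<tau>))\<bar> =
     (4 * pi * \<tau>) powr (- real DIM('a) / 2) * (exp (- S / (4 * \<tau>)) * \<bar>S / (4 * \<tau>\<^sup>2) - real DIM('a) / (2 * \<tau>)\<bar>)"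
    by (simp add: heat_kernel_def abs_mult S_def)
  also have "\<dots> \<le> (4 * pi * (t / 2)) powr (- real DIM('a) / 2) *
      (exp (- S / (4 * t)) * (4 * real DIM('a) * (S / (4 * t\<^sup>2) + 1 / (2 * t))))"
    by (intro mult_mono 1 2 3) auto
  also have "\<dots> = (4 * pi * (t / 2)) powr (- real DIM('a) / 2) *
      (4 * real DIM('a) * (exp (- S / (4 * t)) * (S / (4 * t\<^sup>2) + 1 / (2 * t))))"
    by (simp only: mult_ac)
  also have "\<dots> \<le> (4 * pi * (t / 2)) powr (- real DIM('a) / 2) * (4 * real DIM('a) * (5 / (2 * t) * exp (- S / (8 * t))))"
    using t S by (intro mult_left_mono gaussian_absorb) auto
  also have "\<dots> \<le> (4 * pi * (t / 2)) powr (- real DIM('a) / 2) * (4 * real DIM('a) * (5 / (2 * t) * exp (- (1 / (16 * t)) * S)))"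
    using t by (intro mult_left_mono 4) auto
  finally show ?thesis by (simp only: mult.assoc S_def)
qed

lemma heat_measurable [measurable]: "heat_kernel t \<in> borel_measurable borel"
  unfolding heat_kernel_def by measurable

lemma heat_nonneg: "0 \<le> heat_kernel t v"
  unfolding heat_kernel_def by simp

text \<open>\<open>h\<close> has Laplacian \<open>2 * DIM('a)\<close> and time derivative
  \<open>2 * DIM('a) + 1\<close>, so the heat operator takes it to -1. At a local maximum of the
  extension minus \<open>\<delta> * h\<close>, the discrete heat operator of the extension would
  stay at most \<open>- \<delta>\<close>, although it converges to 0.\<close>

lemma heat_no_local_max:
  fixes g :: "'a::euclidean_space \<Rightarrow> real"
  assumes g[measurable]: "g \<in> borel_measurable borel" and B: "\<And>w. \<bar>g w\<bar> \<le> B"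
    and t: "0 < t" and \<delta>: "0 < \<delta>" and e: "0 < e"
  defines "h \<equiv> \<lambda>z::'a \<times> real. (norm (fst z))\<^sup>2 + (2 * real DIM('a) + 1) * snd z"
  shows "\<exists>z\<in>ball (y, t) e. Kext heat_kernel g y t - \<delta> * h (y, t) < Kext heat_kernel g (fst z) (snd z) - \<delta> * h z"
proof (rule ccontr)
  assume neg: "\<not> ?thesis"
  have max: "Kext heat_kernel g y' t' - Kext heat_kernel g y t \<le> \<delta> * (h (y', t') - h (y, t))"
    if "dist (y, t) (y', t') < e" for y' t'
  proof -
    have "(y', t') \<in> ball (y, t) e" using that by simp
    with neg have "\<not> Kext heat_kernel g y t - \<delta> * h (y, t) < Kext heat_kernel g (fst (y', t')) (snd (y', t')) - \<delta> * h (y', t')"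
      by blast
    then show ?thesis by (simp add: algebra_simps)
  qed
  let ?u = "Kext heat_kernel g"
  \<comment> \<open>The bound \<open>sqrt (t / 2)\<close> keeps the earlier times
    \<open>t - r^2\<close> at least \<open>t / 2\<close>, \<open>e / 2\<close> keeps space steps in
    the ball, and 1 gives \<open>r^2 \<le> r0 < e\<close> for time steps.\<close>
  define r0 where "r0 = min 1 (min (e / 2) (sqrt (t / 2)))"
  have r0: "0 < r0" "r0 \<le> 1" "r0 < e" "r0\<^sup>2 \<le> t / 2"
  proof -
    show "0 < r0" "r0 \<le> 1" "r0 < e" using t e by (auto simp: r0_def)
    have "r0\<^sup>2 \<le> (sqrt (t / 2))\<^sup>2" using t e by (intro power_mono) (auto simp: r0_def)
    then show "r0\<^sup>2 \<le> t / 2" using t by simp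
  qed
  define r where "r n = r0 / real (Suc n)" for n
  have r: "0 < r n" "r n \<le> r0" for n
    using r0 by (auto simp: r_def divide_le_eq mult_le_cancel_left1)
  have rlim: "r \<longlonglongrightarrow> 0" unfolding r_def by real_asymp
  have r2: "(r n)\<^sup>2 \<le> r0\<^sup>2" "(r n)\<^sup>2 < e" for n
  proof -
    show "(r n)\<^sup>2 \<le> r0\<^sup>2" using r[of n] by (intro power_mono) auto
    have "r n * r n \<le> r0 * 1" using r[of n] r0 by (intro mult_mono) auto
    then show "(r n)\<^sup>2 < e" using r0 by (simp add: power2_eq_square)
  qed
  have heat_int: "integrable lborel (heat_kernel t' :: 'a \<Rightarrow> real)" if "0 < t'" for t'
    using heat_mass[OF that, where 'a='a] by (intro integrable_of_mass[where c=1]) (auto simp: heat_nonneg)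
  have G: "integrable lborel (\<lambda>w. c * exp (- (1 / (16 * t)) * (norm (y - w :: 'a))\<^sup>2))" for c
    using t gaussian_mass[of "1 / (16 * t)", where 'a='a]
    by (intro integrable_mult_right integrable_reflect[where f="\<lambda>w. exp (- (1 / (16 * t)) * (norm w)\<^sup>2)"] integrable_of_mass) auto
  let ?k2 = "\<lambda>b w. heat_kernel t (y - w) * (((y - w) \<bullet> b)\<^sup>2 / (4 * t\<^sup>2) - 1 / (2 * t))"
  let ?k1 = "\<lambda>w. heat_kernel t (y - w) * ((norm (y - w))\<^sup>2 / (4 * t\<^sup>2) - real DIM('a) / (2 * t))"
  have space: "(\<lambda>n. (?u (y + r n *\<^sub>R b) t + ?u (y - r n *\<^sub>R b) t - 2 * ?u y t) / (r n)\<^sup>2) \<longlonglongrightarrow> (\<integral>w. ?k2 b w * g w \<partial>lborel)"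
    "integrable lborel (\<lambda>w. ?k2 b w * g w)" if b: "b \<in> Basis" for b
  proof -
    define k where "k x w = heat_kernel t (y - w + x *\<^sub>R b)" for x w
    define k1 where "k1 x w = k x w * (- ((y - w) \<bullet> b + x) / (2 * t))" for x w
    define k2 where "k2 x w = k x w * (((y - w) \<bullet> b + x)\<^sup>2 / (4 * t\<^sup>2) - 1 / (2 * t))" for x w
    define D where "D w = (4 * pi * t) powr (- real DIM('a) / 2) * (5 / (2 * t)) * exp (1 / 8) * exp (- (1 / (16 * t)) * (norm (y - w))\<^sup>2)" for w
    have d1: "((\<lambda>x. k x w) has_real_derivative k1 x w) (at x)" if "\<bar>x\<bar> \<le> r0" for x w
      unfolding k_def k1_def by (rule heat_deriv_space(1)[OF b t])
    have d2: "((\<lambda>x. k1 x w) has_real_derivative k2 x w) (at x)" if "\<bar>x\<bar> \<le> r0" for x w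
      unfolding k_def k1_def k2_def by (rule heat_deriv_space(2)[OF b t])
    have i: "integrable lborel (\<lambda>w. k x w * g w)" if "\<bar>x\<bar> \<le> r0" for x
      using integrable_reflect_mult[OF heat_int[OF t] g B, of "y + x *\<^sub>R b"] by (simp add: k_def algebra_simps)
    have c: "isCont (\<lambda>x. k2 x w) 0" for w
      unfolding k2_def k_def by (intro continuous_intros DERIV_isCont[OF heat_deriv_space(1)[OF b t]]) (use t in auto)
    have bnd: "\<bar>k2 x w\<bar> \<le> D w" if "\<bar>x\<bar> \<le> r0" for x w
    proof -
      have "x\<^sup>2 \<le> r0\<^sup>2" using that r0 by (simp add: abs_le_square_iff[symmetric])
      then have "x\<^sup>2 \<le> t" using r0 t by linarith
      then show ?thesis unfolding k2_def k_def D_def by (rule heat_bound_space[OF b t])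
    qed
    have m: "k2 0 \<in> borel_measurable lborel" "g \<in> borel_measurable lborel" unfolding k2_def k_def by measurable
    have D: "integrable lborel D" unfolding D_def by (rule G)
    note * = second_difference_integral[OF d1 d2 c r rlim m B i D bnd]
    show "(\<lambda>n. (?u (y + r n *\<^sub>R b) t + ?u (y - r n *\<^sub>R b) t - 2 * ?u y t) / (r n)\<^sup>2) \<longlonglongrightarrow> (\<integral>w. ?k2 b w * g w \<partial>lborel)"
      using *(1) by (simp add: Kext_def k2_def k_def algebra_simps)
    show "integrable lborel (\<lambda>w. ?k2 b w * g w)"
      using *(2) by (simp add: k2_def k_def)
  qed
  have time: "(\<lambda>n. (?u y (t - (r n)\<^sup>2) - ?u y t) / (r n)\<^sup>2) \<longlonglongrightarrow> - (\<integral>w. ?k1 w * g w \<partial>lborel)"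
    "integrable lborel (\<lambda>w. ?k1 w * g w)"
  proof -
    have \<tau>: "0 < t + x" "t / 2 \<le> t + x" "t + x \<le> t" if "- r0\<^sup>2 \<le> x" "x \<le> 0" for x
      using that r0 t by auto
    have r2': "0 < (r n)\<^sup>2" "(\<lambda>n. (r n)\<^sup>2) \<longlonglongrightarrow> 0" for n
      using r(1)[of n] tendsto_power[OF rlim, of 2] by auto
    define k where "k x w = heat_kernel (t + x) (y - w)" for x w
    define k1 where "k1 x w = k x w * ((norm (y - w))\<^sup>2 / (4 * (t + x)\<^sup>2) - real DIM('a) / (2 * (t + x)))" for x w
    define D where "D w = (4 * pi * (t / 2)) powr (- real DIM('a) / 2) * (4 * real DIM('a) * (5 / (2 * t))) * exp (- (1 / (16 * t)) * (norm (y - w))\<^sup>2)" for w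
    have d1: "((\<lambda>x. k x w) has_real_derivative k1 x w) (at x)" if "- r0\<^sup>2 \<le> x" "x \<le> 0" for x w
      unfolding k_def k1_def by (rule heat_deriv_time[OF \<tau>(1)[OF that]])
    have i: "integrable lborel (\<lambda>w. k x w * g w)" if "- r0\<^sup>2 \<le> x" "x \<le> 0" for x
      unfolding k_def by (rule integrable_reflect_mult[OF heat_int[OF \<tau>(1)[OF that]] g B])
    have bnd: "\<bar>k1 x w\<bar> \<le> D w" if "- r0\<^sup>2 \<le> x" "x \<le> 0" for x w
      unfolding k1_def k_def D_def by (rule heat_bound_time[OF t \<tau>(2,3)[OF that]])
    have m: "k1 0 \<in> borel_measurable lborel" "g \<in> borel_measurable lborel" unfolding k1_def k_def by measurable
    have D: "integrable lborel D" unfolding D_def by (rule G)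
    note * = backward_difference_integral[OF d1 r2'(1) r2(1) r2'(2) m B i D bnd]
    show "(\<lambda>n. (?u y (t - (r n)\<^sup>2) - ?u y t) / (r n)\<^sup>2) \<longlonglongrightarrow> - (\<integral>w. ?k1 w * g w \<partial>lborel)"
      using *(1) by (simp add: Kext_def k1_def k_def)
    show "integrable lborel (\<lambda>w. ?k1 w * g w)"
      using *(2) by (simp add: k1_def k_def)
  qed
  \<comment> \<open>Discrete Laplacian minus time derivative; the latter appears as a difference
    backwards in time, with the parabolic step \<open>r^2\<close>.\<close>
  let ?S = "\<lambda>n. (\<Sum>b\<in>Basis. (?u (y + r n *\<^sub>R b) t + ?u (y - r n *\<^sub>R b) t - 2 * ?u y t) / (r n)\<^sup>2) + (?u y (t - (r n)\<^sup>2) - ?u y t) / (r n)\<^sup>2"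
  have "?S \<longlonglongrightarrow> (\<Sum>b\<in>Basis. (\<integral>w. ?k2 b w * g w \<partial>lborel)) + - (\<integral>w. ?k1 w * g w \<partial>lborel)"
    by (intro tendsto_add tendsto_sum space(1) time(1))
  also have "(\<Sum>b\<in>Basis. (\<integral>w. ?k2 b w * g w \<partial>lborel)) = (\<integral>w. (\<Sum>b\<in>Basis. ?k2 b w * g w) \<partial>lborel)"
    using space(2) by (subst Bochner_Integration.integral_sum) auto
  \<comment> \<open>The heat equation for the kernel: summed over the directions, the squares of the
    coordinates give the squared norm and the constants give
    \<open>DIM('a) / (2 * t)\<close>.\<close>
  also have "(\<lambda>w. \<Sum>b\<in>Basis. ?k2 b w * g w) = (\<lambda>w. ?k1 w * g w)"
    by (simp add: sum_distrib_right[symmetric] sum_distrib_left[symmetric] sum_subtractf sum_divide_distrib[symmetric] sum_inner_Basis_square)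
  finally have lim: "?S \<longlonglongrightarrow> 0" by simp
  \<comment> \<open>The linear terms of \<open>h\<close> cancel between opposite space steps,
    leaving \<open>2 * \<delta>\<close> per direction; the time step contributes
    \<open>- \<delta> * (2 * DIM('a) + 1)\<close>.\<close>
  have "?S n \<le> - \<delta>" for n
  proof -
    have "(?u (y + r n *\<^sub>R b) t + ?u (y - r n *\<^sub>R b) t - 2 * ?u y t) / (r n)\<^sup>2 \<le> 2 * \<delta>" if b: "b \<in> Basis" for b
    proof -
      have d: "dist (y, t) (y + r n *\<^sub>R b, t) < e" "dist (y, t) (y - r n *\<^sub>R b, t) < e"
        using b r[of n] r0 by (auto simp: dist_Pair_Pair dist_norm)
      have "(norm (y - r n *\<^sub>R b))\<^sup>2 = (norm y)\<^sup>2 - 2 * (y \<bullet> b) * r n + (r n)\<^sup>2"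
        using norm_add_Basis_square[OF b, of y "- r n"] by simp
      with max[OF d(1)] max[OF d(2)] have "?u (y + r n *\<^sub>R b) t + ?u (y - r n *\<^sub>R b) t - 2 * ?u y t \<le> 2 * \<delta> * (r n)\<^sup>2"
        by (simp add: h_def norm_add_Basis_square[OF b] algebra_simps)
      then show ?thesis using r(1)[of n] by (simp add: divide_le_eq)
    qed
    then have "(\<Sum>b\<in>Basis. (?u (y + r n *\<^sub>R b) t + ?u (y - r n *\<^sub>R b) t - 2 * ?u y t) / (r n)\<^sup>2) \<le> (\<Sum>b\<in>(Basis::'a set). 2 * \<delta>)"
      by (rule sum_mono)
    moreover have "(?u y (t - (r n)\<^sup>2) - ?u y t) / (r n)\<^sup>2 \<le> - (\<delta> * (2 * real DIM('a) + 1))"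
    proof -
      have "dist (y, t) (y, t') = \<bar>t - t'\<bar>" for t' by (simp add: dist_Pair_Pair dist_real_def)
      then have "dist (y, t) (y, t - (r n)\<^sup>2) < e" using r2[of n] by simp
      from max[OF this] have "?u y (t - (r n)\<^sup>2) - ?u y t \<le> - (\<delta> * (2 * real DIM('a) + 1)) * (r n)\<^sup>2"
        by (simp add: h_def algebra_simps)
      then show ?thesis using r(1)[of n] by (subst pos_divide_le_eq) auto
    qed
    ultimately show ?thesis by (simp add: algebra_simps)
  qed
  then have "0 \<le> - \<delta>" by (intro LIMSEQ_le_const2[OF lim]) auto
  with \<delta> show False by simp
qed

lemma heat_averaging_kernel:
  "averaging_kernel (heat_kernel :: real \<Rightarrow> 'a::euclidean_space \<Rightarrow> real) sqrt
     (\<lambda>z. (norm (fst z))\<^sup>2 + (2 * real DIM('a) + 1) * snd z)"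
proof
  fix t :: real and v :: 'a assume t: "0 < t"
  show "0 \<le> heat_kernel t v" by (rule heat_nonneg)
  show "continuous_on UNIV (heat_kernel t :: 'a \<Rightarrow> real)"
    unfolding heat_kernel_def using t by (intro continuous_intros) auto
  show "(\<integral>\<^sup>+ w. ennreal (heat_kernel t (w::'a)) \<partial>lborel) = 1" using t by (rule heat_mass)
  show "sqrt t ^ DIM('a) * heat_kernel t (sqrt t *\<^sub>R v) = heat_kernel 1 v"
  proof -
    have "sqrt t ^ DIM('a) = t powr (real DIM('a) / 2)"
      using t by (simp add: powr_half_sqrt[symmetric] powr_powr powr_realpow[symmetric])
    moreover have "(4 * pi * t) powr (- real DIM('a) / 2) = (4 * pi) powr (- real DIM('a) / 2) * t powr (- (real DIM('a) / 2))"
      using t by (simp add: powr_mult)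
    moreover have "t powr (real DIM('a) / 2) * t powr (- (real DIM('a) / 2)) = 1"
      using t by (simp add: powr_add[symmetric])
    ultimately show ?thesis
      using t by (simp add: heat_kernel_def power_mult_distrib mult_ac)
  qed
  show "0 < sqrt t" using t by simp
next
  show "bounded {z::'a \<times> real. 0 \<le> snd z \<and> (norm (fst z))\<^sup>2 + (2 * real DIM('a) + 1) * snd z \<le> C}" for C
  proof (rule boundedI, clarsimp)
    fix y :: 'a and t :: real
    assume t: "0 \<le> t" and le: "(norm y)\<^sup>2 + (2 * real DIM('a) + 1) * t \<le> C"
    have "0 \<le> real DIM('a) * t" using t by simp
    moreover have "(2 * real DIM('a) + 1) * t = 2 * (real DIM('a) * t) + t" by (simp add: algebra_simps)
    ultimately have 1: "(norm y)\<^sup>2 + t \<le> C" using le by linarith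
    have "norm y \<le> 1 + (norm y)\<^sup>2"
      using zero_le_power2[of "norm y - 1 / 2"] by (simp add: power2_diff field_simps) 
    then have "norm y + \<bar>t\<bar> \<le> 1 + C" using 1 t by simp
    moreover have "norm (y, t) \<le> norm y + norm t" by (rule norm_Pair_le)
    ultimately show "norm (y, t) \<le> 1 + C" by simp
  qed
  show "continuous_on (UNIV \<times> {0..}) (\<lambda>z::'a \<times> real. (norm (fst z))\<^sup>2 + (2 * real DIM('a) + 1) * snd z)"
    by (intro continuous_intros)
  show "continuous_on {0..} sqrt" by (intro continuous_intros)
  show "\<exists>z\<in>ball (y, t) e. Kext heat_kernel g y t - \<delta> * ((norm (fst (y, t)))\<^sup>2 + (2 * real DIM('a) + 1) * snd (y, t))
      < Kext heat_kernel g (fst z) (snd z) - \<delta> * ((norm (fst z))\<^sup>2 + (2 * real DIM('a) + 1) * snd z)"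
    if "g \<in> borel_measurable borel" "\<And>w. \<bar>g w\<bar> \<le> B" "0 < t" "0 < \<delta>" "0 < e" for g B and y :: 'a and t \<delta> e
    using that by (rule heat_no_local_max)
qed auto

section \<open>The Poisson kernel\<close>

text \<open>Along any line parallel to an axis, the time axis included, \<open>t^2 + |v|^2\<close>
  has this form: \<open>A\<close> is its value at the base point and \<open>B\<close> the coordinate
  that varies. Powers of it produce both the Poisson kernel and the barrier.\<close>

definition quad :: "real \<Rightarrow> real \<Rightarrow> real \<Rightarrow> real" where
  "quad A B x = A + 2 * B * x + x\<^sup>2"

definition quad_powr' :: "real \<Rightarrow> real \<Rightarrow> real \<Rightarrow> real \<Rightarrow> real" where
  "quad_powr' A B a x = 2 * a * (B + x) * quad A B x powr (a - 1)"

definition quad_powr'' :: "real \<Rightarrow> real \<Rightarrow> real \<Rightarrow> real \<Rightarrow> real" where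
  "quad_powr'' A B a x = 2 * a * quad A B x powr (a - 1) + 4 * a * (a - 1) * (B + x)\<^sup>2 * quad A B x powr (a - 2)"

lemma quad_deriv: "(quad A B has_real_derivative 2 * (B + x)) (at x)"
  unfolding quad_def by (auto intro!: derivative_eq_intros)

lemma quad_powr_deriv:
  assumes "0 < quad A B x"
  shows "((\<lambda>x. quad A B x powr a) has_real_derivative quad_powr' A B a x) (at x)"
    and "(quad_powr' A B a has_real_derivative quad_powr'' A B a x) (at x)"
proof -
  have p: "((\<lambda>x. quad A B x powr c) has_real_derivative c * quad A B x powr (c - 1) * (2 * (B + x))) (at x)" for c
    using DERIV_fun_powr[OF quad_deriv assms, of c] by simp
  show "((\<lambda>x. quad A B x powr a) has_real_derivative quad_powr' A B a x) (at x)"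
    by (rule DERIV_cong[OF p]) (simp add: quad_powr'_def)
  have l: "((\<lambda>x. 2 * a * (B + x)) has_real_derivative 2 * a) (at x)"
    by (auto intro!: derivative_eq_intros)
  have "((\<lambda>x. 2 * a * (B + x) * quad A B x powr (a - 1)) has_real_derivative
      2 * a * quad A B x powr (a - 1) + (a - 1) * quad A B x powr (a - 1 - 1) * (2 * (B + x)) * (2 * a * (B + x))) (at x)"
    by (rule DERIV_mult[OF l p])
  moreover have "2 * a * quad A B x powr (a - 1) + (a - 1) * quad A B x powr (a - 1 - 1) * (2 * (B + x)) * (2 * a * (B + x)) = quad_powr'' A B a x"
    by (simp add: quad_powr''_def power2_eq_square diff_diff_eq algebra_simps)
  ultimately show "(quad_powr' A B a has_real_derivative quad_powr'' A B a x) (at x)"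
    unfolding quad_powr'_def by simp
qed

lemma isCont_quad_powr'':
  assumes "0 < quad A B x" shows "isCont (quad_powr'' A B a) x"
  unfolding quad_powr''_def using assms DERIV_isCont[OF quad_deriv[of A B x]]
  by (intro continuous_intros) auto

text \<open>For the time direction, where a factor \<open>t\<close> (kernel) or
  \<open>sqrt (t + 1)\<close> (barrier) multiplies the power of the quadratic.\<close>

lemma product_second_deriv:
  fixes m m1 m2 g g1 g2 :: "real \<Rightarrow> real"
  assumes "(m has_real_derivative m1 x) (at x)" "(m1 has_real_derivative m2 x) (at x)"
    "(g has_real_derivative g1 x) (at x)" "(g1 has_real_derivative g2 x) (at x)"
  shows "((\<lambda>x. m x * g x) has_real_derivative m1 x * g x + m x * g1 x) (at x)"
    and "((\<lambda>x. m1 x * g x + m x * g1 x) has_real_derivative m2 x * g x + 2 * m1 x * g1 x + m x * g2 x) (at x)"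
proof -
  show "((\<lambda>x. m x * g x) has_real_derivative m1 x * g x + m x * g1 x) (at x)"
    using DERIV_mult[OF assms(1,3)] by (simp add: mult.commute)
  show "((\<lambda>x. m1 x * g x + m x * g1 x) has_real_derivative m2 x * g x + 2 * m1 x * g1 x + m x * g2 x) (at x)"
    using DERIV_add[OF DERIV_mult[OF assms(2,3)] DERIV_mult[OF assms(1,4)]] by (simp add: algebra_simps)
qed

text \<open>A coordinate is at most the distance, so one factor \<open>quad A B x\<close> absorbs
  \<open>(B + x)^2\<close> and both terms get the same order.\<close>

lemma quad_powr''_bound:
  assumes pos: "0 < quad A B x" and le: "(B + x)\<^sup>2 \<le> quad A B x" and a: "a \<le> 0"
  shows "\<bar>quad_powr'' A B a x\<bar> \<le> (- 2 * a + 4 * a * (a - 1)) * quad A B x powr (a - 1)"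
proof -
  let ?Q = "quad A B x"
  have a2: "0 \<le> 4 * a * (a - 1)" using a by (simp add: mult_nonpos_nonpos)
  have "(B + x)\<^sup>2 * ?Q powr (a - 2) \<le> ?Q * ?Q powr (a - 2)"
    using le by (intro mult_right_mono) auto
  also have "\<dots> = ?Q powr (a - 1)"
    using pos powr_mult_base[of ?Q "a - 2"] by simp
  finally have "4 * a * (a - 1) * ((B + x)\<^sup>2 * ?Q powr (a - 2)) \<le> 4 * a * (a - 1) * ?Q powr (a - 1)"
    using a2 by (rule mult_left_mono)
  moreover have "0 \<le> 4 * a * (a - 1) * ((B + x)\<^sup>2 * ?Q powr (a - 2))"
    using a2 by (rule mult_nonneg_nonneg) auto
  moreover have "2 * a * ?Q powr (a - 1) \<le> 0" using a by (simp add: mult_nonpos_nonneg)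
  ultimately show ?thesis
    unfolding quad_powr''_def by (simp add: abs_le_iff algebra_simps)
qed

lemma sum_Basis_quad_powr'':
  fixes v :: "'a::euclidean_space"
  shows "(\<Sum>b\<in>Basis. quad_powr'' A (v \<bullet> b) a 0) = 2 * a * real DIM('a) * A powr (a - 1) + 4 * a * (a - 1) * (norm v)\<^sup>2 * A powr (a - 2)"
proof -
  have "quad_powr'' A (v \<bullet> b) a 0 = 2 * a * A powr (a - 1) + (4 * a * (a - 1) * A powr (a - 2)) * (v \<bullet> b)\<^sup>2" for b
    by (simp add: quad_powr''_def quad_def)
  then have "(\<Sum>b\<in>Basis. quad_powr'' A (v \<bullet> b) a 0) =
      2 * a * (real DIM('a) * A powr (a - 1)) + (4 * a * (a - 1) * A powr (a - 2)) * (\<Sum>b\<in>Basis. (v \<bullet> b)\<^sup>2)"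
    by (simp only: sum.distrib sum_distrib_left[symmetric] sum_constant)
  then show ?thesis
    by (simp only: sum_inner_Basis_square mult_ac)
qed

text \<open>\<open>Q0\<close> is the quadratic at the base point and \<open>Q\<close> the one at a
  nearby point. Of the \<open>s + 1\<close> powers, \<open>s\<close> are compared with
  \<open>Q0\<close> and the spare one is at most \<open>4 / t^2\<close>. The second derivatives of
  the Poisson kernel are thus dominated by a multiple of the kernel itself, which is
  integrable.\<close>

lemma powr_quarter_bound:
  fixes t Q0 Q s :: real
  assumes t: "0 < t" and Q0: "t\<^sup>2 \<le> Q0" and Q: "Q0 / 4 \<le> Q" and s: "0 < s"
  shows "Q powr (- s - 1) \<le> 4 powr s * (4 / t\<^sup>2) * Q0 powr (- s)"
proof -
  have "0 < t\<^sup>2" using t by simp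
  with Q0 Q have pos: "0 < Q0" "0 < Q" by linarith+
  have "Q powr (- s - 1) = Q powr (- s) * (1 / Q)"
    using pos by (simp add: powr_diff)
  also have "\<dots> \<le> (Q0 / 4) powr (- s) * (4 / t\<^sup>2)"
  proof (rule mult_mono)
    show "Q powr (- s) \<le> (Q0 / 4) powr (- s)" using pos Q s by (intro powr_mono2') auto
    have "1 / Q \<le> 1 / (t\<^sup>2 / 4)" using Q0 Q pos t by (intro divide_left_mono) auto
    then show "1 / Q \<le> 4 / t\<^sup>2" by simp
  qed (use pos in auto)
  also have "(Q0 / 4) powr (- s) = 4 powr s * Q0 powr (- s)"
    using pos by (simp add: powr_divide powr_minus field_simps)
  finally show ?thesis by (simp add: mult_ac)
qed

lemma poisson_kernel_eq:
  "poisson_kernel t (v::'a::euclidean_space) =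
    Gamma ((real DIM('a) + 1) / 2) / pi powr ((real DIM('a) + 1) / 2) * t * (t\<^sup>2 + (norm v)\<^sup>2) powr (- ((real DIM('a) + 1) / 2))"
  unfolding poisson_kernel_def powr_minus_divide by simp

lemma poisson_const_pos: "0 < Gamma ((real n + 1) / 2) / pi powr ((real n + 1) / 2)"
  by (intro divide_pos_pos Gamma_real_pos) auto

lemma poisson_nonneg: "0 \<le> t \<Longrightarrow> 0 \<le> poisson_kernel t v"
  unfolding poisson_kernel_eq using poisson_const_pos by (intro mult_nonneg_nonneg less_imp_le[OF poisson_const_pos]) auto

lemma poisson_measurable [measurable]: "poisson_kernel t \<in> borel_measurable borel"
  unfolding poisson_kernel_def by measurable

text \<open>
  The barrier has the form \<open>s powr (1/2) * \<rho> powr \<gamma>\<close> with \<open>s = t + 1\<close> and \<open>\<rho>\<^sup>2 = s\<^sup>2 + (norm y)\<^sup>2\<close>; its Laplacian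
  is \<open>(\<gamma> * (\<gamma> + n) / \<rho>\<^sup>2 - 1 / (4 * s\<^sup>2))\<close> times itself, which is negative for small \<open>\<gamma>\<close> because \<open>s \<le> \<rho>\<close>.
\<close>

lemma poisson_no_local_max:
  fixes g :: "'a::euclidean_space \<Rightarrow> real"
  assumes g[measurable]: "g \<in> borel_measurable borel" and B: "\<And>w. \<bar>g w\<bar> \<le> B"
    and t: "0 < t" and \<delta>: "0 < \<delta>" and e: "0 < e"
  defines "h \<equiv> \<lambda>z::'a \<times> real. sqrt (snd z + 1) * ((snd z + 1)\<^sup>2 + (norm (fst z))\<^sup>2) powr (1 / (16 * real DIM('a)))"
  shows "\<exists>z\<in>ball (y, t) e. Kext poisson_kernel g y t - \<delta> * h (y, t) < Kext poisson_kernel g (fst z) (snd z) - \<delta> * h z"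
proof (rule ccontr)
  assume neg: "\<not> ?thesis"
  let ?u = "Kext poisson_kernel g"
  have max: "?u y' t' - ?u y t \<le> \<delta> * (h (y', t') - h (y, t))" if "dist (y, t) (y', t') < e" for y' t'
  proof -
    have "(y', t') \<in> ball (y, t) e" using that by simp
    with neg have "\<not> ?u y t - \<delta> * h (y, t) < ?u (fst (y', t')) (snd (y', t')) - \<delta> * h (y', t')"
      by blast
    then show ?thesis by (simp add: algebra_simps)
  qed
  \<comment> \<open>The bound \<open>t / 2\<close> keeps all times between \<open>t / 2\<close> and
    \<open>2 * t\<close>, away from the boundary where the kernel is singular.\<close>
  define r0 where "r0 = min (e / 2) (t / 2)"
  have r0: "0 < r0" "r0 < e" "r0 \<le> t / 2" using t e by (auto simp: r0_def)
  define r where "r n = r0 / real (Suc n)" for n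
  have r: "0 < r n" "r n \<le> r0" for n
    using r0 by (auto simp: r_def divide_le_eq mult_le_cancel_left1)
  have rlim: "r \<longlonglongrightarrow> 0" unfolding r_def by real_asymp
  define s where "s = (real DIM('a) + 1) / 2"
  have s: "0 < s" by (simp add: s_def)
  define C where "C = Gamma s / pi powr s"
  have C: "0 < C" unfolding C_def s_def by (rule poisson_const_pos)
  have pk: "poisson_kernel t' v = C * t' * (t'\<^sup>2 + (norm v)\<^sup>2) powr (- s)" for t' and v :: 'a
    unfolding poisson_kernel_eq C_def s_def by (rule refl)
  have poisson_int: "integrable lborel (poisson_kernel t' :: 'a \<Rightarrow> real)" if "0 < t'" for t'
    using poisson_mass[OF that, where 'a='a] that by (intro integrable_of_mass[where c=1]) (auto simp: poisson_nonneg)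
  let ?A = "\<lambda>w. t\<^sup>2 + (norm (y - w))\<^sup>2"
  have A: "0 < ?A w" "t\<^sup>2 \<le> ?A w" for w using t by (auto simp: add_pos_nonneg)
  \<comment> \<open>One constant for all directions: space needs
    \<open>2 * s + 4 * s * (s + 1)\<close>, time needs \<open>6 * s + 4 * s * (s + 1)\<close>, and
    the leading 2 comes from \<open>t + x \<le> 2 * t\<close>. The last factor is that of
    \<open>powr_quarter_bound\<close>.\<close>
  define c where "c = 2 * (6 * s + 4 * s * (s + 1)) * (4 powr s * (4 / t\<^sup>2))"
  define D where "D w = c * poisson_kernel t (y - w)" for w
  have D: "integrable lborel D"
    unfolding D_def by (intro integrable_mult_right integrable_reflect[OF poisson_int[OF t]])
  have x2: "x\<^sup>2 \<le> t\<^sup>2" if "\<bar>x\<bar> \<le> r0" for x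
    using that r0 t by (simp add: abs_le_square_iff[symmetric])
  have gm: "g \<in> borel_measurable lborel" by simp

  \<comment> \<open>Second differences of the extension in space\<close>
  have space: "(\<lambda>n. (?u (y + r n *\<^sub>R b) t + ?u (y - r n *\<^sub>R b) t - 2 * ?u y t) / (r n)\<^sup>2)
      \<longlonglongrightarrow> (\<integral>w. C * t * quad_powr'' (?A w) ((y - w) \<bullet> b) (- s) 0 * g w \<partial>lborel)"
    "integrable lborel (\<lambda>w. C * t * quad_powr'' (?A w) ((y - w) \<bullet> b) (- s) 0 * g w)" if b: "b \<in> Basis" for b
  proof -
    let ?Q = "\<lambda>w. quad (?A w) ((y - w) \<bullet> b)"
    have Q_eq: "?Q w x = t\<^sup>2 + (norm (y - w + x *\<^sub>R b))\<^sup>2" for w x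
      unfolding norm_add_Basis_square[OF b] quad_def by simp
    have Q: "0 < ?Q w x" for w x unfolding Q_eq using t by (simp add: add_pos_nonneg)
    define k where "k x w = C * t * ?Q w x powr (- s)" for x w
    define k1 where "k1 x w = C * t * quad_powr' (?A w) ((y - w) \<bullet> b) (- s) x" for x w
    define k2 where "k2 x w = C * t * quad_powr'' (?A w) ((y - w) \<bullet> b) (- s) x" for x w
    have k_eq: "k x w = poisson_kernel t (y + x *\<^sub>R b - w)" for x w
    proof -
      have eq: "y - w + x *\<^sub>R b = y + x *\<^sub>R b - w" by simp
      show ?thesis unfolding k_def pk Q_eq eq ..
    qed
    have d1: "((\<lambda>x. k x w) has_real_derivative k1 x w) (at x)" if "\<bar>x\<bar> \<le> r0" for x w
      unfolding k_def k1_def by (intro DERIV_cmult quad_powr_deriv Q)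
    have d2: "((\<lambda>x. k1 x w) has_real_derivative k2 x w) (at x)" if "\<bar>x\<bar> \<le> r0" for x w
      unfolding k1_def k2_def by (intro DERIV_cmult quad_powr_deriv Q)
    have ct: "isCont (\<lambda>x. k2 x w) 0" for w
      unfolding k2_def by (intro continuous_intros isCont_quad_powr'' Q)
    have i: "integrable lborel (\<lambda>w. k x w * g w)" if "\<bar>x\<bar> \<le> r0" for x
      unfolding k_eq by (rule integrable_reflect_mult[OF poisson_int[OF t] g B])
    have m: "k2 0 \<in> borel_measurable lborel"
      unfolding k2_def quad_powr''_def quad_def by measurable
    have bnd: "\<bar>k2 x w\<bar> \<le> D w" if x: "\<bar>x\<bar> \<le> r0" for x w
    proof -
      have "((y - w) \<bullet> b + x)\<^sup>2 \<le> ?Q w x"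
        unfolding Q_eq using inner_Basis_square_le[OF b, of "y - w" x] t zero_le_power2[of t] by linarith
      then have "\<bar>quad_powr'' (?A w) ((y - w) \<bullet> b) (- s) x\<bar> \<le> (- 2 * - s + 4 * - s * (- s - 1)) * ?Q w x powr (- s - 1)"
        using s by (intro quad_powr''_bound Q) auto
      also have "- 2 * - s + 4 * - s * (- s - 1) = 2 * s + 4 * s * (s + 1)" by (simp add: algebra_simps)
      also have "?Q w x powr (- s - 1) \<le> 4 powr s * (4 / t\<^sup>2) * ?A w powr (- s)"
      proof (rule powr_quarter_bound[OF t A(2) _ s])
        have aux: "(T + S') / 4 \<le> T + S" if "S' \<le> 2 * S + 2 * X" "X \<le> T" "0 \<le> S" "0 \<le> T" for S S' T X :: real
          using that by (simp add: field_simps)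
        show "?A w / 4 \<le> ?Q w x"
          unfolding Q_eq by (rule aux[OF norm_square_le_shift[OF b] x2[OF x]]) auto
      qed
      finally have "\<bar>quad_powr'' (?A w) ((y - w) \<bullet> b) (- s) x\<bar> \<le> (2 * s + 4 * s * (s + 1)) * (4 powr s * (4 / t\<^sup>2) * ?A w powr (- s))"
        using s by (simp add: mult_left_mono)
      also have "\<dots> \<le> (2 * (6 * s + 4 * s * (s + 1))) * (4 powr s * (4 / t\<^sup>2) * ?A w powr (- s))"
      proof (rule mult_right_mono)
        have "0 \<le> s * (s + 1)" using s by simp
        then show "2 * s + 4 * s * (s + 1) \<le> 2 * (6 * s + 4 * s * (s + 1))" using s by (simp add: mult.assoc)
      qed auto
      finally have "C * t * \<bar>quad_powr'' (?A w) ((y - w) \<bullet> b) (- s) x\<bar> \<le> C * t * (c * ?A w powr (- s))"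
        using C t by (intro mult_left_mono) (auto simp: c_def mult.assoc)
      then show ?thesis
        using C t by (simp add: k2_def D_def pk abs_mult mult_ac)
    qed
    note * = second_difference_integral[OF d1 d2 ct r rlim m gm B i D bnd]
    show "(\<lambda>n. (?u (y + r n *\<^sub>R b) t + ?u (y - r n *\<^sub>R b) t - 2 * ?u y t) / (r n)\<^sup>2)
      \<longlonglongrightarrow> (\<integral>w. C * t * quad_powr'' (?A w) ((y - w) \<bullet> b) (- s) 0 * g w \<partial>lborel)"
      using *(1) unfolding k_eq k2_def Kext_def by simp
    show "integrable lborel (\<lambda>w. C * t * quad_powr'' (?A w) ((y - w) \<bullet> b) (- s) 0 * g w)"
      using *(2) unfolding k2_def .
  qed

  \<comment> \<open>Second difference of the extension in time\<close>
  let ?T = "\<lambda>w. C * (2 * quad_powr' (?A w) t (- s) 0 + t * quad_powr'' (?A w) t (- s) 0)"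
  have time: "(\<lambda>n. (?u y (t + r n) + ?u y (t - r n) - 2 * ?u y t) / (r n)\<^sup>2) \<longlonglongrightarrow> (\<integral>w. ?T w * g w \<partial>lborel)"
    "integrable lborel (\<lambda>w. ?T w * g w)"
  proof -
    let ?Q = "\<lambda>w. quad (?A w) t"
    have Q_eq: "?Q w x = (t + x)\<^sup>2 + (norm (y - w))\<^sup>2" for w x
      by (simp add: quad_def power2_sum)
    have tx: "t / 2 \<le> t + x" "t + x \<le> 2 * t" "0 < t + x" if "\<bar>x\<bar> \<le> r0" for x
      using that r0 t by auto
    have Q: "0 < ?Q w x" if "\<bar>x\<bar> \<le> r0" for w x unfolding Q_eq using tx[OF that] by (simp add: add_pos_nonneg)
    define k where "k x w = C * ((t + x) * ?Q w x powr (- s))" for x w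
    \<comment> \<open>The trivial factors here and in \<open>k2\<close> are kept so that the terms
      match \<open>product_second_deriv\<close> for the factor \<open>t + x\<close> with derivatives
      1 and 0.\<close>
    define k1 where "k1 x w = C * (1 * ?Q w x powr (- s) + (t + x) * quad_powr' (?A w) t (- s) x)" for x w
    define k2 where "k2 x w = C * (0 * ?Q w x powr (- s) + 2 * 1 * quad_powr' (?A w) t (- s) x + (t + x) * quad_powr'' (?A w) t (- s) x)" for x w
    have k_eq: "k x w = poisson_kernel (t + x) (y - w)" for x w
      unfolding k_def pk Q_eq by simp
    have m1: "((\<lambda>x. t + x) has_real_derivative 1) (at x)" "((\<lambda>x. 1::real) has_real_derivative 0) (at x)" for x
      by (auto intro!: derivative_eq_intros)
    have d1: "((\<lambda>x. k x w) has_real_derivative k1 x w) (at x)" if "\<bar>x\<bar> \<le> r0" for x w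
      unfolding k_def k1_def 
      by (intro DERIV_cmult product_second_deriv(1)[where m="\<lambda>x. t + x" and ?m1.0="\<lambda>_. 1" and ?m2.0="\<lambda>_. 0"
            and g="\<lambda>x. ?Q w x powr (- s)" and ?g1.0="quad_powr' (?A w) t (- s)" and ?g2.0="quad_powr'' (?A w) t (- s)"]
          m1 quad_powr_deriv Q[OF that])
    have d2: "((\<lambda>x. k1 x w) has_real_derivative k2 x w) (at x)" if "\<bar>x\<bar> \<le> r0" for x w
      unfolding k1_def k2_def 
      by (intro DERIV_cmult product_second_deriv(2)[where m="\<lambda>x. t + x" and ?m1.0="\<lambda>_. 1" and ?m2.0="\<lambda>_. 0"
            and g="\<lambda>x. ?Q w x powr (- s)" and ?g1.0="quad_powr' (?A w) t (- s)" and ?g2.0="quad_powr'' (?A w) t (- s)"]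
          m1 quad_powr_deriv Q[OF that])
    have Q00: "0 < ?Q w 0" for w using Q[of 0 w] r0 by simp
    have ct: "isCont (\<lambda>x. k2 x w) 0" for w
      unfolding k2_def
      by (intro continuous_intros isCont_quad_powr'' DERIV_isCont[OF quad_powr_deriv(1)] DERIV_isCont[OF quad_powr_deriv(2)] Q00)
    have i: "integrable lborel (\<lambda>w. k x w * g w)" if "\<bar>x\<bar> \<le> r0" for x
      unfolding k_eq by (rule integrable_reflect_mult[OF poisson_int[OF tx(3)[OF that]] g B])
    have m: "k2 0 \<in> borel_measurable lborel"
      unfolding k2_def quad_powr''_def quad_powr'_def quad_def by measurable
    have bnd: "\<bar>k2 x w\<bar> \<le> D w" if x: "\<bar>x\<bar> \<le> r0" for x w
    proof -
      let ?R = "?Q w x powr (- s - 1)"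
      have "(t + x)\<^sup>2 \<le> ?Q w x" unfolding Q_eq by simp
      then have "\<bar>quad_powr'' (?A w) t (- s) x\<bar> \<le> (- 2 * - s + 4 * - s * (- s - 1)) * ?R"
        using s by (intro quad_powr''_bound Q[OF x]) auto
      also have "- 2 * - s + 4 * - s * (- s - 1) = 2 * s + 4 * s * (s + 1)" by (simp add: algebra_simps)
      finally have 2: "(t + x) * \<bar>quad_powr'' (?A w) t (- s) x\<bar> \<le> (t + x) * ((2 * s + 4 * s * (s + 1)) * ?R)"
        using tx[OF x] by (intro mult_left_mono) auto
      have 1: "\<bar>2 * quad_powr' (?A w) t (- s) x\<bar> = (t + x) * (4 * s * ?R)"
        using s tx(3)[OF x] by (simp add: quad_powr'_def abs_mult)
      have 3: "\<bar>2 * quad_powr' (?A w) t (- s) x + (t + x) * quad_powr'' (?A w) t (- s) x\<bar>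
          \<le> (t + x) * (4 * s * ?R) + (t + x) * ((2 * s + 4 * s * (s + 1)) * ?R)"
        by (rule order_trans[OF abs_triangle_ineq add_mono[OF eq_refl[OF 1]]])
           (use 2 tx(3)[OF x] in \<open>simp only: abs_mult abs_of_pos\<close>)
      also have "\<dots> = (t + x) * ((6 * s + 4 * s * (s + 1)) * ?R)" by (simp add: algebra_simps)
      also have "\<dots> \<le> (2 * t) * ((6 * s + 4 * s * (s + 1)) * (4 powr s * (4 / t\<^sup>2) * ?A w powr (- s)))"
      proof (intro mult_mono)
        show "?R \<le> 4 powr s * (4 / t\<^sup>2) * ?A w powr (- s)"
        proof (rule powr_quarter_bound[OF t A(2) _ s])
          have "(t / 2)\<^sup>2 \<le> (t + x)\<^sup>2" using tx[OF x] t by (intro power_mono) auto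
          then have "t\<^sup>2 \<le> 4 * (t + x)\<^sup>2" by (simp add: power_divide)
          moreover have "(T + S) / 4 \<le> T' + S" if "T \<le> 4 * T'" "0 \<le> S" for S T T' :: real
            using that by simp
          ultimately show "?A w / 4 \<le> ?Q w x"
            unfolding Q_eq by (metis zero_le_power2)
        qed
      qed (use s t tx[OF x] in auto)
      also have "\<dots> = t * (c * ?A w powr (- s))" by (simp add: c_def mult_ac)
      finally have "C * \<bar>2 * quad_powr' (?A w) t (- s) x + (t + x) * quad_powr'' (?A w) t (- s) x\<bar> \<le> C * (t * (c * ?A w powr (- s)))"
        using C by (intro mult_left_mono) auto
      then show ?thesis
        using C by (simp add: k2_def D_def pk abs_mult mult_ac)
    qed
    note * = second_difference_integral[OF d1 d2 ct r rlim m gm B i D bnd]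
    show "(\<lambda>n. (?u y (t + r n) + ?u y (t - r n) - 2 * ?u y t) / (r n)\<^sup>2) \<longlonglongrightarrow> (\<integral>w. ?T w * g w \<partial>lborel)"
      using *(1) unfolding k_eq k2_def Kext_def by simp
    show "integrable lborel (\<lambda>w. ?T w * g w)"
      using *(2) unfolding k2_def by simp
  qed

  \<comment> \<open>Harmonicity of the extension\<close>
  let ?S = "\<lambda>n. (\<Sum>b\<in>Basis. (?u (y + r n *\<^sub>R b) t + ?u (y - r n *\<^sub>R b) t - 2 * ?u y t) / (r n)\<^sup>2) + (?u y (t + r n) + ?u y (t - r n) - 2 * ?u y t) / (r n)\<^sup>2"
  have "?S \<longlonglongrightarrow> (\<Sum>b\<in>Basis. (\<integral>w. C * t * quad_powr'' (?A w) ((y - w) \<bullet> b) (- s) 0 * g w \<partial>lborel)) + (\<integral>w. ?T w * g w \<partial>lborel)"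
    by (intro tendsto_add tendsto_sum space(1) time(1))
  also have "(\<Sum>b\<in>Basis. (\<integral>w. C * t * quad_powr'' (?A w) ((y - w) \<bullet> b) (- s) 0 * g w \<partial>lborel)) + (\<integral>w. ?T w * g w \<partial>lborel)
      = (\<integral>w. (\<Sum>b\<in>Basis. C * t * quad_powr'' (?A w) ((y - w) \<bullet> b) (- s) 0 * g w) + ?T w * g w \<partial>lborel)"
    using space(2) time(2) by (simp add: Bochner_Integration.integral_sum Bochner_Integration.integral_add Bochner_Integration.integrable_sum)
  also have "(\<lambda>w. (\<Sum>b\<in>Basis. C * t * quad_powr'' (?A w) ((y - w) \<bullet> b) (- s) 0 * g w) + ?T w * g w) = (\<lambda>w. 0)"
  proof
    fix w
    define R where "R = ?A w powr (- s - 1)"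
    define W where "W = ?A w powr (- s - 2)"
    have RW: "R = ?A w * W"
    proof -
      have e: "- s - 1 = 1 + (- s - 2)" by simp
      show ?thesis unfolding R_def W_def e by (rule powr_mult_base[symmetric, OF less_imp_le[OF A(1)]])
    qed
    have E1: "(\<Sum>b\<in>Basis. quad_powr'' (?A w) ((y - w) \<bullet> b) (- s) 0) = - 2 * s * real DIM('a) * R + 4 * s * (s + 1) * (norm (y - w))\<^sup>2 * W"
      unfolding sum_Basis_quad_powr'' R_def W_def by (simp add: algebra_simps)
    have E2: "2 * quad_powr' (?A w) t (- s) 0 + t * quad_powr'' (?A w) t (- s) 0 = t * (- 6 * s * R + 4 * s * (s + 1) * t\<^sup>2 * W)"
      unfolding quad_powr''_def quad_powr'_def by (simp add: quad_def R_def W_def algebra_simps)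
    have "(\<Sum>b\<in>Basis. C * t * quad_powr'' (?A w) ((y - w) \<bullet> b) (- s) 0 * g w) + ?T w * g w =
      C * t * (\<Sum>b\<in>Basis. quad_powr'' (?A w) ((y - w) \<bullet> b) (- s) 0) * g w + ?T w * g w"
      by (simp only: sum_distrib_left sum_distrib_right)
    also have "\<dots> = C * t * (- 2 * s * real DIM('a) * R + 4 * s * (s + 1) * (norm (y - w))\<^sup>2 * W - 6 * s * R + 4 * s * (s + 1) * t\<^sup>2 * W) * g w"
      unfolding E1 E2 by (simp add: algebra_simps)
    \<comment> \<open>The two squares add up to \<open>?A w\<close>, and
      \<open>?A w * W = R\<close>. What remains vanishes by the value of \<open>s\<close>: this
      exponent is the one that makes the kernel harmonic.\<close>
    also have "- 2 * s * real DIM('a) * R + 4 * s * (s + 1) * (norm (y - w))\<^sup>2 * W - 6 * s * R + 4 * s * (s + 1) * t\<^sup>2 * W =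
        2 * s * R * (2 * s - real DIM('a) - 1)"
      unfolding RW by (simp add: algebra_simps)
    also have "2 * s - real DIM('a) - 1 = 0" by (simp add: s_def field_simps)
    finally show "(\<Sum>b\<in>Basis. C * t * quad_powr'' (?A w) ((y - w) \<bullet> b) (- s) 0 * g w) + ?T w * g w = 0" by simp
  qed
  finally have lim: "?S \<longlonglongrightarrow> 0" by simp

  \<comment> \<open>Second differences of the barrier\<close>
  define p where "p = 1 / (16 * real DIM('a))"
  define l where "l = t + 1"
  have l: "1 < l" using t by (simp add: l_def)
  let ?M = "l\<^sup>2 + (norm y)\<^sup>2"
  have M: "0 < ?M" using l by (simp add: add_pos_nonneg)
  have h_space: "(\<lambda>n. (h (y + r n *\<^sub>R b, t) + h (y - r n *\<^sub>R b, t) - 2 * h (y, t)) / (r n)\<^sup>2) \<longlonglongrightarrow> sqrt l * quad_powr'' ?M (y \<bullet> b) p 0"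
    if b: "b \<in> Basis" for b
  proof -
    let ?f = "\<lambda>x. sqrt l * quad ?M (y \<bullet> b) x powr p"
    have Q_eq: "quad ?M (y \<bullet> b) x = l\<^sup>2 + (norm (y + x *\<^sub>R b))\<^sup>2" for x
      unfolding norm_add_Basis_square[OF b] quad_def by simp
    have Q: "0 < quad ?M (y \<bullet> b) x" for x unfolding Q_eq using l by (simp add: add_pos_nonneg)
    have h_eq: "h (y + x *\<^sub>R b, t) = ?f x" for x
      unfolding Q_eq by (simp add: h_def p_def l_def)
    have "(\<lambda>n. (?f (r n) + ?f (- r n) - 2 * ?f 0) / (r n)\<^sup>2) \<longlonglongrightarrow> sqrt l * quad_powr'' ?M (y \<bullet> b) p 0"
      by (rule second_difference_tendsto[of r0 ?f "\<lambda>x. sqrt l * quad_powr' ?M (y \<bullet> b) p x" "\<lambda>x. sqrt l * quad_powr'' ?M (y \<bullet> b) p x", OF _ _ _ r rlim])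
         (intro DERIV_cmult quad_powr_deriv Q continuous_intros isCont_quad_powr'')+
    then show ?thesis
      unfolding h_eq[symmetric] by simp
  qed
  have h_time: "(\<lambda>n. (h (y, t + r n) + h (y, t - r n) - 2 * h (y, t)) / (r n)\<^sup>2) \<longlonglongrightarrow>
      - 1 / (4 * (l * sqrt l)) * ?M powr p + 2 * (1 / (2 * sqrt l)) * quad_powr' ?M l p 0 + sqrt l * quad_powr'' ?M l p 0"
  proof -
    let ?m = "\<lambda>x. sqrt (l + x)" and ?m1 = "\<lambda>x. 1 / (2 * sqrt (l + x))" and ?m2 = "\<lambda>x. - 1 / (4 * ((l + x) * sqrt (l + x)))"
    let ?Q = "quad ?M l"
    let ?f = "\<lambda>x. ?m x * ?Q x powr p"
    let ?f1 = "\<lambda>x. ?m1 x * ?Q x powr p + ?m x * quad_powr' ?M l p x"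
    let ?f2 = "\<lambda>x. ?m2 x * ?Q x powr p + 2 * ?m1 x * quad_powr' ?M l p x + ?m x * quad_powr'' ?M l p x"
    have Q_eq: "?Q x = (l + x)\<^sup>2 + (norm y)\<^sup>2" for x by (simp add: quad_def power2_sum)
    have lx: "0 < l + x" if "\<bar>x\<bar> \<le> r0" for x using that r0 t by (simp add: l_def)
    have Q: "0 < ?Q x" if "\<bar>x\<bar> \<le> r0" for x unfolding Q_eq using lx[OF that] by (simp add: add_pos_nonneg)
    have h_eq: "h (y, t + x) = ?f x" for x
      unfolding Q_eq by (simp add: h_def p_def l_def ac_simps)
    have m1: "(?m has_real_derivative ?m1 x) (at x)" if "0 < l + x" for x
      using that by (auto intro!: derivative_eq_intros simp: field_simps)
    have m2: "(?m1 has_real_derivative ?m2 x) (at x)" if "0 < l + x" for x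
      using that by (auto intro!: derivative_eq_intros simp: field_simps power2_eq_square)
    have "(\<lambda>n. (?f (r n) + ?f (- r n) - 2 * ?f 0) / (r n)\<^sup>2) \<longlonglongrightarrow> ?f2 0"
    proof (rule second_difference_tendsto[of r0 ?f ?f1 ?f2, OF _ _ _ r rlim])
      show "(?f has_real_derivative ?f1 x) (at x)" if "\<bar>x\<bar> \<le> r0" for x
        by (rule product_second_deriv(1)[where m="?m" and ?m1.0="?m1" and ?m2.0="?m2" and g="\<lambda>x. ?Q x powr p"
              and ?g1.0="quad_powr' ?M l p" and ?g2.0="quad_powr'' ?M l p",
              OF m1[OF lx[OF that]] m2[OF lx[OF that]] quad_powr_deriv[OF Q[OF that]]])
      show "(?f1 has_real_derivative ?f2 x) (at x)" if "\<bar>x\<bar> \<le> r0" for x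
        by (rule product_second_deriv(2)[where m="?m" and ?m1.0="?m1" and ?m2.0="?m2" and g="\<lambda>x. ?Q x powr p"
              and ?g1.0="quad_powr' ?M l p" and ?g2.0="quad_powr'' ?M l p",
              OF m1[OF lx[OF that]] m2[OF lx[OF that]] quad_powr_deriv[OF Q[OF that]]])
      have Q00: "0 < ?Q 0" using Q[of 0] r0 by simp
      show "isCont ?f2 0"
        using l by (intro continuous_intros isCont_quad_powr'' DERIV_isCont[OF quad_powr_deriv(1)] DERIV_isCont[OF quad_powr_deriv(2)] Q00) auto
    qed
    moreover have "?Q 0 = ?M" by (simp add: quad_def)
    ultimately show ?thesis
      unfolding h_eq[symmetric] by simp
  qed

  \<comment> \<open>Comparison at the supposed maximum\<close>
  define Lh where "Lh = (\<Sum>b\<in>Basis. sqrt l * quad_powr'' ?M (y \<bullet> b) p 0) +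
     (- 1 / (4 * (l * sqrt l)) * ?M powr p + 2 * (1 / (2 * sqrt l)) * quad_powr' ?M l p 0 + sqrt l * quad_powr'' ?M l p 0)"
  let ?H = "\<lambda>n. (\<Sum>b\<in>Basis. (h (y + r n *\<^sub>R b, t) + h (y - r n *\<^sub>R b, t) - 2 * h (y, t)) / (r n)\<^sup>2) + (h (y, t + r n) + h (y, t - r n) - 2 * h (y, t)) / (r n)\<^sup>2"
  have limH: "(\<lambda>n. \<delta> * ?H n) \<longlonglongrightarrow> \<delta> * Lh"
    unfolding Lh_def by (intro tendsto_intros h_space h_time)
  have "?S n \<le> \<delta> * ?H n" for n
  proof -
    have "(?u (y + r n *\<^sub>R b) t + ?u (y - r n *\<^sub>R b) t - 2 * ?u y t) / (r n)\<^sup>2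
        \<le> \<delta> * ((h (y + r n *\<^sub>R b, t) + h (y - r n *\<^sub>R b, t) - 2 * h (y, t)) / (r n)\<^sup>2)" if b: "b \<in> Basis" for b
    proof -
      have d: "dist (y, t) (y + r n *\<^sub>R b, t) < e" "dist (y, t) (y - r n *\<^sub>R b, t) < e"
        using b r[of n] r0 by (auto simp: dist_Pair_Pair dist_norm)
      from max[OF d(1)] max[OF d(2)]
      have "?u (y + r n *\<^sub>R b) t + ?u (y - r n *\<^sub>R b) t - 2 * ?u y t \<le> \<delta> * (h (y + r n *\<^sub>R b, t) + h (y - r n *\<^sub>R b, t) - 2 * h (y, t))"
        by (simp add: algebra_simps)
      then show ?thesis using r(1)[of n] by (simp add: divide_right_mono)
    qed
    then have "(\<Sum>b\<in>Basis. (?u (y + r n *\<^sub>R b) t + ?u (y - r n *\<^sub>R b) t - 2 * ?u y t) / (r n)\<^sup>2) \<le>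
        (\<Sum>b\<in>Basis. \<delta> * ((h (y + r n *\<^sub>R b, t) + h (y - r n *\<^sub>R b, t) - 2 * h (y, t)) / (r n)\<^sup>2))"
      by (rule sum_mono)
    moreover have "(?u y (t + r n) + ?u y (t - r n) - 2 * ?u y t) / (r n)\<^sup>2 \<le> \<delta> * ((h (y, t + r n) + h (y, t - r n) - 2 * h (y, t)) / (r n)\<^sup>2)"
    proof -
      have "dist (y, t) (y, t') = \<bar>t - t'\<bar>" for t' by (simp add: dist_Pair_Pair dist_real_def)
      then have d: "dist (y, t) (y, t + r n) < e" "dist (y, t) (y, t - r n) < e" using r[of n] r0 by simp_all
      from max[OF d(1)] max[OF d(2)]
      have "?u y (t + r n) + ?u y (t - r n) - 2 * ?u y t \<le> \<delta> * (h (y, t + r n) + h (y, t - r n) - 2 * h (y, t))"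
        by (simp add: algebra_simps)
      then show ?thesis using r(1)[of n] by (simp add: divide_right_mono)
    qed
    ultimately show ?thesis by (simp add: sum_distrib_left distrib_left)
  qed
  then have "0 \<le> \<delta> * Lh" by (intro LIMSEQ_le[OF lim limH]) auto
  moreover have "Lh < 0"
  proof -
    \<comment> \<open>With the lowest power as unit, every term becomes a polynomial multiple of
      \<open>W\<close>, and the sign of \<open>Lh\<close> is that of one bracket.\<close>
    define W where "W = ?M powr (p - 2)"
    have W: "0 < W" using l by (simp add: W_def)
    have W1: "?M powr (p - 1) = ?M * W" using powr_mult_base[OF less_imp_le[OF M], of "p - 2"] by (simp add: W_def)
    have W0: "?M powr p = ?M * (?M * W)" using powr_mult_base[OF less_imp_le[OF M], of "p - 1"] by (simp add: W1)
    have q: "1 / (2 * sqrt l) = sqrt l / (2 * l)" "1 / (4 * (l * sqrt l)) = sqrt l / (4 * l\<^sup>2)"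
      using l by (simp_all add: field_simps power2_eq_square)
    have "(\<Sum>b\<in>Basis. sqrt l * quad_powr'' ?M (y \<bullet> b) p 0) = sqrt l * (2 * p * real DIM('a) * (?M * W) + 4 * p * (p - 1) * (norm y)\<^sup>2 * W)"
      unfolding sum_distrib_left[symmetric] sum_Basis_quad_powr'' W_def[symmetric] W1 ..
    moreover have "2 * (1 / (2 * sqrt l)) * quad_powr' ?M l p 0 = sqrt l * (2 * p * (?M * W))"
      unfolding q quad_powr'_def using l by (simp add: quad_def W1)
    moreover have "quad_powr'' ?M l p 0 = 2 * p * (?M * W) + 4 * p * (p - 1) * l\<^sup>2 * W"
      unfolding quad_powr''_def by (simp add: quad_def W_def[symmetric] W1)
    moreover have "- 1 / (4 * (l * sqrt l)) * ?M powr p = sqrt l * (- (?M / (4 * l\<^sup>2)) * (?M * W))"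
      using q(2) by (simp add: W0)
    ultimately have "Lh = sqrt l * ((2 * p * real DIM('a) * (?M * W) + 4 * p * (p - 1) * (norm y)\<^sup>2 * W) +
        (- (?M / (4 * l\<^sup>2)) * (?M * W) + 2 * p * (?M * W) + (2 * p * (?M * W) + 4 * p * (p - 1) * l\<^sup>2 * W)))"
      unfolding Lh_def by (simp only: distrib_left)
    also have "\<dots> = sqrt l * ((?M * W) * (2 * p * real DIM('a) + 4 * p\<^sup>2 - ?M / (4 * l\<^sup>2)))"
      by (simp add: algebra_simps power2_eq_square)
    also have "\<dots> < 0"
    proof -
      have "l\<^sup>2 / (4 * l\<^sup>2) \<le> ?M / (4 * l\<^sup>2)" using l by (intro divide_right_mono) auto
      then have 1: "1 / 4 \<le> ?M / (4 * l\<^sup>2)" using l by simp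
      \<comment> \<open>Origin of the 16: with \<open>\<gamma> = 2 * p\<close> as exponent of
        \<rho>, the positive part \<open>\<gamma> * (\<gamma> + n) = 2 * p * n + 4 * p^2\<close> is
        at most 1/8 + 1/64, below the 1/4 coming from the square root factor.\<close>
      have 2: "2 * p * real DIM('a) = 1 / 8" by (simp add: p_def)
      have "p \<le> 1 / 16" "0 < p" by (auto simp: p_def field_simps Suc_leI)
      then have "p\<^sup>2 \<le> (1 / 16)\<^sup>2" by (intro power_mono) auto
      then have 3: "p\<^sup>2 \<le> 1 / 256" by (simp add: power2_eq_square)
      have "X + 4 * P - Y < 0" if "1 / 4 \<le> Y" "X = 1 / 8" "P \<le> 1 / 256" for X P Y :: real
        using that by linarith
      from this[OF 1 2 3] have "2 * p * real DIM('a) + 4 * p\<^sup>2 - ?M / (4 * l\<^sup>2) < 0" .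
      moreover have "0 < ?M * W" using M W by simp
      ultimately have "(?M * W) * (2 * p * real DIM('a) + 4 * p\<^sup>2 - ?M / (4 * l\<^sup>2)) < 0" by (rule mult_pos_neg[rotated])
      moreover have "0 < sqrt l" using l by simp
      ultimately show ?thesis by (rule mult_pos_neg[rotated])
    qed
    finally show ?thesis .
  qed
  ultimately show False using \<delta> by (simp add: zero_le_mult_iff)
qed

lemma poisson_averaging_kernel:
  "averaging_kernel (poisson_kernel :: real \<Rightarrow> 'a::euclidean_space \<Rightarrow> real) (\<lambda>t. t)
     (\<lambda>z. sqrt (snd z + 1) * ((snd z + 1)\<^sup>2 + (norm (fst z))\<^sup>2) powr (1 / (16 * real DIM('a))))"
proof
  fix t :: real and v :: 'a assume t: "0 < t"
  show "0 \<le> poisson_kernel t v" using t by (simp add: poisson_nonneg)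
  have nz: "t\<^sup>2 + (norm w)\<^sup>2 \<noteq> 0" for w :: 'a using t by (simp add: add_nonneg_eq_0_iff)
  show "continuous_on UNIV (poisson_kernel t :: 'a \<Rightarrow> real)"
    unfolding poisson_kernel_def using nz by (intro continuous_intros) auto
  show "(\<integral>\<^sup>+ w. ennreal (poisson_kernel t (w::'a)) \<partial>lborel) = 1" using t by (rule poisson_mass)
  show "t ^ DIM('a) * poisson_kernel t (t *\<^sub>R v) = poisson_kernel 1 v"
  proof -
    define s where "s = (real DIM('a) + 1) / 2"
    have "(t\<^sup>2 + (norm (t *\<^sub>R v))\<^sup>2) powr (- s) = (t\<^sup>2 * (1 + (norm v)\<^sup>2)) powr (- s)"
      by (simp add: power_mult_distrib distrib_left)
    also have "\<dots> = (t\<^sup>2) powr (- s) * (1 + (norm v)\<^sup>2) powr (- s)"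
      by (rule powr_mult)
    also have "(t\<^sup>2) powr (- s) = t powr (2 * - s)"
      using powr_powr[of t 2 "- s"] t by simp
    also have "2 * - s = - (real DIM('a) + 1)" by (simp add: s_def field_simps)
    finally have 1: "(t\<^sup>2 + (norm (t *\<^sub>R v))\<^sup>2) powr (- s) = t powr (- (real DIM('a) + 1)) * (1 + (norm v)\<^sup>2) powr (- s)" .
    have "t ^ DIM('a) * t * t powr (- (real DIM('a) + 1)) = t powr real DIM('a) * t powr 1 * t powr (- (real DIM('a) + 1))"
      using t by (simp add: powr_realpow)
    also have "\<dots> = 1" using t by (simp only: powr_add[symmetric]) simp
    finally have 2: "t ^ DIM('a) * t * t powr (- (real DIM('a) + 1)) = 1" .
    have "t ^ DIM('a) * poisson_kernel t (t *\<^sub>R v) = (t ^ DIM('a) * t * t powr (- (real DIM('a) + 1))) *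
        (Gamma s / pi powr s * (1 + (norm v)\<^sup>2) powr (- s))"
      unfolding poisson_kernel_eq s_def[symmetric] 1 by (simp add: mult_ac)
    also have "\<dots> = poisson_kernel 1 v"
      unfolding 2 poisson_kernel_eq s_def[symmetric] by simp
    finally show ?thesis .
  qed
next
  show "bounded {z::'a \<times> real. 0 \<le> snd z \<and> sqrt (snd z + 1) * ((snd z + 1)\<^sup>2 + (norm (fst z))\<^sup>2) powr (1 / (16 * real DIM('a))) \<le> C}" for C
  proof (rule boundedI, clarsimp)
    fix y :: 'a and t :: real
    assume t: "0 \<le> t" and le: "sqrt (t + 1) * ((t + 1)\<^sup>2 + (norm y)\<^sup>2) powr (1 / (16 * real DIM('a))) \<le> C"
    define p where "p = 1 / (16 * real DIM('a))"
    have p: "0 < p" by (simp add: p_def)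
    let ?Q = "(t + 1)\<^sup>2 + (norm y)\<^sup>2"
    have Q: "0 < ?Q" using t by (simp add: add_pos_nonneg)
    \<comment> \<open>The factor \<open>sqrt (t + 1)\<close> is at least 1, so the power of
      \<open>?Q\<close> alone is bounded by \<open>C\<close>; and \<open>?Q\<close> controls both
      the position and the time.\<close>
    have "1 * ?Q powr p \<le> sqrt (t + 1) * ?Q powr p" using t by (intro mult_right_mono) auto
    with le have "?Q powr p \<le> C" by (simp add: p_def)
    then have "(?Q powr p) powr (1 / p) \<le> C powr (1 / p)" using p by (intro powr_mono2) auto
    then have Q2: "?Q \<le> C powr (1 / p)" using p Q by (simp add: powr_powr)
    have "t\<^sup>2 \<le> (t + 1)\<^sup>2" using t by (intro power_mono) auto
    with Q2 have "(norm y)\<^sup>2 + t\<^sup>2 \<le> C powr (1 / p)" by simp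
    then show "norm (y, t) \<le> sqrt (C powr (1 / (1 / (16 * real DIM('a)))))"
      unfolding p_def norm_Pair by simp
  qed
  show "continuous_on (UNIV \<times> {0..}) (\<lambda>z::'a \<times> real. sqrt (snd z + 1) * ((snd z + 1)\<^sup>2 + (norm (fst z))\<^sup>2) powr (1 / (16 * real DIM('a))))"
    by (intro continuous_intros) (auto simp: add_nonneg_eq_0_iff)
  show "\<exists>z\<in>ball (y, t) e. Kext poisson_kernel g y t - \<delta> * (sqrt (snd (y, t) + 1) * ((snd (y, t) + 1)\<^sup>2 + (norm (fst (y, t)))\<^sup>2) powr (1 / (16 * real DIM('a))))
      < Kext poisson_kernel g (fst z) (snd z) - \<delta> * (sqrt (snd z + 1) * ((snd z + 1)\<^sup>2 + (norm (fst z))\<^sup>2) powr (1 / (16 * real DIM('a))))"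
    if "g \<in> borel_measurable borel" "\<And>w. \<bar>g w\<bar> \<le> B" "0 < t" "0 < \<delta>" "0 < e" for g B and y :: 'a and t \<delta> e
    using that by (rule poisson_no_local_max)
  show "continuous_on {0..} (\<lambda>t::real. t)" by (intro continuous_intros)
qed auto

theorem theorem3p1:
  fixes K :: "real \<Rightarrow> 'a::euclidean_space \<Rightarrow> real"
    and f :: "real \<Rightarrow> real"
    and \<mu> \<mu>' :: real
    and x :: "real \<times> real"
  assumes "K = poisson_kernel \<or> K = heat_kernel"
    and "f \<in> borel_measurable borel"
    and "\<And>s. f s \<ge> 0"
    and "0 < \<mu>'" and "\<mu>' < \<mu>"
    and "x \<in> Omega \<mu>'"
  shows "BK K \<mu>' f x \<le> Bstar \<mu> f x"
  using assms(1)
proof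
  assume "K = poisson_kernel"
  then show ?thesis
    using averaging_kernel.BK_le_Bstar[OF poisson_averaging_kernel assms(2,4,5)] by simp
next
  assume "K = heat_kernel"
  then show ?thesis
    using averaging_kernel.BK_le_Bstar[OF heat_averaging_kernel assms(2,4,5)] by simp
qed

end
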